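(* Let $T>1$, $\Lambda_1=[-1,1]$, $f\in L^2(\Lambda_1)$, and let $\mathcal F$, $\mathcal B_h$, $\mathcal R=\mathcal B_{h_r}$, $\mathcal G=\mathcal F\mathcal R^{-1}$ with singular values $(\sigma_i)$, $c_{\mathcal B}^{\dag}$ (with respect to $h_s$) and $\mathcal T_k$ be as defined in the context. Suppose $\|\mathcal B_{h_s}c_{\mathcal B}^{\dag}\|_{\ell^2}\le E$ for some constant $E>0$, and that there is a constant $C_0$ with $\sup_{\ell}\frac{h_r(|\ell|)}{h_s(|\ell|)}\le C_0$. For $\epsilon\in(0,\sigma_1)$ let $f^\epsilon\in L^2(\Lambda_1)$ satisfy $|f^\epsilon(x)-f(x)|\le\epsilon$ for all $x\in\Lambda_1$, let $\eta=\sup\{k\mid\sigma_k>\epsilon\}$ and $c^{\epsilon,\eta}=\mathcal R^{-1}\mathcal T_\eta f^\epsilon$. Then the following hold as $\epsilon\to0$. 1. If $h_s(x)=\sqrt{1+x^{2s}}$, $f\in H^s(\Lambda_1)$, and $h_r(x)=\sqrt{1+x^{2r}}$ with $0<r\le s$, then $$\|\mathcal F c^{\epsilon,\eta}-f\|_{L^2(\Lambda_1)}=O(\epsilon),$$ and $$\|\mathcal F c^{\epsilon,\eta}-f\|_{H^r(\Lambda_1)}\le \|\mathcal R(c^{\epsilon,\eta}-c_{\mathcal B}^{\dag})\|_{\ell^2}=O(1).$$ Moreover, by the interpolation inequality in Sobolev spaces, for any $0\le q\le r$, $$\|\mathcal F c^{\epsilon,\eta}-f\|_{H^q(\Lambda_1)}=O\bigl(\epsilon^{\frac{r-q}{r}}\bigr).$$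 2. If $h_s(x)=\mathrm e^{a|x|^s}$ with $a>0$, $0<s\le1$, and $h_r(x)=\mathrm e^{a|x|^r}$ with $0<r\le s$, then $$\|\mathcal F c^{\epsilon,\eta}-f\|_{L^2(\Lambda_1)}=O(\epsilon),$$ and for every $p\ge0$ there is a constant $C_p$, independent of $\epsilon$ and $f^\epsilon$, such that $$\|\mathcal F c^{\epsilon,\eta}-f\|_{H^p(\Lambda_1)}\le C_p\|\mathcal R(c^{\epsilon,\eta}-c_{\mathcal B}^{\dag})\|_{\ell^2}=O(1).$$ Consequently, for every $p>0$ and any $0\le q\le p$, $$\|\mathcal F c^{\epsilon,\eta}-f\|_{H^q(\Lambda_1)}=O\bigl(\epsilon^{\frac{p-q}{p}}\bigr).$$
   Context: Fix $T>1$ and $\Lambda_1=[-1,1]$. Put $\phi_0(x)=\frac1{\sqrt2}$ and $\phi_\ell(x)=e^{\mathrm i\frac{\pi}{T}\ell x}$ for $\ell=\pm1,\pm2,\dots$, $x\in\Lambda_1$. $\ell^2=\ell^2(\mathbb Z)$ (complex sequences $c=\{\hat c_\ell\}_{\ell\in\mathbb Z}$). $H^q(\Lambda_1)$ is the usual ($L^2$-based) Sobolev space of order $q\ge0$ on the interval, with $H^0=L^2$. The operator $\mathcal F:\ell^2\to L^2(\Lambda_1)$ is $\mathcal F c=\sum_{\ell\in\mathbb Z}\hat c_\ell\phi_\ell$. For a non-decreasing $h:[0,\infty)\to(0,\infty)$ with $\lim_{x\to\infty}h(x)=\infty$, $\mathcal B_h:\mathcal D(\mathcal B_h)\subset\ell^2\to\ell^2$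 is the diagonal operator $c\mapsto\{h(|\ell|)\hat c_\ell\}_{\ell\in\mathbb Z}$ with its maximal domain. A least-squares solution of $\mathcal F c=f$ is a $c^\star\in\ell^2$ with $\|\mathcal F c^\star-f\|_{L^2(\Lambda_1)}=\inf_{c\in\ell^2}\|\mathcal F c-f\|_{L^2(\Lambda_1)}$. The weighted best-approximation solution $c_{\mathcal B}^{\dag}$ is the least-squares solution in $\mathcal D(\mathcal B_{h_s})$ that minimizes $\|\mathcal B_{h_s}c^\star\|_{\ell^2}$ among all least-squares solutions $c^\star$ (in $\mathcal D(\mathcal B_{h_s})$); the hypothesis $\|\mathcal B_{h_s}c_{\mathcal B}^{\dag}\|_{\ell^2}\le E$ includes that such least-squares solutions exist. $\mathcal R=\mathcal B_{h_r}$ and $\mathcal G=\mathcal F\mathcal R^{-1}:\ell^2\to L^2(\Lambda_1)$, which is compact. $(\sigma_i,v_i,u_i)_{i\ge1}$ is a singular system of $\mathcal G$ with $\sigma_1\ge\sigma_2\ge\cdots>0$: $\{v_i\}\subset\ell^2$ and $\{u_i\}\subset L^2(\Lambda_1)$ are orthonormal systems with $\mathcal G v_i=\sigma_iu_i$, $\mathcal G^*u_i=\sigma_iv_i$, and $\mathcal G x=\sum_i\sigma_i\langle x,v_i\rangle u_i$. For $k\ge1$, $\mathcal T_k:L^2(\Lambda_1)\to\ell^2$ is $\mathcal T_kg=\sum_{i=1}^k\frac1{\sigma_i}\langle g,u_i\rangle v_i$. The implied constants in $O(\cdot)$ are independent of $\epsilon$ and of the choice of $f^\epsilon$ (they may depend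 on $f$, $T$, $E$, the weights, and the Sobolev orders).
   Formalization: In item 1 the inequality with constant 1 between the H^r norm of the error and the norm of R(c−c†) is proved for some norm on H^r equivalent to the usual one and depending only on T and r; for the usual norm it fails (f=0, f^ε a multiple of u_1, since σ_1>1). *)

theory Defs
  imports "HOL-Analysis.Analysis"
begin

section \<open>Square-summable sequences and square-integrable functions\<close>

definition ell2 :: "(int \<Rightarrow> complex) set" where
  "ell2 = {c. (\<lambda>l. (cmod (c l))\<^sup>2) summable_on UNIV}"

definition ell2_inner :: "(int \<Rightarrow> complex) \<Rightarrow> (int \<Rightarrow> complex) \<Rightarrow> complex" where
  "ell2_inner c d = (\<Sum>\<^sub>\<infinity>l. c l * cnj (d l))"

definition ell2_norm :: "(int \<Rightarrow> complex) \<Rightarrow> real" where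
  "ell2_norm c = sqrt (\<Sum>\<^sub>\<infinity>l. (cmod (c l))\<^sup>2)"

abbreviation Lam :: "real measure" where
  "Lam \<equiv> lebesgue_on {-1..1}"

text \<open>Elements of \<open>L\<^sup>2(-1,1)\<close> are represented by functions; two representatives of the
  same element agree almost everywhere on \<open>[-1,1]\<close>, and values outside are irrelevant.\<close>

definition L2 :: "(real \<Rightarrow> complex) set" where
  "L2 = {g. g \<in> borel_measurable Lam \<and> integrable Lam (\<lambda>x. (cmod (g x))\<^sup>2)}"

definition L2_inner :: "(real \<Rightarrow> complex) \<Rightarrow> (real \<Rightarrow> complex) \<Rightarrow> complex" where
  "L2_inner g k = (LINT x|Lam. g x * cnj (k x))"

definition L2_norm :: "(real \<Rightarrow> complex) \<Rightarrow> real" where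
  "L2_norm g = sqrt (LINT x|Lam. (cmod (g x))\<^sup>2)"


section \<open>Sobolev spaces on the interval\<close>

definition test_fun :: "(real \<Rightarrow> real) set" where
  "test_fun = {\<psi>. (\<forall>n x. (deriv ^^ n) \<psi> differentiable (at x)) \<and>
     (\<exists>a b. -1 < a \<and> b < 1 \<and> (\<forall>x. x \<notin> {a..b} \<longrightarrow> \<psi> x = 0))}"

definition is_weak_deriv :: "nat \<Rightarrow> (real \<Rightarrow> complex) \<Rightarrow> (real \<Rightarrow> complex) \<Rightarrow> bool" where
  "is_weak_deriv j g w \<longleftrightarrow> w \<in> L2 \<and>
     (\<forall>\<psi>\<in>test_fun. (LINT x|Lam. g x * of_real ((deriv ^^ j) \<psi> x))
        = (-1) ^ j * (LINT x|Lam. w x * of_real (\<psi> x)))"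

text \<open>Weak derivatives are unique up to null sets; an arbitrary representative is taken.\<close>

definition weak_deriv :: "nat \<Rightarrow> (real \<Rightarrow> complex) \<Rightarrow> real \<Rightarrow> complex" where
  "weak_deriv j g = (SOME w. is_weak_deriv j g w)"

text \<open>For real order \<open>q = m + \<theta>\<close> with \<open>m = \<lfloor>q\<rfloor>\<close> and \<open>0 \<le> \<theta> < 1\<close> this is the
  Sobolev--Slobodeckij space: weak derivatives up to order \<open>m\<close> in \<open>L\<^sup>2\<close>, and, for
  \<open>\<theta> > 0\<close>, a finite Gagliardo double integral of the derivative of order \<open>m\<close>.\<close>

definition gagliardo :: "real \<Rightarrow> (real \<Rightarrow> complex) \<Rightarrow> real \<times> real \<Rightarrow> real" where
  "gagliardo \<theta> w = (\<lambda>(x, y). (cmod (w x - w y))\<^sup>2 / \<bar>x - y\<bar> powr (1 + 2 * \<theta>))"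

definition sobolev :: "real \<Rightarrow> (real \<Rightarrow> complex) set" where
  "sobolev q = {g \<in> L2. (\<forall>j\<le>nat \<lfloor>q\<rfloor>. \<exists>w. is_weak_deriv j g w) \<and>
     (frac q > 0 \<longrightarrow>
       integrable (Lam \<Otimes>\<^sub>M Lam) (gagliardo (frac q) (weak_deriv (nat \<lfloor>q\<rfloor>) g)))}"

definition sobolev_norm :: "real \<Rightarrow> (real \<Rightarrow> complex) \<Rightarrow> real" where
  "sobolev_norm q g = sqrt ((\<Sum>j\<le>nat \<lfloor>q\<rfloor>. (L2_norm (weak_deriv j g))\<^sup>2) +
     (if frac q > 0
      then (LINT z|(Lam \<Otimes>\<^sub>M Lam). gagliardo (frac q) (weak_deriv (nat \<lfloor>q\<rfloor>) g) z)
      else 0))"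

text \<open>The Hilbert space topology of \<open>H\<^sup>q(-1,1)\<close> determines its norm only up to equivalence;
  the following are the admissible choices. (Nonnegativity and definiteness up to null sets
  follow from the two-sided bound.)\<close>

definition equivalent_sobolev_norm :: "real \<Rightarrow> ((real \<Rightarrow> complex) \<Rightarrow> real) \<Rightarrow> bool" where
  "equivalent_sobolev_norm q N \<longleftrightarrow>
     (\<forall>g\<in>sobolev q. \<forall>k\<in>sobolev q. N (\<lambda>x. g x + k x) \<le> N g + N k) \<and>
     (\<forall>z. \<forall>g\<in>sobolev q. N (\<lambda>x. z * g x) = cmod z * N g) \<and>
     (\<exists>a>0. \<exists>b. \<forall>g\<in>sobolev q. a * sobolev_norm q g \<le> N g \<and> N g \<le> b * sobolev_norm q g)"


section \<open>The Fourier extension operator and diagonal weights\<close>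

definition phi :: "real \<Rightarrow> int \<Rightarrow> real \<Rightarrow> complex" where
  "phi T l x = (if l = 0 then of_real (1 / sqrt 2)
                else exp (\<i> * of_real (pi / T * of_int l * x)))"

text \<open>\<open>fext T c\<close> is a representative of the sum of \<open>c l * phi T l\<close> over all integers \<open>l\<close>,
  converging (unconditionally) in \<open>L\<^sup>2\<close>.\<close>

definition fext :: "real \<Rightarrow> (int \<Rightarrow> complex) \<Rightarrow> real \<Rightarrow> complex" where
  "fext T c = (SOME g. g \<in> L2 \<and>
     ((\<lambda>S. L2_norm (\<lambda>x. (\<Sum>l\<in>S. c l * phi T l x) - g x)) \<longlongrightarrow> 0)
       (finite_subsets_at_top UNIV))"

definition diag_op :: "(real \<Rightarrow> real) \<Rightarrow> (int \<Rightarrow> complex) \<Rightarrow> int \<Rightarrow> complex" where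
  "diag_op h c = (\<lambda>l. of_real (h (of_int \<bar>l\<bar>)) * c l)"

definition diag_dom :: "(real \<Rightarrow> real) \<Rightarrow> (int \<Rightarrow> complex) set" where
  "diag_dom h = {c \<in> ell2. diag_op h c \<in> ell2}"

definition diag_inv :: "(real \<Rightarrow> real) \<Rightarrow> (int \<Rightarrow> complex) \<Rightarrow> int \<Rightarrow> complex" where
  "diag_inv h = the_inv_into (diag_dom h) (diag_op h)"

definition alg_weight :: "real \<Rightarrow> real \<Rightarrow> real" where
  "alg_weight s x = sqrt (1 + x powr (2 * s))"

definition exp_weight :: "real \<Rightarrow> real \<Rightarrow> real \<Rightarrow> real" where
  "exp_weight a s x = exp (a * \<bar>x\<bar> powr s)"

definition least_squares_sol :: "real \<Rightarrow> (real \<Rightarrow> complex) \<Rightarrow> (int \<Rightarrow> complex) set" where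
  "least_squares_sol T f = {c \<in> ell2.
     L2_norm (\<lambda>x. fext T c x - f x) = (INF d\<in>ell2. L2_norm (\<lambda>x. fext T d x - f x))}"

definition weighted_best_approx ::
  "real \<Rightarrow> (real \<Rightarrow> real) \<Rightarrow> (real \<Rightarrow> complex) \<Rightarrow> (int \<Rightarrow> complex) \<Rightarrow> bool" where
  "weighted_best_approx T h f c \<longleftrightarrow> c \<in> least_squares_sol T f \<inter> diag_dom h \<and>
     (\<forall>d \<in> least_squares_sol T f \<inter> diag_dom h.
        ell2_norm (diag_op h c) \<le> ell2_norm (diag_op h d))"


section \<open>Singular systems and the truncated singular value decomposition\<close>

definition Gop :: "real \<Rightarrow> (real \<Rightarrow> real) \<Rightarrow> (int \<Rightarrow> complex) \<Rightarrow> real \<Rightarrow> complex" where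
  "Gop T h c = fext T (diag_inv h c)"

text \<open>Sequences are indexed from 1; the values at index 0 are unused. The condition
  involving \<open>L2_inner (Gop T h c) (u i)\<close> for all \<open>c\<close> says that the adjoint of \<open>Gop T h\<close>
  maps \<open>u i\<close> to \<open>\<sigma> i\<close> times \<open>v i\<close>.\<close>

definition singular_system ::
  "real \<Rightarrow> (real \<Rightarrow> real) \<Rightarrow> (nat \<Rightarrow> real) \<Rightarrow> (nat \<Rightarrow> int \<Rightarrow> complex) \<Rightarrow>
   (nat \<Rightarrow> real \<Rightarrow> complex) \<Rightarrow> bool" where
  "singular_system T h \<sigma> v u \<longleftrightarrow>
     (\<forall>i\<ge>1. \<sigma> i > 0 \<and> \<sigma> (Suc i) \<le> \<sigma> i) \<and>
     (\<forall>i\<ge>1. v i \<in> ell2 \<and> u i \<in> L2) \<and>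
     (\<forall>i\<ge>1. \<forall>j\<ge>1. ell2_inner (v i) (v j) = (if i = j then 1 else 0)) \<and>
     (\<forall>i\<ge>1. \<forall>j\<ge>1. L2_inner (u i) (u j) = (if i = j then 1 else 0)) \<and>
     (\<forall>i\<ge>1. AE x in Lam. Gop T h (v i) x = of_real (\<sigma> i) * u i x) \<and>
     (\<forall>i\<ge>1. \<forall>c\<in>ell2. L2_inner (Gop T h c) (u i) = ell2_inner c (\<lambda>l. of_real (\<sigma> i) * v i l)) \<and>
     (\<forall>c\<in>ell2. (\<lambda>n. L2_norm (\<lambda>x. Gop T h c x -
        (\<Sum>i=1..n. of_real (\<sigma> i) * ell2_inner c (v i) * u i x))) \<longlonglongrightarrow> 0)"

definition tsvd ::
  "(nat \<Rightarrow> real) \<Rightarrow> (nat \<Rightarrow> int \<Rightarrow> complex) \<Rightarrow> (nat \<Rightarrow> real \<Rightarrow> complex) \<Rightarrow> nat \<Rightarrow>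
   (real \<Rightarrow> complex) \<Rightarrow> int \<Rightarrow> complex" where
  "tsvd \<sigma> v u k g = (\<lambda>l. \<Sum>i=1..k. of_real (1 / \<sigma> i) * L2_inner g (u i) * v i l)"

definition cutoff :: "(nat \<Rightarrow> real) \<Rightarrow> real \<Rightarrow> nat" where
  "cutoff \<sigma> \<epsilon> = Sup {k. 1 \<le> k \<and> \<sigma> k > \<epsilon>}"

definition reg_sol ::
  "(real \<Rightarrow> real) \<Rightarrow> (nat \<Rightarrow> real) \<Rightarrow> (nat \<Rightarrow> int \<Rightarrow> complex) \<Rightarrow> (nat \<Rightarrow> real \<Rightarrow> complex) \<Rightarrow>
   real \<Rightarrow> (real \<Rightarrow> complex) \<Rightarrow> int \<Rightarrow> complex" where
  "reg_sol h \<sigma> v u \<epsilon> fe = diag_inv h (tsvd \<sigma> v u (cutoff \<sigma> \<epsilon>) fe)"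

definition noisy :: "(real \<Rightarrow> complex) \<Rightarrow> real \<Rightarrow> (real \<Rightarrow> complex) set" where
  "noisy f \<epsilon> = {fe \<in> L2. \<forall>x\<in>{-1..1}. cmod (fe x - f x) \<le> \<epsilon>}"

definition admissible ::
  "real \<Rightarrow> (real \<Rightarrow> real) \<Rightarrow> (real \<Rightarrow> real) \<Rightarrow> (real \<Rightarrow> complex) \<Rightarrow> real \<Rightarrow> real \<Rightarrow>
   (int \<Rightarrow> complex) \<Rightarrow> (nat \<Rightarrow> real) \<Rightarrow> (nat \<Rightarrow> int \<Rightarrow> complex) \<Rightarrow>
   (nat \<Rightarrow> real \<Rightarrow> complex) \<Rightarrow> bool" where
  "admissible T hr hs f E C0 cd \<sigma> v u \<longleftrightarrow>
     f \<in> L2 \<and>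
     weighted_best_approx T hs f cd \<and> 0 < E \<and> ell2_norm (diag_op hs cd) \<le> E \<and>
     (\<forall>l::int. hr (of_int \<bar>l\<bar>) / hs (of_int \<bar>l\<bar>) \<le> C0) \<and>
     singular_system T hr \<sigma> v u"

text \<open>\<open>g \<epsilon> y = O(b \<epsilon>)\<close> as \<open>\<epsilon>\<close> tends to 0 from the right, uniformly in \<open>y \<in> A \<epsilon>\<close>.\<close>

definition unif_bigo ::
  "(real \<Rightarrow> 'a set) \<Rightarrow> (real \<Rightarrow> 'a \<Rightarrow> real) \<Rightarrow> (real \<Rightarrow> real) \<Rightarrow> bool" where
  "unif_bigo A g b \<longleftrightarrow>
     (\<exists>C. eventually (\<lambda>\<epsilon>. \<forall>y\<in>A \<epsilon>. \<bar>g \<epsilon> y\<bar> \<le> C * b \<epsilon>) (at_right 0))"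

end

theory Submission
  imports Defs
begin

text \<open>Since \<open>T > 1\<close>, trigonometric sums of period \<open>2T\<close> are dense in \<open>L\<^sup>2(-1,1)\<close>, so the
  least-squares solution solves \<open>\<F> c\<^sup>\<dagger> = f\<close> exactly and the error is \<open>\<F> d\<close> with
  \<open>d = c - c\<^sup>\<dagger>\<close>. Expanding \<open>\<R> d\<close> in the singular vectors and cutting at \<open>\<sigma> = \<epsilon>\<close> gives
  \<open>\<parallel>\<R> d\<parallel> = O(1)\<close> and \<open>\<parallel>\<F> d\<parallel> = O(\<epsilon>)\<close>.

  The norm of \<open>d\<close> itself need not be small, because \<open>\<F>\<close> has a kernel, so the interpolation
  inequality cannot be read off the coefficients. Instead \<open>d\<close> is split at the frequency
  \<open>\<epsilon> powr (- 1 / r)\<close>. The high frequencies are controlled by \<open>\<parallel>\<R> d\<parallel>\<close> alone. The low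
  frequencies form a trigonometric polynomial that is \<open>O(\<epsilon>)\<close> on the interval and whose
  derivative of a large integer order is bounded through its coefficients; integer-order
  interpolation on the interval (Landau's inequality) then bounds all derivatives in between,
  and the fractional seminorm by splitting its kernel at distance \<open>\<epsilon> powr (1 / r)\<close>.\<close>

section \<open>Square-integrable functions\<close>

text \<open>The same Hilbert space arguments are needed over four measures: counting measure on the
  integers for the coefficients, the interval, the period \<open>{-T..T}\<close> where the
  exponentials are orthogonal, and the square of the interval, where the Gagliardo integrand is a
  squared modulus. Hence norm and inner product are developed over an arbitrary measure.

  The rate needs only that the singular values tend to 0. Up to the cutoff index the noise, of norm
  at most \<open>sqrt 2 * \<epsilon>\<close>, is amplified by less than
  \<open>1 / \<epsilon>\<close>; past it the discarded exact part is damped by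
  \<open>\<sigma> i \<le> \<epsilon>\<close>. One constant, \<open>sqrt 2 + C0 * E\<close>,
  therefore bounds both the weighted error and the residual divided by \<epsilon>.

  Since \<open>fext\<close> and \<open>weak_deriv\<close> are arbitrary choices of representatives,
  norms are computed from explicit Fourier series and transferred by almost everywhere uniqueness;
  for weak derivatives this calls for smooth bump functions.

  The exponential weight dominates every algebraic one, so both parts share one argument.\<close>

definition sqi :: "'a measure \<Rightarrow> ('a \<Rightarrow> complex) set" where
  "sqi M = {g \<in> borel_measurable M. integrable M (\<lambda>x. (cmod (g x))\<^sup>2)}"

definition nrm :: "'a measure \<Rightarrow> ('a \<Rightarrow> complex) \<Rightarrow> real" where
  "nrm M g = sqrt (LINT x|M. (cmod (g x))\<^sup>2)"

definition ip :: "'a measure \<Rightarrow> ('a \<Rightarrow> complex) \<Rightarrow> ('a \<Rightarrow> complex) \<Rightarrow> complex" where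
  "ip M g k = (LINT x|M. g x * cnj (k x))"

lemma sqi_measurable [measurable_dest]: "g \<in> sqi M \<Longrightarrow> g \<in> borel_measurable M"
  by (simp add: sqi_def)

lemma sqi_integrable: "g \<in> sqi M \<Longrightarrow> integrable M (\<lambda>x. (cmod (g x))\<^sup>2)"
  by (simp add: sqi_def)

lemma nrm_nonneg [simp]: "0 \<le> nrm M g"
  by (simp add: nrm_def)

lemma nrm_square: "(nrm M g)\<^sup>2 = (LINT x|M. (cmod (g x))\<^sup>2)"
  by (simp add: nrm_def)

lemma sqi_bound:
  assumes "f \<in> borel_measurable M" "integrable M h" "\<And>x. (cmod (f x))\<^sup>2 \<le> h x"
  shows "f \<in> sqi M"
proof -
  have "integrable M (\<lambda>x. (cmod (f x))\<^sup>2)"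
    by (rule Bochner_Integration.integrable_bound[OF assms(2)])
      (use assms in \<open>auto intro!: AE_I2 order_trans[OF assms(3)]\<close>)
  thus ?thesis using assms by (simp add: sqi_def)
qed

lemma cmod_add_square_le: "(cmod (a + b))\<^sup>2 \<le> 2 * (cmod a)\<^sup>2 + 2 * (cmod b)\<^sup>2"
proof -
  have "(cmod (a + b))\<^sup>2 \<le> (cmod a + cmod b)\<^sup>2"
    by (simp add: norm_triangle_ineq power_mono)
  also have "\<dots> \<le> 2 * (cmod a)\<^sup>2 + 2 * (cmod b)\<^sup>2"
    using sum_squares_bound[of "cmod a" "cmod b"] by (simp add: power2_sum)
  finally show ?thesis .
qed

lemma sqi_zero [simp]: "(\<lambda>x. 0) \<in> sqi M"
  by (simp add: sqi_def)

lemma sqi_cmult: "g \<in> sqi M \<Longrightarrow> (\<lambda>x. z * g x) \<in> sqi M"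
  by (auto simp: sqi_def norm_mult power_mult_distrib)

lemma sqi_add: "g \<in> sqi M \<Longrightarrow> k \<in> sqi M \<Longrightarrow> (\<lambda>x. g x + k x) \<in> sqi M"
  by (rule sqi_bound[where h = "\<lambda>x. 2 * (cmod (g x))\<^sup>2 + 2 * (cmod (k x))\<^sup>2"])
    (auto simp: sqi_def cmod_add_square_le)

lemma sqi_diff: "g \<in> sqi M \<Longrightarrow> k \<in> sqi M \<Longrightarrow> (\<lambda>x. g x - k x) \<in> sqi M"
  using sqi_add[of g M "\<lambda>x. (-1) * k x"] sqi_cmult[of k M "-1"] by simp

lemma sqi_sum: "(\<And>i. i \<in> I \<Longrightarrow> g i \<in> sqi M) \<Longrightarrow> (\<lambda>x. \<Sum>i\<in>I. g i x) \<in> sqi M"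
  by (induction I rule: infinite_finite_induct) (auto intro: sqi_add)

lemma sqi_AE_cong:
  assumes "g \<in> sqi M" "AE x in M. g x = k x" "k \<in> borel_measurable M"
  shows "k \<in> sqi M"
proof -
  have "integrable M (\<lambda>x. (cmod (k x))\<^sup>2)"
    by (rule integrable_cong_AE_imp[OF sqi_integrable[OF assms(1)]]) (use assms in auto)
  thus ?thesis using assms by (simp add: sqi_def)
qed

lemma nrm_AE_cong:
  assumes "AE x in M. g x = k x" "g \<in> borel_measurable M" "k \<in> borel_measurable M"
  shows "nrm M g = nrm M k"
proof -
  have "(LINT x|M. (cmod (g x))\<^sup>2) = (LINT x|M. (cmod (k x))\<^sup>2)"
    by (rule integral_cong_AE) (use assms in auto)
  thus ?thesis by (simp add: nrm_def)
qed

lemma borel_measurable_cnj [measurable (raw)]: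
  "f \<in> borel_measurable M \<Longrightarrow> (\<lambda>x. cnj (f x)) \<in> borel_measurable M"
  by (rule measurable_compose[OF _ borel_measurable_continuous_onI[OF continuous_on_cnj[OF continuous_on_id]]])

lemma ip_AE_cong:
  assumes "AE x in M. g x = g' x" "g \<in> borel_measurable M" "g' \<in> borel_measurable M"
    "k \<in> borel_measurable M"
  shows "ip M g k = ip M g' k"
  unfolding ip_def by (rule integral_cong_AE) (use assms in auto)

lemma integrable_ip:
  assumes "g \<in> sqi M" "k \<in> sqi M"
  shows "integrable M (\<lambda>x. g x * cnj (k x))"
proof (rule Bochner_Integration.integrable_bound)
  show "integrable M (\<lambda>x. (cmod (g x))\<^sup>2 + (cmod (k x))\<^sup>2)"
    using assms by (auto simp: sqi_def)
  have "cmod (g x) * cmod (k x) \<le> (cmod (g x))\<^sup>2 + (cmod (k x))\<^sup>2" for x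
    using sum_squares_bound[of "cmod (g x)" "cmod (k x)"]
      mult_nonneg_nonneg[OF norm_ge_zero norm_ge_zero, of "g x" "k x"] by linarith
  thus "AE x in M. norm (g x * cnj (k x)) \<le> norm ((cmod (g x))\<^sup>2 + (cmod (k x))\<^sup>2)"
    by (auto simp: norm_mult)
qed (use assms in auto)

lemma ip_self: "ip M g g = of_real ((nrm M g)\<^sup>2)"
  by (simp only: ip_def nrm_square complex_norm_square[symmetric] integral_complex_of_real)

lemma ip_commute: "ip M g k = cnj (ip M k g)"
  unfolding ip_def Bochner_Integration.integral_cnj [symmetric] by (simp add: mult.commute)

lemma ip_cmult_left: "ip M (\<lambda>x. z * g x) k = z * ip M g k"
  unfolding ip_def by (simp add: mult.assoc)

lemma ip_cmult_right: "ip M g (\<lambda>x. z * k x) = cnj z * ip M g k"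
  unfolding ip_def
  by (subst integral_mult_right_zero[symmetric]) (simp add: mult_ac)

lemma ip_add_left:
  "g \<in> sqi M \<Longrightarrow> g' \<in> sqi M \<Longrightarrow> k \<in> sqi M \<Longrightarrow> ip M (\<lambda>x. g x + g' x) k = ip M g k + ip M g' k"
  unfolding ip_def by (simp add: distrib_right integrable_ip)

lemma ip_diff_left:
  "g \<in> sqi M \<Longrightarrow> g' \<in> sqi M \<Longrightarrow> k \<in> sqi M \<Longrightarrow> ip M (\<lambda>x. g x - g' x) k = ip M g k - ip M g' k"
  unfolding ip_def by (simp add: left_diff_distrib integrable_ip)

lemma ip_diff_right:
  "g \<in> sqi M \<Longrightarrow> g' \<in> sqi M \<Longrightarrow> k \<in> sqi M \<Longrightarrow> ip M k (\<lambda>x. g x - g' x) = ip M k g - ip M k g'"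
  unfolding ip_commute[of M k] by (simp add: ip_diff_left)

lemma ip_add_right:
  "g \<in> sqi M \<Longrightarrow> g' \<in> sqi M \<Longrightarrow> k \<in> sqi M \<Longrightarrow> ip M k (\<lambda>x. g x + g' x) = ip M k g + ip M k g'"
  unfolding ip_commute[of M k] by (simp add: ip_add_left)

lemma ip_sum_left:
  "(\<And>i. i \<in> I \<Longrightarrow> g i \<in> sqi M) \<Longrightarrow> k \<in> sqi M \<Longrightarrow> ip M (\<lambda>x. \<Sum>i\<in>I. g i x) k = (\<Sum>i\<in>I. ip M (g i) k)"
  unfolding ip_def by (simp add: sum_distrib_right integrable_ip)

lemma ip_sum_right:
  "(\<And>i. i \<in> I \<Longrightarrow> g i \<in> sqi M) \<Longrightarrow> k \<in> sqi M \<Longrightarrow> ip M k (\<lambda>x. \<Sum>i\<in>I. g i x) = (\<Sum>i\<in>I. ip M k (g i))"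
  unfolding ip_commute[of M k] by (simp add: ip_sum_left)

lemma nrm_cmult: "nrm M (\<lambda>x. z * g x) = cmod z * nrm M g"
  by (simp add: nrm_def norm_mult power_mult_distrib real_sqrt_mult)

lemma nrm_minus_commute: "nrm M (\<lambda>x. g x - k x) = nrm M (\<lambda>x. k x - g x)"
  by (simp add: nrm_def norm_minus_commute)

lemma nrm_zero_AE:
  assumes "g \<in> sqi M" "nrm M g = 0"
  shows "AE x in M. g x = 0"
proof -
  have "(LINT x|M. (cmod (g x))\<^sup>2) = 0" using assms(2) by (simp add: nrm_def)
  hence "AE x in M. (cmod (g x))\<^sup>2 = 0"
    using integral_nonneg_eq_0_iff_AE[OF sqi_integrable[OF assms(1)]] by simp
  thus ?thesis by simp
qed

section \<open>Orthonormal families: Pythagoras, Bessel, Cauchy-Schwarz, triangle inequality\<close>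

lemma nrm_diff_orthonormal_sum:
  assumes I: "finite I" and v: "\<And>i. i \<in> I \<Longrightarrow> v i \<in> sqi M"
    and on: "\<And>i j. i \<in> I \<Longrightarrow> j \<in> I \<Longrightarrow> ip M (v i) (v j) = (if i = j then 1 else 0)"
    and x: "x \<in> sqi M"
  shows "(nrm M (\<lambda>t. x t - (\<Sum>i\<in>I. a i * v i t)))\<^sup>2
    = (nrm M x)\<^sup>2 - 2 * Re (\<Sum>i\<in>I. cnj (a i) * ip M x (v i)) + (\<Sum>i\<in>I. (cmod (a i))\<^sup>2)"
proof -
  let ?s = "\<lambda>t. \<Sum>i\<in>I. a i * v i t"
  have s: "?s \<in> sqi M" using v by (intro sqi_sum sqi_cmult)
  have av: "(\<lambda>t. a i * v i t) \<in> sqi M" if "i \<in> I" for i using v that by (intro sqi_cmult)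
  have xs: "ip M x ?s = (\<Sum>i\<in>I. cnj (a i) * ip M x (v i))"
    using x av by (simp add: ip_sum_right ip_cmult_right)
  have ss: "ip M ?s ?s = (\<Sum>i\<in>I. a i * cnj (a i))"
  proof -
    have "ip M ?s ?s = (\<Sum>i\<in>I. \<Sum>j\<in>I. a i * (cnj (a j) * ip M (v i) (v j)))"
      by (simp add: ip_sum_left av s ip_sum_right ip_cmult_left ip_cmult_right v sum_distrib_left)
    also have "\<dots> = (\<Sum>i\<in>I. \<Sum>j\<in>I. if i = j then a i * cnj (a i) else 0)"
      by (intro sum.cong refl) (auto simp: on)
    finally show ?thesis using I by (simp add: sum.delta')
  qed
  have "complex_of_real ((nrm M (\<lambda>t. x t - ?s t))\<^sup>2) = ip M x x - ip M x ?s - (ip M ?s x - ip M ?s ?s)"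
    unfolding ip_self[symmetric] by (simp add: ip_diff_left ip_diff_right x s sqi_diff)
  also have "\<dots> = ip M x x - (ip M x ?s + cnj (ip M x ?s)) + ip M ?s ?s"
    by (subst ip_commute[of M ?s x]) simp
  also have "\<dots> = of_real ((nrm M x)\<^sup>2 - 2 * Re (ip M x ?s) + (\<Sum>i\<in>I. (cmod (a i))\<^sup>2))"
    unfolding ss unfolding ip_self complex_add_cnj
    by (simp only: of_real_add of_real_diff of_real_sum complex_norm_square)
  finally show ?thesis unfolding xs of_real_eq_iff .
qed

text \<open>Both are instances of the preceding identity: \<open>x = 0\<close> gives Pythagoras, and
  the coefficients \<open>ip M x (v i)\<close> give Bessel because the left-hand side is
  nonnegative.\<close>

lemma
  assumes "finite I" "\<And>i. i \<in> I \<Longrightarrow> v i \<in> sqi M"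
    and "\<And>i j. i \<in> I \<Longrightarrow> j \<in> I \<Longrightarrow> ip M (v i) (v j) = (if i = j then 1 else 0)"
  shows nrm_orthonormal_sum: "(nrm M (\<lambda>t. \<Sum>i\<in>I. a i * v i t))\<^sup>2 = (\<Sum>i\<in>I. (cmod (a i))\<^sup>2)"
    and bessel: "x \<in> sqi M \<Longrightarrow> (\<Sum>i\<in>I. (cmod (ip M x (v i)))\<^sup>2) \<le> (nrm M x)\<^sup>2"
proof -
  have "nrm M (\<lambda>t. 0 - (\<Sum>i\<in>I. a i * v i t)) = nrm M (\<lambda>t. \<Sum>i\<in>I. a i * v i t)"
    by (subst nrm_minus_commute) simp
  thus "(nrm M (\<lambda>t. \<Sum>i\<in>I. a i * v i t))\<^sup>2 = (\<Sum>i\<in>I. (cmod (a i))\<^sup>2)"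
    using nrm_diff_orthonormal_sum[OF assms sqi_zero, of a]
    by (simp add: ip_def nrm_def[of M "\<lambda>_. 0"])
  assume x: "x \<in> sqi M"
  have "Re (\<Sum>i\<in>I. cnj (ip M x (v i)) * ip M x (v i)) = (\<Sum>i\<in>I. (cmod (ip M x (v i)))\<^sup>2)"
    by (simp add: cmod_power2 flip: power2_eq_square)
  moreover have "0 \<le> (nrm M (\<lambda>t. x t - (\<Sum>i\<in>I. ip M x (v i) * v i t)))\<^sup>2" by simp
  ultimately show "(\<Sum>i\<in>I. (cmod (ip M x (v i)))\<^sup>2) \<le> (nrm M x)\<^sup>2"
    using nrm_diff_orthonormal_sum[OF assms x, of "\<lambda>i. ip M x (v i)"] by linarith
qed

text \<open>Cauchy-Schwarz is Bessel's inequality for the one-element family consisting of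
  \<open>y\<close> divided by its norm. If that norm is 0, then \<open>y\<close> vanishes almost
  everywhere.\<close>

lemma cmod_ip_le:
  assumes "x \<in> sqi M" "y \<in> sqi M"
  shows "cmod (ip M x y) \<le> nrm M x * nrm M y"
proof (cases "nrm M y = 0")
  case True
  hence "AE t in M. y t = 0" using nrm_zero_AE assms by blast
  hence "ip M y x = ip M (\<lambda>_. 0) x" using assms by (intro ip_AE_cong) auto
  thus ?thesis using True by (subst ip_commute) (simp add: ip_def)
next
  case False
  define v where "v = (\<lambda>t. of_real (1 / nrm M y) * y t)"
  have v: "v \<in> sqi M" unfolding v_def using assms(2) by (rule sqi_cmult)
  have "ip M v v = 1" using False
    unfolding v_def ip_cmult_left ip_cmult_right ip_self by (simp add: power2_eq_square)
  hence "(cmod (ip M x v))\<^sup>2 \<le> (nrm M x)\<^sup>2"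
    using bessel[of "{()}" "\<lambda>_. v" M x] v assms by simp
  hence "cmod (ip M x v) \<le> nrm M x" by (rule power2_le_imp_le) simp
  moreover have "cmod (ip M x v) = cmod (ip M x y) / nrm M y"
    unfolding v_def ip_cmult_right by (simp add: norm_mult norm_divide)
  ultimately show ?thesis using False
    by (simp add: divide_le_eq order.strict_iff_order)
qed

lemma nrm_add_le:
  assumes "x \<in> sqi M" "y \<in> sqi M"
  shows "nrm M (\<lambda>t. x t + y t) \<le> nrm M x + nrm M y"
proof (rule power2_le_imp_le)
  have "complex_of_real ((nrm M (\<lambda>t. x t + y t))\<^sup>2)
      = ip M x x + (ip M y x + cnj (ip M y x)) + ip M y y"
    unfolding ip_self[symmetric]
    by (simp add: ip_add_left ip_add_right assms sqi_add ip_commute[of M x y])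
  also have "\<dots> = of_real ((nrm M x)\<^sup>2 + (nrm M y)\<^sup>2 + 2 * Re (ip M y x))"
    unfolding complex_add_cnj ip_self by simp
  finally have "(nrm M (\<lambda>t. x t + y t))\<^sup>2 = (nrm M x)\<^sup>2 + (nrm M y)\<^sup>2 + 2 * Re (ip M y x)"
    unfolding of_real_eq_iff .
  also have "Re (ip M y x) \<le> nrm M x * nrm M y"
    using complex_Re_le_cmod[of "ip M y x"] cmod_ip_le[of y M x] assms by (simp add: mult.commute)
  hence "(nrm M x)\<^sup>2 + (nrm M y)\<^sup>2 + 2 * Re (ip M y x) \<le> (nrm M x + nrm M y)\<^sup>2"
    by (simp add: power2_sum)
  finally show "(nrm M (\<lambda>t. x t + y t))\<^sup>2 \<le> (nrm M x + nrm M y)\<^sup>2" .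
qed simp

lemma nrm_diff_le:
  assumes "x \<in> sqi M" "y \<in> sqi M"
  shows "nrm M (\<lambda>t. x t - y t) \<le> nrm M x + nrm M y"
  using nrm_add_le[OF assms(1) sqi_cmult[OF assms(2), of "-1"]] nrm_cmult[of M "-1" y] by simp

lemma nrm_triangle:
  assumes "x \<in> sqi M" "y \<in> sqi M" "z \<in> sqi M"
  shows "nrm M (\<lambda>t. x t - z t) \<le> nrm M (\<lambda>t. x t - y t) + nrm M (\<lambda>t. y t - z t)"
  using nrm_add_le[of "\<lambda>t. x t - y t" M "\<lambda>t. y t - z t"] assms by (simp add: sqi_diff)

lemma nrm_tendsto:
  assumes "\<And>n. x n \<in> sqi M" "y \<in> sqi M" "((\<lambda>n. nrm M (\<lambda>t. x n t - y t)) \<longlongrightarrow> 0) F"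
  shows "((\<lambda>n. nrm M (x n)) \<longlongrightarrow> nrm M y) F"
proof -
  have "\<bar>nrm M (x n) - nrm M y\<bar> \<le> nrm M (\<lambda>t. x n t - y t)" for n
    using nrm_add_le[of "\<lambda>t. x n t - y t" M y] nrm_add_le[of "\<lambda>t. y t - x n t" M "x n"]
      assms(1)[of n] assms(2) by (simp add: sqi_diff nrm_minus_commute[of M y])
  hence "((\<lambda>n. nrm M (x n) - nrm M y) \<longlongrightarrow> 0) F"
    by (intro Lim_null_comparison[OF _ assms(3)]) (auto intro!: always_eventually)
  thus ?thesis by (simp add: LIM_zero_iff)
qed

lemma ip_tendsto:
  assumes "\<And>n. x n \<in> sqi M" "y \<in> sqi M" "k \<in> sqi M"
    "((\<lambda>n. nrm M (\<lambda>t. x n t - y t)) \<longlongrightarrow> 0) F"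
  shows "((\<lambda>n. ip M (x n) k) \<longlongrightarrow> ip M y k) F"
proof -
  have "cmod (ip M (x n) k - ip M y k) \<le> nrm M (\<lambda>t. x n t - y t) * nrm M k" for n
    using cmod_ip_le[of "\<lambda>t. x n t - y t" M k] assms by (simp add: ip_diff_left sqi_diff)
  hence "\<forall>\<^sub>F n in F. cmod (ip M (x n) k - ip M y k) \<le> nrm M (\<lambda>t. x n t - y t) * nrm M k"
    by (simp add: always_eventually)
  moreover have "((\<lambda>n. nrm M (\<lambda>t. x n t - y t) * nrm M k) \<longlongrightarrow> 0) F"
    using tendsto_mult_right[OF assms(4), of "nrm M k"] by simp
  ultimately have "((\<lambda>n. ip M (x n) k - ip M y k) \<longlongrightarrow> 0) F"
    by (rule Lim_null_comparison)
  thus ?thesis by (simp add: LIM_zero_iff)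
qed

section \<open>Fatou's lemma and almost everywhere limits\<close>

lemma nn_integral_sqi:
  assumes "g \<in> sqi M" shows "(\<integral>\<^sup>+x. ennreal ((cmod (g x))\<^sup>2) \<partial>M) = ennreal ((nrm M g)\<^sup>2)"
  unfolding nrm_square by (rule nn_integral_eq_integral) (use assms in \<open>auto simp: sqi_def\<close>)

lemma sqi_nrm_leI:
  assumes "g \<in> borel_measurable M" "(\<integral>\<^sup>+x. ennreal ((cmod (g x))\<^sup>2) \<partial>M) \<le> ennreal (B\<^sup>2)" "0 \<le> B"
  shows "g \<in> sqi M" "nrm M g \<le> B"
proof -
  have "(\<integral>\<^sup>+x. ennreal ((cmod (g x))\<^sup>2) \<partial>M) < \<infinity>"
    using assms(2) by (simp add: le_less_trans)
  hence "integrable M (\<lambda>x. (cmod (g x))\<^sup>2)" using assms(1) by (intro integrableI_bounded) auto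
  thus g: "g \<in> sqi M" using assms by (simp add: sqi_def)
  have "(nrm M g)\<^sup>2 \<le> B\<^sup>2"
    using assms(2,3) unfolding nn_integral_sqi[OF g] by (simp add: ennreal_le_iff)
  thus "nrm M g \<le> B" using assms(3) by (rule power2_le_imp_le)
qed

text \<open>Square integrability of the limit is a conclusion here. This is what completeness needs,
  and it later carries the Gagliardo bound from finite sums to the full series.\<close>

lemma sqi_fatou:
  assumes x: "\<And>n::nat. x n \<in> sqi M" and y: "y \<in> borel_measurable M"
    and lim: "AE t in M. (\<lambda>n. x n t) \<longlonglongrightarrow> y t"
    and B: "eventually (\<lambda>n. nrm M (x n) \<le> B) sequentially" and "0 \<le> B"
  shows "y \<in> sqi M" "nrm M y \<le> B"
proof -
  have "(\<integral>\<^sup>+t. ennreal ((cmod (y t))\<^sup>2) \<partial>M)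
      = (\<integral>\<^sup>+t. liminf (\<lambda>n. ennreal ((cmod (x n t))\<^sup>2)) \<partial>M)"
  proof (rule nn_integral_cong_AE, use lim in eventually_elim)
    case (elim t)
    have "(\<lambda>n. ennreal ((cmod (x n t))\<^sup>2)) \<longlonglongrightarrow> ennreal ((cmod (y t))\<^sup>2)"
      by (intro tendsto_ennrealI tendsto_power tendsto_norm elim)
    thus ?case using lim_imp_Liminf[OF sequentially_bot] by metis
  qed
  also have "\<dots> \<le> liminf (\<lambda>n. \<integral>\<^sup>+t. ennreal ((cmod (x n t))\<^sup>2) \<partial>M)"
    by (rule nn_integral_liminf) (use x in auto)
  also have "\<dots> \<le> ennreal (B\<^sup>2)"
  proof (rule Liminf_le)
    show "eventually (\<lambda>n. (\<integral>\<^sup>+t. ennreal ((cmod (x n t))\<^sup>2) \<partial>M) \<le> ennreal (B\<^sup>2)) sequentially"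
      using B by eventually_elim (auto simp: nn_integral_sqi[OF x] intro!: ennreal_leI power_mono)
  qed simp
  finally show "y \<in> sqi M" "nrm M y \<le> B" using sqi_nrm_leI y \<open>0 \<le> B\<close> by blast+
qed

text \<open>Convergence in norm is L1 convergence of the squared differences to 0, so the L1
  subsequence theorem applies.\<close>

lemma sqi_tendsto_AE_subseq:
  assumes x: "\<And>n::nat. x n \<in> sqi M" and y: "y \<in> sqi M"
    and lim: "(\<lambda>n. nrm M (\<lambda>t. x n t - y t)) \<longlonglongrightarrow> 0"
  shows "\<exists>r::nat \<Rightarrow> nat. strict_mono r \<and> (AE t in M. (\<lambda>n. x (r n) t) \<longlonglongrightarrow> y t)"
proof -
  have d: "(\<lambda>t. x n t - y t) \<in> sqi M" for n using x y by (rule sqi_diff)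
  have "(\<lambda>n. (nrm M (\<lambda>t. x n t - y t))\<^sup>2) \<longlonglongrightarrow> 0"
    using tendsto_power[OF lim, of 2] by simp
  hence "(\<lambda>n. LINT t|M. norm ((cmod (x n t - y t))\<^sup>2)) \<longlonglongrightarrow> 0"
    by (simp add: nrm_square)
  from tendsto_L1_AE_subseq[OF sqi_integrable[OF d] this]
  obtain r where r: "strict_mono r" "AE t in M. (\<lambda>n. (cmod (x (r n) t - y t))\<^sup>2) \<longlonglongrightarrow> 0" by blast
  from r(2) have "AE t in M. (\<lambda>n. x (r n) t) \<longlonglongrightarrow> y t"
  proof eventually_elim
    case (elim t)
    have "(\<lambda>n. sqrt ((cmod (x (r n) t - y t))\<^sup>2)) \<longlonglongrightarrow> sqrt 0"
      by (intro tendsto_real_sqrt elim)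
    thus ?case by (simp add: LIM_zero_iff tendsto_norm_zero_iff)
  qed
  thus ?thesis using r(1) by blast
qed

section \<open>Square-summable sequences as functions on the counting measure\<close>

lemma ell2_sqi: "ell2 = sqi (count_space UNIV)"
  unfolding ell2_def sqi_def
  using abs_summable_equivalent[of "\<lambda>l. (cmod (c l))\<^sup>2" UNIV for c]
  by (auto simp: abs_summable_on_def)

lemma ell2_inner_ip:
  assumes "c \<in> ell2" "d \<in> ell2"
  shows "ell2_inner c d = ip (count_space UNIV) c d"
  using infsetsum_infsum[of "\<lambda>l. c l * cnj (d l)" UNIV] integrable_ip[OF assms[unfolded ell2_sqi]]
  by (simp add: ell2_inner_def ip_def infsetsum_def abs_summable_on_def)

lemma ell2_norm_nrm:
  assumes "c \<in> ell2"
  shows "ell2_norm c = nrm (count_space UNIV) c"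
  using infsetsum_infsum[of "\<lambda>l. (cmod (c l))\<^sup>2" UNIV] sqi_integrable[OF assms[unfolded ell2_sqi]]
  by (simp add: ell2_norm_def nrm_def infsetsum_def abs_summable_on_def)

lemma L2_sqi: "L2 = sqi Lam"
  by (simp add: L2_def sqi_def)

lemma L2_norm_nrm: "L2_norm g = nrm Lam g"
  by (simp add: L2_norm_def nrm_def)

lemma L2_inner_ip: "L2_inner g k = ip Lam g k"
  by (simp add: L2_inner_def ip_def)

lemma ell2_norm_nonneg [simp]: "0 \<le> ell2_norm c"
  by (simp add: ell2_norm_def infsum_nonneg)

lemma ell2_norm_square: "(ell2_norm c)\<^sup>2 = (\<Sum>\<^sub>\<infinity>l. (cmod (c l))\<^sup>2)"
  by (simp add: ell2_norm_def infsum_nonneg)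

lemma ell2_sum_le:
  assumes "c \<in> ell2" "finite S"
  shows "(\<Sum>l\<in>S. (cmod (c l))\<^sup>2) \<le> (ell2_norm c)\<^sup>2"
  unfolding ell2_norm_square by (rule finite_sum_le_infsum) (use assms in \<open>auto simp: ell2_def\<close>)

lemma ell2_normI:
  assumes "\<And>S. finite S \<Longrightarrow> (\<Sum>l\<in>S. (cmod (c l))\<^sup>2) \<le> B\<^sup>2" "0 \<le> B"
  shows "c \<in> ell2" "ell2_norm c \<le> B"
proof -
  have "(\<lambda>l. (cmod (c l))\<^sup>2) summable_on UNIV"
    by (rule nonneg_bdd_above_summable_on) (auto intro!: bdd_aboveI2[where M = "B\<^sup>2"] assms)
  thus "c \<in> ell2" by (simp add: ell2_def)
  have "(ell2_norm c)\<^sup>2 \<le> B\<^sup>2" unfolding ell2_norm_square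
    by (rule infsum_le_finite_sums) (use \<open>(\<lambda>l. (cmod (c l))\<^sup>2) summable_on UNIV\<close> assms in auto)
  thus "ell2_norm c \<le> B" using assms(2) by (rule power2_le_imp_le)
qed

lemma ell2_comparison:
  assumes "d \<in> ell2" "\<And>l. cmod (c l) \<le> K * cmod (d l)" "0 \<le> K"
  shows "c \<in> ell2" "ell2_norm c \<le> K * ell2_norm d"
proof -
  have "(\<Sum>l\<in>S. (cmod (c l))\<^sup>2) \<le> (K * ell2_norm d)\<^sup>2" if "finite S" for S
  proof -
    have "(\<Sum>l\<in>S. (cmod (c l))\<^sup>2) \<le> (\<Sum>l\<in>S. (K * cmod (d l))\<^sup>2)"
      by (intro sum_mono power_mono assms) auto
    also have "\<dots> = K\<^sup>2 * (\<Sum>l\<in>S. (cmod (d l))\<^sup>2)"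
      by (simp add: power_mult_distrib sum_distrib_left)
    also have "\<dots> \<le> K\<^sup>2 * (ell2_norm d)\<^sup>2"
      by (intro mult_left_mono ell2_sum_le assms that) auto
    finally show ?thesis by (simp add: power_mult_distrib)
  qed
  from ell2_normI[OF this] show "c \<in> ell2" "ell2_norm c \<le> K * ell2_norm d"
    using assms by auto
qed

lemma ell2_finite_support:
  assumes "finite S" "\<And>l. l \<notin> S \<Longrightarrow> c l = 0"
  shows "c \<in> ell2"
proof (rule ell2_normI(1)[where B = "sqrt (\<Sum>l\<in>S. (cmod (c l))\<^sup>2)"])
  fix S' :: "int set" assume "finite S'"
  have "(\<Sum>l\<in>S'. (cmod (c l))\<^sup>2) = (\<Sum>l\<in>S' \<inter> S. (cmod (c l))\<^sup>2)"
    using \<open>finite S'\<close> assms(2) by (intro sum.mono_neutral_right) auto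
  also have "\<dots> \<le> (\<Sum>l\<in>S. (cmod (c l))\<^sup>2)"
    using assms(1) by (intro sum_mono2) auto
  finally show "(\<Sum>l\<in>S'. (cmod (c l))\<^sup>2) \<le> (sqrt (\<Sum>l\<in>S. (cmod (c l))\<^sup>2))\<^sup>2"
    by (simp add: sum_nonneg)
qed (simp add: sum_nonneg)

lemma ell2_diff: "c \<in> ell2 \<Longrightarrow> d \<in> ell2 \<Longrightarrow> (\<lambda>l. c l - d l) \<in> ell2"
  unfolding ell2_sqi by (rule sqi_diff)

text \<open>The squared norm of the tail is the total sum minus the partial sum over
  \<open>S\<close>, and partial sums converge along finite sets.\<close>

lemma ell2_tail_tendsto:
  assumes "c \<in> ell2"
  shows "((\<lambda>S. (ell2_norm (\<lambda>l. if l \<in> S then 0 else c l))\<^sup>2) \<longlongrightarrow> 0) (finite_subsets_at_top UNIV)"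
proof -
  let ?f = "\<lambda>l. (cmod (c l))\<^sup>2"
  have s: "?f summable_on UNIV" using assms by (simp add: ell2_def)
  have "(ell2_norm (\<lambda>l. if l \<in> S then 0 else c l))\<^sup>2 = infsum ?f UNIV - sum ?f S" if "finite S" for S
  proof -
    have "infsum ?f (UNIV - S) = infsum ?f UNIV - infsum ?f S"
      by (rule infsum_Diff) (use s that in auto)
    moreover have "infsum ?f (UNIV - S) = (\<Sum>\<^sub>\<infinity>l. (cmod (if l \<in> S then 0 else c l))\<^sup>2)"
      by (rule infsum_cong_neutral) auto
    ultimately show ?thesis using that by (simp add: ell2_norm_square)
  qed
  hence "\<forall>\<^sub>F S in finite_subsets_at_top UNIV.
      infsum ?f UNIV - sum ?f S = (ell2_norm (\<lambda>l. if l \<in> S then 0 else c l))\<^sup>2"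
    by (auto simp: eventually_finite_subsets_at_top)
  moreover have "((\<lambda>S. infsum ?f UNIV - sum ?f S) \<longlongrightarrow> infsum ?f UNIV - infsum ?f UNIV)
      (finite_subsets_at_top UNIV)"
    by (intro tendsto_diff tendsto_const infsum_tendsto s)
  ultimately show ?thesis using Lim_transform_eventually by fastforce
qed

section \<open>Completeness\<close>

text \<open>Riesz-Fischer: a subsequence whose increments have norm below \<open>(1/2) ^ k\<close>
  has summable increments in L1, because the measure is finite. It therefore converges almost
  everywhere, and Fatou shows that its limit is the norm limit of the whole sequence.\<close>

lemma sqi_complete:
  assumes M: "finite_measure M" and x: "\<And>n::nat. x n \<in> sqi M"
    and cauchy: "\<And>e. e > 0 \<Longrightarrow> \<exists>N. \<forall>m\<ge>N. \<forall>n\<ge>N. nrm M (\<lambda>t. x m t - x n t) < e"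
  shows "\<exists>y\<in>sqi M. (\<lambda>n. nrm M (\<lambda>t. x n t - y t)) \<longlonglongrightarrow> 0"
proof -
  interpret finite_measure M by (fact M)
  have "\<forall>k. \<exists>N. \<forall>m\<ge>N. \<forall>n\<ge>N. nrm M (\<lambda>t. x m t - x n t) < (1/2) ^ k"
    using cauchy by simp
  then obtain N where N: "\<And>k m n. m \<ge> N k \<Longrightarrow> n \<ge> N k \<Longrightarrow> nrm M (\<lambda>t. x m t - x n t) < (1/2) ^ k"
    by metis
  \<comment> \<open>The partial sums of \<open>N\<close> make \<open>r k\<close> and
    \<open>r (Suc k)\<close> both at least \<open>N k\<close>; the summand \<open>k\<close> makes
    \<open>r\<close> tend to infinity.\<close>
  define r where "r k = k + (\<Sum>i\<le>k. N i)" for k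
  have rN: "r k \<ge> N k" "r (Suc k) \<ge> N k" "r k \<ge> k" for k
  proof -
    have "N k \<le> (\<Sum>i\<le>k. N i)" "N k \<le> (\<Sum>i\<le>Suc k. N i)" by (rule member_le_sum; simp)+
    thus "r k \<ge> N k" "r (Suc k) \<ge> N k" "r k \<ge> k" by (simp_all add: r_def)
  qed
  define D where "D k t = x (r (Suc k)) t - x (r k) t" for k t
  have D: "D k \<in> sqi M" for k unfolding D_def by (intro sqi_diff x)
  define m where "m = measure M (space M)"
  have int: "(\<integral>\<^sup>+t. ennreal (cmod (D k t)) \<partial>M) \<le> ennreal ((1/2) ^ k * (m + 1))" for k
  proof -
    let ?c = "(1/2::real) ^ k"
    \<comment> \<open>Either the value is at most \<open>?c\<close>, or it is at most its square
      divided by \<open>?c\<close>. Integration turns the bound \<open>?c\<close> on the L2 norm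
      into an L1 bound of order \<open>?c\<close>.\<close>
    have pt: "cmod (D k t) \<le> ?c + (cmod (D k t))\<^sup>2 / ?c" for t
    proof (cases "cmod (D k t) \<le> ?c")
      case False
      hence "cmod (D k t) * ?c \<le> (cmod (D k t))\<^sup>2" by (simp add: power2_eq_square mult_left_mono)
      hence "cmod (D k t) \<le> (cmod (D k t))\<^sup>2 / ?c" by (simp add: pos_le_divide_eq)
      thus ?thesis by (rule order_trans) simp
    qed (auto intro: add_increasing2)
    have "(\<integral>\<^sup>+t. ennreal (cmod (D k t)) \<partial>M) \<le> (\<integral>\<^sup>+t. ennreal (?c + (cmod (D k t))\<^sup>2 / ?c) \<partial>M)"
      by (intro nn_integral_mono ennreal_leI pt)
    also have "\<dots> = ennreal (LINT t|M. ?c + (cmod (D k t))\<^sup>2 / ?c)"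
      by (rule nn_integral_eq_integral) (use sqi_integrable[OF D] in auto)
    also have "(LINT t|M. ?c + (cmod (D k t))\<^sup>2 / ?c) = ?c * m + (nrm M (D k))\<^sup>2 / ?c"
      using sqi_integrable[OF D, of k] by (simp add: nrm_square m_def)
    also have "(nrm M (D k))\<^sup>2 \<le> ?c\<^sup>2"
      by (intro power_mono) (use N[OF rN(2,1)] in \<open>auto simp: D_def[abs_def] less_imp_le\<close>)
    hence "(nrm M (D k))\<^sup>2 / ?c \<le> ?c"
      by (simp add: pos_divide_le_eq power2_eq_square)
    hence "?c * m + (nrm M (D k))\<^sup>2 / ?c \<le> ?c * (m + 1)" by (simp add: distrib_left)
    finally show ?thesis by (simp add: ennreal_leI)
  qed
  have "(\<integral>\<^sup>+t. (\<Sum>k. ennreal (cmod (D k t))) \<partial>M) = (\<Sum>k. \<integral>\<^sup>+t. ennreal (cmod (D k t)) \<partial>M)"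
    by (rule nn_integral_suminf) (use D in auto)
  also have "\<dots> \<le> (\<Sum>k. ennreal ((1/2) ^ k * (m + 1)))"
    by (intro suminf_le int) auto
  also have "\<dots> = ennreal (\<Sum>k. (1/2) ^ k * (m + 1))"
    by (intro suminf_ennreal2 summable_mult2) (auto simp: m_def)
  also have "\<dots> < \<infinity>" by simp
  finally have "AE t in M. (\<Sum>k. ennreal (cmod (D k t))) \<noteq> \<infinity>"
    by (intro nn_integral_PInf_AE) (use D in auto)
  hence conv: "AE t in M. convergent (\<lambda>k. x (r k) t)"
  proof eventually_elim
    case (elim t)
    hence "summable (\<lambda>k. cmod (D k t))"
      by (intro summable_suminf_not_top) auto
    hence "summable (\<lambda>k. D k t)" by (rule summable_norm_cancel)
    hence "convergent (\<lambda>n. \<Sum>k<n. D k t)" by (simp add: summable_iff_convergent)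
    hence "convergent (\<lambda>n. (\<Sum>k<n. D k t) + x (r 0) t)"
      by (intro convergent_add convergent_const)
    moreover have "(\<Sum>k<n. D k t) + x (r 0) t = x (r n) t" for n
      unfolding D_def by (subst sum_lessThan_telescope) simp
    ultimately show ?case by simp
  qed
  define y where "y t = lim (\<lambda>k. x (r k) t)" for t
  have y: "y \<in> borel_measurable M" unfolding y_def
    by (rule borel_measurable_lim_metric) (use x in auto)
  have lim: "AE t in M. (\<lambda>k. x n t - x (r k) t) \<longlonglongrightarrow> x n t - y t" for n
    using conv by eventually_elim (auto simp: y_def convergent_LIMSEQ_iff intro!: tendsto_diff)
  \<comment> \<open>Fatou in the second index of the Cauchy condition, with the first index
    fixed.\<close>
  have fat: "\<exists>K. \<forall>n\<ge>K. (\<lambda>t. x n t - y t) \<in> sqi M \<and> nrm M (\<lambda>t. x n t - y t) \<le> e" if e: "e > 0" for e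
  proof -
    obtain K where K: "\<And>m n. m \<ge> K \<Longrightarrow> n \<ge> K \<Longrightarrow> nrm M (\<lambda>t. x m t - x n t) < e"
      using cauchy[OF e] by blast
    have "(\<lambda>t. x n t - y t) \<in> sqi M \<and> nrm M (\<lambda>t. x n t - y t) \<le> e" if nK: "n \<ge> K" for n
    proof -
      have "eventually (\<lambda>k. nrm M (\<lambda>t. x n t - x (r k) t) \<le> e) sequentially"
        using eventually_ge_at_top[of K]
        by eventually_elim (rule less_imp_le[OF K[OF nK order_trans[OF _ rN(3)]]])
      from sqi_fatou[OF sqi_diff[OF x x] _ lim this] show ?thesis
        using e x y by auto
    qed
    thus ?thesis by blast
  qed
  obtain n where n: "(\<lambda>t. x n t - y t) \<in> sqi M" using fat[of 1] by auto
  have "y \<in> sqi M" using sqi_diff[OF x[of n] n] by simp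
  moreover have "(\<lambda>n. nrm M (\<lambda>t. x n t - y t)) \<longlonglongrightarrow> 0"
  proof (rule LIMSEQ_I)
    fix e :: real assume "e > 0"
    then obtain K where "\<forall>n\<ge>K. nrm M (\<lambda>t. x n t - y t) \<le> e / 2" using fat[of "e/2"] by auto
    thus "\<exists>K. \<forall>n\<ge>K. norm (nrm M (\<lambda>t. x n t - y t) - 0) < e"
      using \<open>e > 0\<close> by (intro exI[of _ K]) auto
  qed
  ultimately show ?thesis by blast
qed

section \<open>Lebesgue measure on the interval\<close>

lemma finite_measure_Lam: "finite_measure Lam"
  by (rule finite_measure_lebesgue_on) simp

lemma space_Lam [simp]: "space Lam = {-1..1}"
  by (simp add: space_restrict_space)

lemma measure_Lam [simp]: "measure Lam {-1..1} = 2"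
  by (simp add: measure_restrict_space)

lemma Lam_AE_interior: "AE x in Lam. -1 < x \<and> x < 1"
proof -
  have "AE x in lebesgue. x \<noteq> (1::real) \<and> x \<noteq> -1"
    by (intro AE_completion AE_conjI AE_lborel_singleton)
  hence "AE x in Lam. x \<noteq> (1::real) \<and> x \<noteq> -1"
    by (subst AE_restrict_space_iff) auto
  moreover have "AE x in Lam. x \<in> {-1..1}" by (rule AE_I2) simp
  ultimately show ?thesis by eventually_elim auto
qed

lemma continuous_measurable_Lam:
  "continuous_on {-1..1} f \<Longrightarrow> f \<in> borel_measurable Lam"
  by (rule continuous_imp_measurable_on_sets_lebesgue) auto

lemma continuous_L2:
  assumes "continuous_on {-1..1} f" shows "f \<in> L2"
proof -
  have "integrable Lam (\<lambda>x. (cmod (f x))\<^sup>2)"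
    by (intro continuous_imp_integrable_real continuous_intros assms)
  thus ?thesis using continuous_measurable_Lam[OF assms] by (simp add: L2_def)
qed

lemma L2_norm_le_bound:
  assumes "f \<in> L2" "\<And>x. x \<in> {-1..1} \<Longrightarrow> cmod (f x) \<le> B" "0 \<le> B"
  shows "L2_norm f \<le> sqrt 2 * B"
proof -
  have "(LINT x|Lam. (cmod (f x))\<^sup>2) \<le> (LINT x|Lam. B\<^sup>2)"
    using assms finite_measure.integrable_const[OF finite_measure_Lam]
    by (intro integral_mono) (auto simp: L2_def intro: power_mono)
  hence "L2_norm f \<le> sqrt (2 * B\<^sup>2)" unfolding L2_norm_def by (intro real_sqrt_le_mono) simp
  thus ?thesis using assms(3) by (simp add: real_sqrt_mult)
qed

section \<open>Density of function rings\<close>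

lemma nrm_tendsto_dominated:
  assumes "\<And>n::nat. f n \<in> borel_measurable M" "AE x in M. (\<lambda>n. f n x) \<longlonglongrightarrow> 0"
    "integrable M w" "\<And>n x. x \<in> space M \<Longrightarrow> (cmod (f n x))\<^sup>2 \<le> w x"
  shows "(\<lambda>n. nrm M (f n)) \<longlonglongrightarrow> 0"
proof -
  have "(\<lambda>n. LINT x|M. (cmod (f n x))\<^sup>2) \<longlonglongrightarrow> (LINT x|M. 0)"
  proof (rule integral_dominated_convergence)
    show "AE x in M. (\<lambda>n. (cmod (f n x))\<^sup>2) \<longlonglongrightarrow> 0"
      using assms(2)
    proof eventually_elim
      case (elim x)
      show ?case using tendsto_power[OF tendsto_norm[OF elim], of 2] by simp
    qed
  qed (use assms in \<open>auto intro!: AE_I2\<close>)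
  from tendsto_real_sqrt[OF this] show ?thesis by (simp add: nrm_def)
qed

text \<open>Three errors of \<open>e/3\<close> are added: truncating \<open>g\<close>, replacing the
  truncation by a continuous function, and Stone-Weierstrass. The ring stays abstract because the
  result serves smooth functions, for the uniqueness of weak derivatives, as well as trigonometric
  polynomials, for the density of the range.\<close>

lemma approx_real_by_ring:
  assumes R: "function_ring_on R {-1..1::real}"
    and g: "g \<in> borel_measurable Lam" "integrable Lam (\<lambda>x. (g x)\<^sup>2)" and "0 < (e::real)"
  shows "\<exists>a\<in>R. L2_norm (\<lambda>x. of_real (g x) - of_real (a x)) < e"
proof -
  interpret function_ring_on R "{-1..1}" by (fact R)
  \<comment> \<open>Clamping to \<open>{-m..m}\<close>. It is applied to \<open>g\<close>, and again
    to the continuous approximants, which then differ from the clamped \<open>g\<close> by at most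
    \<open>2 * m\<close>; a constant is thus a dominating function.\<close>
  define cl where "cl m t = max (- m) (min m t)" for m t :: real
  have cl: "\<bar>cl m t\<bar> \<le> \<bar>m\<bar>" "\<bar>cl m t - t\<bar> \<le> \<bar>t\<bar>" "\<bar>t\<bar> \<le> m \<Longrightarrow> cl m t = t" if "0 \<le> m" for m t
    using that by (auto simp: cl_def)
  have clc: "continuous_on S (cl m)" for m S unfolding cl_def by (intro continuous_intros)
  have clm: "(\<lambda>x. cl m (h x)) \<in> borel_measurable M" if "h \<in> borel_measurable M" for m h M
    unfolding cl_def using that by measurable
  have "(\<lambda>m. nrm Lam (\<lambda>x. complex_of_real (cl (real m) (g x) - g x))) \<longlonglongrightarrow> 0"
  proof (rule nrm_tendsto_dominated[where w = "\<lambda>x. (g x)\<^sup>2"])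
    show "AE x in Lam. (\<lambda>m. complex_of_real (cl (real m) (g x) - g x)) \<longlonglongrightarrow> 0"
    proof (rule AE_I2)
      fix x
      have "eventually (\<lambda>m. complex_of_real (cl (real m) (g x) - g x) = 0) sequentially"
        using eventually_ge_at_top[of "nat \<lceil>\<bar>g x\<bar>\<rceil>"]
        by eventually_elim (auto intro!: cl(3) simp: nat_ceiling_le_eq)
      thus "(\<lambda>m. complex_of_real (cl (real m) (g x) - g x)) \<longlonglongrightarrow> 0"
        by (rule tendsto_eventually)
    qed
    show "(cmod (complex_of_real (cl (real n) (g x) - g x)))\<^sup>2 \<le> (g x)\<^sup>2" for n x
      unfolding norm_of_real power2_abs using cl(2)[of "real n" "g x"] by (simp add: abs_le_square_iff)
    show "(\<lambda>x. complex_of_real (cl (real n) (g x) - g x)) \<in> borel_measurable Lam" for n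
      using g(1) unfolding cl_def by measurable
  qed (use g in auto)
  from LIMSEQ_D[OF this, of "e/3"] \<open>0 < e\<close>
  obtain m where "norm (nrm Lam (\<lambda>x. complex_of_real (cl (real m) (g x) - g x)) - 0) < e/3" by auto
  hence 1: "L2_norm (\<lambda>x. complex_of_real (g x) - complex_of_real (cl (real m) (g x))) < e/3"
    unfolding L2_norm_nrm by (subst nrm_minus_commute) simp
  let ?f = "\<lambda>x. cl (real m) (g x)"
  have fm: "?f \<in> borel_measurable Lam" using g clm by blast
  hence "?f measurable_on {-1..1}" by (simp add: measurable_on_iff_borel_measurable)
  then obtain N h where N: "negligible N" and h: "\<And>n. continuous_on UNIV (h n)"
    and lim: "\<And>x. x \<notin> N \<Longrightarrow> (\<lambda>n::nat. h n x) \<longlonglongrightarrow> (if x \<in> {-1..1} then ?f x else 0)"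
    unfolding measurable_on_def by blast
  have kc: "continuous_on {-1..1} (\<lambda>x. cl (real m) (h n x))" for n
    by (intro continuous_on_compose2[OF clc continuous_on_subset[OF h]]) auto
  have "(\<lambda>n. nrm Lam (\<lambda>x. complex_of_real (cl (real m) (h n x) - ?f x))) \<longlonglongrightarrow> 0"
  proof (rule nrm_tendsto_dominated[where w = "\<lambda>x. (2 * real m)\<^sup>2"])
    have "AE x in lebesgue. x \<notin> N" using N
      by (intro AE_not_in) (simp add: negligible_iff_null_sets)
    hence "AE x in Lam. x \<notin> N" by (subst AE_restrict_space_iff) auto
    moreover have "AE x in Lam. x \<in> {-1..1}" by (rule AE_I2) simp
    ultimately show "AE x in Lam. (\<lambda>n. complex_of_real (cl (real m) (h n x) - ?f x)) \<longlonglongrightarrow> 0"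
    proof eventually_elim
      case (elim x)
      have "isCont (cl (real m)) (?f x)"
        using clc[of UNIV "real m"] by (simp add: continuous_on_eq_continuous_at)
      hence "(\<lambda>n. cl (real m) (h n x)) \<longlonglongrightarrow> cl (real m) (?f x)"
        using lim[OF elim(1)] elim(2) by (auto intro: isCont_tendsto_compose)
      also have "cl (real m) (?f x) = ?f x" using cl(1)[of "real m" "g x"] by (intro cl(3)) auto
      finally have "(\<lambda>n. cl (real m) (h n x) - ?f x) \<longlonglongrightarrow> 0" by (simp add: LIM_zero_iff)
      from tendsto_of_real[OF this, where 'a = complex] show ?case by simp
    qed
    show "(cmod (complex_of_real (cl (real m) (h n x) - ?f x)))\<^sup>2 \<le> (2 * real m)\<^sup>2" for n x
      unfolding norm_of_real using cl(1)[of "real m" "h n x"] cl(1)[of "real m" "g x"]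
      by (intro power_mono) auto
    show "integrable Lam (\<lambda>x. (2 * real m)\<^sup>2)"
      by (rule finite_measure.integrable_const[OF finite_measure_Lam])
    show "(\<lambda>x. complex_of_real (cl (real m) (h n x) - ?f x)) \<in> borel_measurable Lam" for n
      using fm continuous_measurable_Lam[OF kc, of n] by measurable
  qed
  from LIMSEQ_D[OF this, of "e/3"] \<open>0 < e\<close>
  obtain n where "norm (nrm Lam (\<lambda>x. complex_of_real (cl (real m) (h n x) - ?f x)) - 0) < e/3" by auto
  hence 2: "L2_norm (\<lambda>x. complex_of_real (?f x) - complex_of_real (cl (real m) (h n x))) < e/3"
    unfolding L2_norm_nrm by (subst nrm_minus_commute) simp
  \<comment> \<open>The interval has length 2, so a uniform error \<open>e/6\<close> costs at most
    \<open>sqrt 2 * (e/6)\<close>, which is below \<open>e/3\<close>.\<close>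
  have "0 < e/6" using \<open>0 < e\<close> by simp
  from Stone_Weierstrass_basic[OF kc this, of n]
  obtain a where a: "a \<in> R" "\<And>x. x \<in> {-1..1} \<Longrightarrow> \<bar>cl (real m) (h n x) - a x\<bar> < e/6"
    by blast
  have L2s: "(\<lambda>x. complex_of_real (a x)) \<in> L2" "(\<lambda>x. complex_of_real (cl (real m) (h n x))) \<in> L2"
    by (intro continuous_L2 continuous_on_of_real continuous a kc)+
  have L2g: "(\<lambda>x. complex_of_real (g x)) \<in> L2" using g by (simp add: L2_def)
  have L2f: "(\<lambda>x. complex_of_real (?f x)) \<in> L2"
    unfolding L2_sqi
  proof (rule sqi_bound)
    show "(cmod (complex_of_real (?f x)))\<^sup>2 \<le> (real m)\<^sup>2" for x
      unfolding norm_of_real using cl(1)[of "real m" "g x"] by (intro power_mono) auto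
    show "(\<lambda>x. complex_of_real (?f x)) \<in> borel_measurable Lam" using fm by measurable
  qed (rule finite_measure.integrable_const[OF finite_measure_Lam])
  have "(\<lambda>x. complex_of_real (cl (real m) (h n x)) - complex_of_real (a x)) \<in> L2"
    using L2s unfolding L2_sqi by (intro sqi_diff)
  hence "L2_norm (\<lambda>x. complex_of_real (cl (real m) (h n x)) - complex_of_real (a x)) \<le> sqrt 2 * (e/6)"
  proof (rule L2_norm_le_bound)
    show "cmod (complex_of_real (cl (real m) (h n x)) - complex_of_real (a x)) \<le> e/6"
      if "x \<in> {-1..1}" for x
      unfolding of_real_diff[symmetric] norm_of_real using a(2)[OF that] by (rule less_imp_le)
  qed (use \<open>0 < e\<close> in simp)
  also have "\<dots> \<le> 2 * (e/6)"
    using \<open>0 < e\<close> real_sqrt_le_mono[of 2 4] by (intro mult_right_mono) auto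
  finally have 3: "L2_norm (\<lambda>x. complex_of_real (cl (real m) (h n x)) - complex_of_real (a x)) \<le> e/3"
    by simp
  have "L2_norm (\<lambda>x. of_real (g x) - of_real (a x)) < e"
    using nrm_triangle[OF L2g[unfolded L2_sqi] L2f[unfolded L2_sqi] L2s(1)[unfolded L2_sqi]]
      nrm_triangle[OF L2f[unfolded L2_sqi] L2s(2,1)[unfolded L2_sqi]] 1 2 3
    unfolding L2_norm_nrm by linarith
  thus ?thesis using a(1) by blast
qed

text \<open>Stone-Weierstrass concerns real functions, so real and imaginary part are approximated
  separately.\<close>

lemma approx_by_ring:
  assumes R: "function_ring_on R {-1..1::real}" and w: "w \<in> L2" and "0 < (e::real)"
  shows "\<exists>a\<in>R. \<exists>b\<in>R. L2_norm (\<lambda>x. w x - (of_real (a x) + \<i> * of_real (b x))) < e"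
proof -
  interpret function_ring_on R "{-1..1}" by (fact R)
  have wm: "w \<in> borel_measurable Lam" using w by (simp add: L2_def)
  have wi: "integrable Lam (\<lambda>x. (cmod (w x))\<^sup>2)" using w by (simp add: L2_def)
  have m: "(\<lambda>x. Re (w x)) \<in> borel_measurable Lam" "(\<lambda>x. Im (w x)) \<in> borel_measurable Lam"
    using wm by auto
  have "integrable Lam (\<lambda>x. (Re (w x))\<^sup>2)" "integrable Lam (\<lambda>x. (Im (w x))\<^sup>2)"
    by (rule Bochner_Integration.integrable_bound[OF wi]; use m in \<open>auto simp: cmod_power2\<close>)+
  from approx_real_by_ring[OF R m(1) this(1), of "e/2"] approx_real_by_ring[OF R m(2) this(2), of "e/2"]
  obtain a b where ab: "a \<in> R" "b \<in> R"
    "L2_norm (\<lambda>x. of_real (Re (w x)) - of_real (a x)) < e/2"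
    "L2_norm (\<lambda>x. of_real (Im (w x)) - of_real (b x)) < e/2" using \<open>0 < e\<close> by auto
  have s: "(\<lambda>x. complex_of_real (a x)) \<in> sqi Lam" "(\<lambda>x. complex_of_real (b x)) \<in> sqi Lam"
    by (intro continuous_L2[unfolded L2_sqi] continuous_on_of_real continuous ab)+
  have "(\<lambda>x. complex_of_real (Re (w x))) \<in> sqi Lam" "(\<lambda>x. complex_of_real (Im (w x))) \<in> sqi Lam"
    using m \<open>integrable Lam (\<lambda>x. (Re (w x))\<^sup>2)\<close> \<open>integrable Lam (\<lambda>x. (Im (w x))\<^sup>2)\<close>
    by (simp_all add: sqi_def)
  hence re: "(\<lambda>x. complex_of_real (Re (w x)) - of_real (a x)) \<in> sqi Lam"
    and im: "(\<lambda>x. complex_of_real (Im (w x)) - of_real (b x)) \<in> sqi Lam"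
    using s by (simp_all add: sqi_diff)
  have eq: "(\<lambda>x. w x - (of_real (a x) + \<i> * of_real (b x))) =
      (\<lambda>x. (of_real (Re (w x)) - of_real (a x)) + \<i> * (of_real (Im (w x)) - of_real (b x)))"
    by (simp add: fun_eq_iff complex_eq_iff)
  have "L2_norm (\<lambda>x. w x - (of_real (a x) + \<i> * of_real (b x))) < e"
    unfolding eq using nrm_add_le[OF re sqi_cmult[OF im, of \<i>]] ab(3,4)
    by (simp add: L2_norm_nrm nrm_cmult)
  thus ?thesis using ab by blast
qed

text \<open>If \<open>k\<close> is built from the ring and lies within \<open>e\<close> of
  \<open>w\<close>, then orthogonality makes the square of \<open>nrm Lam w\<close> equal to the
  inner product of \<open>w\<close> with \<open>w - k\<close>. Hence it is at most
  \<open>nrm Lam w * e\<close>.\<close>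

lemma ring_orthogonal_zero:
  assumes R: "function_ring_on R {-1..1::real}" and w: "w \<in> L2"
    and orth: "\<And>a. a \<in> R \<Longrightarrow> (LINT x|Lam. w x * of_real (a x)) = 0"
  shows "AE x in Lam. w x = 0"
proof -
  interpret function_ring_on R "{-1..1}" by (fact R)
  note ws = w[unfolded L2_sqi]
  have "nrm Lam w \<le> e" if e: "0 < e" for e
  proof -
    obtain a b where ab: "a \<in> R" "b \<in> R"
      "nrm Lam (\<lambda>x. w x - (of_real (a x) + \<i> * of_real (b x))) < e"
      using approx_by_ring[OF R w e] by (auto simp: L2_norm_nrm)
    let ?k = "\<lambda>x. complex_of_real (a x) + \<i> * of_real (b x)"
    have s: "(\<lambda>x. complex_of_real (a x)) \<in> sqi Lam" "(\<lambda>x. complex_of_real (b x)) \<in> sqi Lam"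
      by (intro continuous_L2[unfolded L2_sqi] continuous_on_of_real continuous ab)+
    have k: "?k \<in> sqi Lam" by (intro sqi_add sqi_cmult s)
    have "ip Lam w ?k = 0"
      using orth[OF ab(1)] orth[OF ab(2)] ws s
      by (simp add: ip_add_right sqi_cmult ip_cmult_right) (simp add: ip_def)
    hence "of_real ((nrm Lam w)\<^sup>2) = ip Lam w (\<lambda>x. w x - ?k x)"
      by (simp only: ip_diff_right[OF ws k ws] ip_self) simp
    hence "(nrm Lam w)\<^sup>2 = cmod (ip Lam w (\<lambda>x. w x - ?k x))"
      by (metis abs_power2 norm_of_real)
    also have "\<dots> \<le> nrm Lam w * nrm Lam (\<lambda>x. w x - ?k x)"
      by (intro cmod_ip_le ws sqi_diff k)
    also have "\<dots> \<le> nrm Lam w * e" using ab(3) by (intro mult_left_mono) auto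
    finally show ?thesis
      using e nrm_nonneg[of Lam w] by (cases "nrm Lam w = 0") (auto simp: power2_eq_square)
  qed
  hence "nrm Lam w = 0" by (metis dense_ge nrm_nonneg order_antisym)
  thus ?thesis by (rule nrm_zero_AE[OF ws])
qed

section \<open>Smooth functions and the uniqueness of weak derivatives\<close>

definition smooth :: "(real \<Rightarrow> real) \<Rightarrow> bool" where
  "smooth f \<longleftrightarrow> (\<forall>n x. (deriv ^^ n) f differentiable (at x))"

text \<open>All iterated derivatives stay inside a family that is closed under differentiation, so
  smoothness reduces to exhibiting such a family.\<close>

lemma smooth_coinduct:
  assumes "f \<in> F"
    and step: "\<And>g. g \<in> F \<Longrightarrow> \<exists>g'\<in>F. \<forall>x. (g has_real_derivative g' x) (at x)"
  shows "smooth f"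
proof -
  have "(deriv ^^ n) f \<in> F" for n
  proof (induction n)
    case (Suc n)
    from step[OF this] obtain g' where g': "g' \<in> F" "\<And>x. ((deriv ^^ n) f has_real_derivative g' x) (at x)"
      by blast
    hence "deriv ((deriv ^^ n) f) = g'" by (intro ext DERIV_imp_deriv)
    thus ?case using g' by simp
  qed (use assms in simp)
  thus ?thesis unfolding smooth_def
    using step by (metis real_differentiable_def)
qed

lemma smooth_DERIV: "smooth f \<Longrightarrow> (f has_real_derivative deriv f x) (at x)"
  unfolding DERIV_deriv_iff_real_differentiable smooth_def by (metis funpow_0)

lemma smooth_deriv: "smooth f \<Longrightarrow> smooth (deriv f)"
  unfolding smooth_def by (metis comp_apply funpow_Suc_right)

lemma smooth_continuous_on: "smooth f \<Longrightarrow> continuous_on S f"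
  by (meson DERIV_isCont continuous_at_imp_continuous_on smooth_DERIV)

text \<open>The closure operations are generated together because differentiating a product produces
  a sum of products, and the chain rule for an affine substitution produces a product with a
  constant.\<close>

inductive_set smooth_alg :: "(real \<Rightarrow> real) set" where
  base: "smooth f \<Longrightarrow> f \<in> smooth_alg"
| add: "f \<in> smooth_alg \<Longrightarrow> g \<in> smooth_alg \<Longrightarrow> (\<lambda>x. f x + g x) \<in> smooth_alg"
| mult: "f \<in> smooth_alg \<Longrightarrow> g \<in> smooth_alg \<Longrightarrow> (\<lambda>x. f x * g x) \<in> smooth_alg"
| affine: "f \<in> smooth_alg \<Longrightarrow> (\<lambda>x. f (a * x + b)) \<in> smooth_alg"

lemma smooth_const: "smooth (\<lambda>x. c)"
  by (rule smooth_coinduct[where F = "range (\<lambda>c x. c)"]) (auto intro!: exI[of _ 0])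

lemma smooth_algD:
  assumes "f \<in> smooth_alg" shows "smooth f"
  using assms
proof (rule smooth_coinduct)
  fix g :: "real \<Rightarrow> real" assume "g \<in> smooth_alg"
  thus "\<exists>g'\<in>smooth_alg. \<forall>x. (g has_real_derivative g' x) (at x)"
  proof induction
    case (base f)
    thus ?case by (intro bexI[of _ "deriv f"]) (auto intro: smooth_DERIV smooth_alg.base smooth_deriv)
  next
    case (add f g)
    then obtain f' g' where "f' \<in> smooth_alg" "g' \<in> smooth_alg"
      "\<forall>x. (f has_real_derivative f' x) (at x)" "\<forall>x. (g has_real_derivative g' x) (at x)" by blast
    thus ?case
      by (intro bexI[of _ "\<lambda>x. f' x + g' x"]) (auto intro!: derivative_eq_intros smooth_alg.add)
  next
    case (mult f g)
    then obtain f' g' where "f' \<in> smooth_alg" "g' \<in> smooth_alg"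
      "\<forall>x. (f has_real_derivative f' x) (at x)" "\<forall>x. (g has_real_derivative g' x) (at x)" by blast
    thus ?case using mult.hyps
      by (intro bexI[of _ "\<lambda>x. f' x * g x + g' x * f x"] allI DERIV_mult smooth_alg.add smooth_alg.mult) auto
  next
    case (affine f a b)
    then obtain f' where f': "f' \<in> smooth_alg" "\<And>x. (f has_real_derivative f' x) (at x)" by blast
    have "((\<lambda>x. f (a * x + b)) has_real_derivative f' (a * x + b) * a) (at x)" for x
      by (rule DERIV_chain2[OF f'(2)]) (auto intro!: derivative_eq_intros)
    moreover have "(\<lambda>x. f' (a * x + b) * a) \<in> smooth_alg"
      by (rule smooth_alg.mult[OF smooth_alg.affine[OF f'(1)] smooth_alg.base[OF smooth_const]])
    ultimately show ?case by (intro bexI[of _ "\<lambda>x. f' (a * x + b) * a"]) auto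
  qed
qed

lemma smooth_add: "smooth f \<Longrightarrow> smooth g \<Longrightarrow> smooth (\<lambda>x. f x + g x)"
  and smooth_mult: "smooth f \<Longrightarrow> smooth g \<Longrightarrow> smooth (\<lambda>x. f x * g x)"
  and smooth_affine: "smooth f \<Longrightarrow> smooth (\<lambda>x. f (a * x + b))"
  by (blast intro: smooth_algD smooth_alg.base smooth_alg.add smooth_alg.mult,
    blast intro: smooth_algD smooth_alg.base smooth_alg.add smooth_alg.mult,
    rule smooth_algD[OF smooth_alg.affine[OF smooth_alg.base]])

lemma smooth_ident: "smooth (\<lambda>x. x)"
proof (rule smooth_coinduct)
  let ?F = "{f. \<exists>a b. f = (\<lambda>x::real. a * x + b)}"
  show "(\<lambda>x. x) \<in> ?F" by (intro CollectI exI[of _ 1] exI[of _ 0]) simp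
  fix g assume "g \<in> ?F"
  then obtain a b where "g = (\<lambda>x. a * x + b)" by blast
  thus "\<exists>g'\<in>?F. \<forall>x. (g has_real_derivative g' x) (at x)"
    by (intro bexI[of _ "\<lambda>x. 0 * x + a"] CollectI exI[of _ 0] exI[of _ a])
      (auto intro!: derivative_eq_intros)
qed

text \<open>The span of the functions \<open>x ^ (- k) * exp (- 1 / x)\<close> is closed under differentiation.\<close>

inductive_set flat_span :: "(real \<Rightarrow> real) set" where
  base: "(\<lambda>x. if x > 0 then inverse x ^ k * exp (- inverse x) else 0) \<in> flat_span"
| comb: "f \<in> flat_span \<Longrightarrow> g \<in> flat_span \<Longrightarrow> (\<lambda>x. c * f x + g x) \<in> flat_span"

text \<open>Away from 0 this is the product rule. At 0 the difference quotient is 0 from the left,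
  and from the right a power of \<open>inverse h\<close> divided by \<open>exp (inverse h)\<close>,
  which tends to 0.\<close>

lemma flat_base_DERIV:
  defines "B \<equiv> \<lambda>k x::real. if x > 0 then inverse x ^ k * exp (- inverse x) else 0"
  shows "(B k has_real_derivative (- real k) * B (Suc k) x + B (k + 2) x) (at x)"
proof -
  consider "x > 0" | "x < 0" | "x = 0" by linarith
  thus ?thesis
  proof cases
    case 1
    have "((\<lambda>x. inverse x ^ k * exp (- inverse x)) has_real_derivative
        (- real k) * B (Suc k) x + B (k + 2) x) (at x)"
      using 1 power_minus_mult[of k "inverse x"]
      by (cases "k = 0") (auto simp: B_def intro!: derivative_eq_intros simp: algebra_simps)
    thus ?thesis
      by (rule has_field_derivative_transform_within_open[where S = "{0<..}"])
        (use 1 in \<open>auto simp: B_def\<close>)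
  next
    case 2
    have "((\<lambda>x. 0) has_real_derivative (- real k) * B (Suc k) x + B (k + 2) x) (at x)"
      using 2 by (auto simp: B_def)
    thus ?thesis
      by (rule has_field_derivative_transform_within_open[where S = "{..<0}"])
        (use 2 in \<open>auto simp: B_def\<close>)
  next
    case 3
    have r: "((\<lambda>h. B k h / h) \<longlongrightarrow> 0) (at_right 0)"
    proof (rule Lim_transform_eventually)
      have "((\<lambda>h. inverse h ^ Suc k / exp (inverse h)) \<longlongrightarrow> (0::real)) (at_right 0)"
        by (rule filterlim_compose[OF tendsto_power_div_exp_0 filterlim_inverse_at_top_right])
      thus "((\<lambda>h. inverse h ^ Suc k / exp (inverse h)) \<longlongrightarrow> (0::real)) (at_right 0)" .
      show "\<forall>\<^sub>F h in at_right 0. inverse h ^ Suc k / exp (inverse h) = B k h / h"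
        by (intro eventually_at_rightI[of 0 1]) (auto simp: B_def exp_minus field_simps)
    qed
    have l: "((\<lambda>h. B k h / h) \<longlongrightarrow> 0) (at_left 0)"
      by (rule tendsto_eventually, intro eventually_at_leftI[of "-1"]) (auto simp: B_def)
    from r l have "((\<lambda>h. B k h / h) \<longlongrightarrow> 0) (at 0)"
      by (simp add: filterlim_split_at)
    thus ?thesis using 3 by (simp add: B_def DERIV_def cong: if_cong)
  qed
qed

definition bump :: "real \<Rightarrow> real" where
  "bump x = (if x > 0 then exp (- inverse x) else 0)"

lemma smooth_bump: "smooth bump"
proof (rule smooth_coinduct)
  show "bump \<in> flat_span"
    using flat_span.base[of 0] by (simp add: bump_def[abs_def] cong: if_cong)
  fix g :: "real \<Rightarrow> real" assume "g \<in> flat_span"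
  thus "\<exists>g'\<in>flat_span. \<forall>x. (g has_real_derivative g' x) (at x)"
  proof induction
    case (base k)
    show ?case
      using flat_base_DERIV[of k] flat_span.comb[OF flat_span.base[of "Suc k"] flat_span.base[of "k + 2"], of "- real k"]
      by (intro bexI) auto
  next
    case (comb f g c)
    then obtain f' g' where "f' \<in> flat_span" "g' \<in> flat_span"
      "\<forall>x. (f has_real_derivative f' x) (at x)" "\<forall>x. (g has_real_derivative g' x) (at x)" by blast
    thus ?case
      by (intro bexI[of _ "\<lambda>x. c * f' x + g' x"]) (auto intro!: derivative_eq_intros flat_span.comb)
  qed
qed

section \<open>Test functions and the fundamental lemma of the calculus of variations\<close>

lemma test_fun_iff: "\<psi> \<in> test_fun \<longleftrightarrow> smooth \<psi> \<and> (\<exists>a b. -1 < a \<and> b < 1 \<and> (\<forall>x. x \<notin> {a..b} \<longrightarrow> \<psi> x = 0))"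
  by (simp add: test_fun_def smooth_def)

lemma test_fun_deriv:
  assumes "\<psi> \<in> test_fun" shows "deriv \<psi> \<in> test_fun"
proof -
  from assms obtain a b where ab: "smooth \<psi>" "-1 < a" "b < 1" "\<And>x. x \<notin> {a..b} \<Longrightarrow> \<psi> x = 0"
    by (auto simp: test_fun_iff)
  have "deriv \<psi> x = 0" if x: "x \<notin> {a..b}" for x
  proof (rule DERIV_imp_deriv)
    have "((\<lambda>x. 0) has_real_derivative 0) (at x)" by simp
    thus "(\<psi> has_real_derivative 0) (at x)"
      by (rule has_field_derivative_transform_within_open[where S = "- {a..b}"])
        (use x ab(4) in auto)
  qed
  thus ?thesis using ab smooth_deriv unfolding test_fun_iff by blast
qed

lemma test_fun_mult:
  assumes "\<psi> \<in> test_fun" "smooth f" shows "(\<lambda>x. \<psi> x * f x) \<in> test_fun"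
  using assms smooth_mult unfolding test_fun_iff by fastforce

lemma function_ring_smooth: "function_ring_on (Collect smooth) {-1..1}"
proof
  fix x y :: real assume "x \<noteq> y"
  thus "\<exists>f\<in>Collect smooth. f x \<noteq> f y" by (intro bexI[of _ "\<lambda>x. x"]) (auto intro: smooth_ident)
qed (auto intro: smooth_add smooth_mult smooth_const smooth_continuous_on)

text \<open>A test function that is positive on \<open>(-b, b)\<close> turns every smooth function into a test
  function, so its product with \<open>w\<close> is orthogonal to the dense ring of smooth functions.\<close>

lemma test_fun_orthogonal_zero:
  assumes w: "w \<in> L2" and orth: "\<And>\<psi>. \<psi> \<in> test_fun \<Longrightarrow> (LINT x|Lam. w x * of_real (\<psi> x)) = 0"
  shows "AE x in Lam. w x = 0"
proof -
  \<comment> \<open>The sequence \<open>b n\<close> increases to 1, and \<open>chi n\<close> is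
    positive exactly on the open interval from \<open>- b n\<close> to \<open>b n\<close>, so these
    supports exhaust the interior.\<close>
  define b where "b n = 1 - 1 / real (n + 2)" for n
  define chi where "chi n x = bump (b n - x) * bump (b n + x)" for n x
  have b: "0 < b n" "b n < 1" for n by (auto simp: b_def field_simps)
  have sm: "smooth (chi n)" for n
    using smooth_mult[OF smooth_affine[OF smooth_bump, of "-1" "b n"] smooth_affine[OF smooth_bump, of 1 "b n"]]
    by (simp add: chi_def[abs_def] algebra_simps)
  have test: "chi n \<in> test_fun" for n
    unfolding test_fun_iff using sm[of n] b[of n]
    by (intro conjI exI[of _ "- b n"] exI[of _ "b n"]) (auto simp: chi_def bump_def)
  have "AE x in Lam. w x * of_real (chi n x) = 0" for n
  proof (rule ring_orthogonal_zero[OF function_ring_smooth])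
    have "\<bar>chi n x\<bar> \<le> 1" for x by (auto simp: chi_def bump_def abs_mult intro!: mult_le_one)
    hence "(cmod (w x * of_real (chi n x)))\<^sup>2 \<le> (cmod (w x))\<^sup>2" for x
      by (intro power_mono) (auto simp: norm_mult mult_left_le)
    moreover have "(\<lambda>x. w x * of_real (chi n x)) \<in> borel_measurable Lam"
      using w continuous_measurable_Lam[OF smooth_continuous_on[OF sm]]
      by (auto simp: L2_def)
    ultimately show "(\<lambda>x. w x * of_real (chi n x)) \<in> L2"
      using w unfolding L2_sqi by (intro sqi_bound) (auto simp: sqi_def)
    show "(LINT x|Lam. w x * of_real (chi n x) * of_real (a x)) = 0" if "a \<in> Collect smooth" for a
      using orth[OF test_fun_mult[OF test]] that by (simp add: mult.assoc)
  qed
  \<comment> \<open>Countably many exceptional null sets are merged, so that one may choose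
    \<open>n\<close> depending on the point.\<close>
  hence "AE x in Lam. \<forall>n. w x * of_real (chi n x) = 0" unfolding AE_all_countable by blast
  thus ?thesis using Lam_AE_interior
  proof eventually_elim
    case (elim x)
    have "0 < 1 - \<bar>x\<bar>" using elim by auto
    then obtain m where m: "inverse (real (Suc m)) < 1 - \<bar>x\<bar>" using reals_Archimedean by blast
    have "1 / real (m + 2) \<le> inverse (real (Suc m))" by (simp add: field_simps)
    with m have "1 / real (m + 2) < 1 - \<bar>x\<bar>" by linarith
    hence "chi m x \<noteq> 0" by (auto simp: chi_def bump_def b_def)
    thus ?case using elim by auto
  qed
qed

text \<open>This neutralizes the arbitrary choice in \<open>weak_deriv\<close>: any explicit weak
  derivative may be used to compute a Sobolev norm.\<close>

lemma is_weak_deriv_unique: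
  assumes "is_weak_deriv j g w" "is_weak_deriv j g w'"
  shows "AE x in Lam. w x = w' x"
proof -
  have ws: "w \<in> sqi Lam" "w' \<in> sqi Lam" using assms by (auto simp: is_weak_deriv_def L2_sqi)
  have "AE x in Lam. w x - w' x = 0"
  proof (rule test_fun_orthogonal_zero)
    show "(\<lambda>x. w x - w' x) \<in> L2" using ws by (simp add: L2_sqi sqi_diff)
    fix \<psi> assume p: "\<psi> \<in> test_fun"
    have "(\<lambda>x. complex_of_real (\<psi> x)) \<in> sqi Lam"
      using p continuous_L2 unfolding L2_sqi
      by (auto simp: test_fun_iff intro!: continuous_on_of_real smooth_continuous_on)
    hence "ip Lam (\<lambda>x. w x - w' x) (\<lambda>x. of_real (\<psi> x)) = ip Lam w (\<lambda>x. of_real (\<psi> x)) - ip Lam w' (\<lambda>x. of_real (\<psi> x))"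
      using ws by (intro ip_diff_left)
    thus "(LINT x|Lam. (w x - w' x) * of_real (\<psi> x)) = 0"
      using assms p by (simp add: is_weak_deriv_def ip_def)
  qed
  thus ?thesis by simp
qed

lemma tendsto_zero_squeeze:
  assumes "\<And>x. 0 \<le> f x" "\<And>x. f x \<le> g x" "(g \<longlongrightarrow> (0::real)) F"
  shows "(f \<longlongrightarrow> 0) F"
  by (rule Lim_null_comparison[OF _ assms(3)]) (simp add: assms always_eventually)

section \<open>Trigonometric sums on the extended interval\<close>

definition freq :: "real \<Rightarrow> int \<Rightarrow> real" where
  "freq T l = pi / T * of_int l"

definition fsum :: "real \<Rightarrow> int set \<Rightarrow> (int \<Rightarrow> complex) \<Rightarrow> real \<Rightarrow> complex" where
  "fsum T S c x = (\<Sum>l\<in>S. c l * phi T l x)"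

lemma phi_eq: "phi T l x = (if l = 0 then of_real (1 / sqrt 2) else 1) * exp (\<i> * of_real (freq T l * x))"
  by (simp add: phi_def freq_def)

lemma phi_shift: "phi T l (x + h) = exp (\<i> * of_real (freq T l * h)) * phi T l x"
  by (simp add: phi_eq distrib_left exp_add mult_ac)

lemma continuous_on_phi: "continuous_on A (phi T l)"
  unfolding phi_eq[abs_def] by (intro continuous_intros)

lemma continuous_on_fsum: "continuous_on A (fsum T S c)"
  unfolding fsum_def[abs_def] by (intro continuous_intros continuous_on_subset[OF continuous_on_phi[of UNIV]]) auto

lemma fsum_sqi: "fsum T S c \<in> sqi Lam"
  using continuous_L2[OF continuous_on_fsum] by (simp add: L2_sqi)

lemma integral_exp_period:
  assumes "0 < T"
  shows "(LINT x|lebesgue_on {-T..T}. exp (\<i> * of_real (freq T n * x))) = (if n = 0 then of_real (2 * T) else 0)"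
proof (cases "n = 0")
  case True
  thus ?thesis using assms by (simp add: freq_def space_restrict_space measure_restrict_space scaleR_conv_of_real)
next
  case False
  let ?a = "\<i> * of_real (freq T n)"
  have a: "?a \<noteq> 0" using False assms by (simp add: freq_def)
  have "((\<lambda>x. exp (?a * of_real x)) has_integral (exp (?a * of_real T) / ?a - exp (?a * of_real (-T)) / ?a)) {-T..T}"
  proof (rule fundamental_theorem_of_calculus)
    fix x assume "x \<in> {-T..T}"
    have "((\<lambda>x. exp (?a * x) / ?a) has_field_derivative exp (?a * of_real x)) (at (of_real x))"
      using a by (auto intro!: derivative_eq_intros)
    thus "((\<lambda>x. exp (?a * of_real x) / ?a) has_vector_derivative exp (?a * of_real x)) (at x within {-T..T})"
      by (rule has_vector_derivative_real_field)
  qed (use assms in simp)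
  moreover have "exp (?a * of_real T) = exp (?a * of_real (-T))"
  proof -
    have "exp (?a * of_real T) = exp (?a * of_real (-T) + of_int (2 * n) * (of_real pi * \<i>))"
      using assms by (intro arg_cong[where f = exp]) (simp add: freq_def field_simps)
    also have "\<dots> = exp (?a * of_real (-T))"
      unfolding exp_eq by (intro exI[of _ n]) simp
    finally show ?thesis .
  qed
  ultimately have "integral {-T..T} (\<lambda>x. exp (?a * of_real x)) = 0"
    by (intro integral_unique) simp
  moreover have "integrable (lebesgue_on {-T..T}) (\<lambda>x. exp (?a * of_real x))"
    by (intro continuous_imp_integrable_real continuous_intros)
  ultimately have "(LINT x|lebesgue_on {-T..T}. exp (?a * of_real x)) = 0"
    by (subst lebesgue_integral_eq_integral) auto
  thus ?thesis using False by (simp add: mult.assoc)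
qed

text \<open>Parseval on the full period \<open>{-T..T}\<close>, where the exponentials are
  orthogonal; passing to the smaller interval only decreases the norm. On the interval itself the
  modes are far from orthogonal, so only an upper bound survives.\<close>

lemma nrm_fsum_le:
  assumes "1 < T" "finite S"
  shows "(nrm Lam (fsum T S c))\<^sup>2 \<le> 2 * T * (\<Sum>l\<in>S. (cmod (c l))\<^sup>2)"
proof -
  let ?M = "lebesgue_on {-T..T}"
  define e where "e l x = of_real (1 / sqrt (2 * T)) * exp (\<i> * of_real (freq T l * x))" for l x
  have ec: "continuous_on {-T..T} (e l)" for l unfolding e_def[abs_def] by (intro continuous_intros)
  have es: "e l \<in> sqi ?M" for l
    unfolding sqi_def using continuous_imp_measurable_on_sets_lebesgue[OF ec]
    by (auto intro!: continuous_imp_integrable_real continuous_intros ec)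
  have "ip ?M (e k) (e l) = (if k = l then 1 else 0)" for k l
  proof -
    have "e k x * cnj (e l x) = of_real (1 / (2 * T)) * exp (\<i> * of_real (freq T (k - l) * x))" for x
    proof -
      have "e k x * cnj (e l x) = (of_real (1 / sqrt (2 * T)) * of_real (1 / sqrt (2 * T)))
          * (exp (\<i> * of_real (freq T k * x)) * exp (- (\<i> * of_real (freq T l * x))))"
        by (simp add: e_def exp_cnj)
      also have "complex_of_real (1 / sqrt (2 * T)) * of_real (1 / sqrt (2 * T)) = of_real (1 / (2 * T))"
        using assms by (simp flip: of_real_mult)
      also have "exp (\<i> * of_real (freq T k * x)) * exp (- (\<i> * of_real (freq T l * x)))
          = exp (\<i> * of_real (freq T (k - l) * x))"
        by (simp add: freq_def algebra_simps flip: exp_add)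
      finally show ?thesis .
    qed
    hence "ip ?M (e k) (e l) = of_real (1 / (2 * T)) * (LINT x|?M. exp (\<i> * of_real (freq T (k - l) * x)))"
      unfolding ip_def by simp
    thus ?thesis using assms integral_exp_period[of T "k - l"] by simp
  qed
  note on = nrm_orthonormal_sum[of S e ?M, OF assms(2) es this]
  \<comment> \<open>The factor accounts for the normalization of the constant mode; as it is at most
    1, it disappears in the final estimate.\<close>
  let ?k = "\<lambda>l. if l = 0 then 1 / sqrt 2 else (1::real)"
  have eq: "fsum T S c = (\<lambda>x. \<Sum>l\<in>S. (c l * of_real (sqrt (2 * T) * ?k l)) * e l x)"
    using assms by (auto simp: fsum_def fun_eq_iff phi_eq e_def field_simps intro!: sum.cong)
  have "integral {-1..1} (\<lambda>x. (cmod (fsum T S c x))\<^sup>2) \<le> integral {-T..T} (\<lambda>x. (cmod (fsum T S c x))\<^sup>2)"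
    using assms
    by (intro integral_subset_le integrable_continuous_interval continuous_intros continuous_on_fsum) auto
  moreover have "integral {a..b} (\<lambda>x. (cmod (fsum T S c x))\<^sup>2) = (nrm (lebesgue_on {a..b}) (fsum T S c))\<^sup>2" for a b
    unfolding nrm_square
    by (subst lebesgue_integral_eq_integral)
      (auto intro!: continuous_imp_integrable_real continuous_intros continuous_on_fsum)
  ultimately have "(nrm Lam (fsum T S c))\<^sup>2 \<le> (nrm ?M (fsum T S c))\<^sup>2" by simp
  also have "\<dots> = (\<Sum>l\<in>S. (cmod (c l * of_real (sqrt (2 * T) * ?k l)))\<^sup>2)"
    unfolding eq by (rule on)
  also have "\<dots> \<le> (\<Sum>l\<in>S. 2 * T * (cmod (c l))\<^sup>2)"
  proof (rule sum_mono)
    fix l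
    have "(cmod (c l * of_real (sqrt (2 * T) * ?k l)))\<^sup>2 = (?k l)\<^sup>2 * (2 * T * (cmod (c l))\<^sup>2)"
      using assms by (simp add: norm_mult power_mult_distrib)
    also have "\<dots> \<le> 1 * (2 * T * (cmod (c l))\<^sup>2)"
      using assms by (intro mult_right_mono) (auto simp: power_divide)
    finally show "(cmod (c l * of_real (sqrt (2 * T) * ?k l)))\<^sup>2 \<le> 2 * T * (cmod (c l))\<^sup>2" by simp
  qed
  finally show ?thesis by (simp add: sum_distrib_left)
qed

lemma nrm_fsum_ell2:
  assumes "1 < T" "finite S" "c \<in> ell2"
  shows "nrm Lam (fsum T S c) \<le> sqrt (2 * T) * ell2_norm c"
proof (rule power2_le_imp_le)
  have "(nrm Lam (fsum T S c))\<^sup>2 \<le> 2 * T * (\<Sum>l\<in>S. (cmod (c l))\<^sup>2)"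
    using assms by (intro nrm_fsum_le)
  also have "\<dots> \<le> 2 * T * (ell2_norm c)\<^sup>2"
    using assms by (intro mult_left_mono ell2_sum_le) auto
  finally show "(nrm Lam (fsum T S c))\<^sup>2 \<le> (sqrt (2 * T) * ell2_norm c)\<^sup>2"
    using assms by (simp add: power_mult_distrib)
qed (use assms in simp)

lemma fsum_mono_neutral:
  "finite S' \<Longrightarrow> S \<subseteq> S' \<Longrightarrow> (\<And>l. l \<in> S' - S \<Longrightarrow> c l = 0) \<Longrightarrow> fsum T S c = fsum T S' c"
  unfolding fsum_def fun_eq_iff by (intro allI sum.mono_neutral_left) auto

lemma fsum_restrict: "finite S \<Longrightarrow> fsum T S c = fsum T S (\<lambda>l. if l \<in> S then c l else 0)"
  by (auto simp: fsum_def)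

lemma fsum_restrict_superset:
  assumes "finite S'" "S \<subseteq> S'"
  shows "fsum T S c = fsum T S' (\<lambda>l. if l \<in> S then c l else 0)"
  using assms by (subst fsum_restrict) (auto intro!: fsum_mono_neutral intro: finite_subset)

lemma fsum_add: "fsum T S (\<lambda>l. c l + d l) x = fsum T S c x + fsum T S d x"
  and fsum_diff: "fsum T S (\<lambda>l. c l - d l) x = fsum T S c x - fsum T S d x"
  and fsum_cmult: "fsum T S (\<lambda>l. z * c l) x = z * fsum T S c x"
  by (simp_all add: fsum_def algebra_simps sum.distrib sum_subtractf sum_distrib_left)

section \<open>The Fourier extension operator\<close>

definition drop_modes :: "int set \<Rightarrow> (int \<Rightarrow> complex) \<Rightarrow> int \<Rightarrow> complex" where
  "drop_modes S c = (\<lambda>l. if l \<in> S then 0 else c l)"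

lemma drop_modes_ell2: "c \<in> ell2 \<Longrightarrow> drop_modes S c \<in> ell2"
  by (rule ell2_comparison(1)[where K = 1 and d = c]) (auto simp: drop_modes_def)

lemma drop_modes_tendsto:
  assumes "c \<in> ell2"
  shows "((\<lambda>S. sqrt (2 * T) * ell2_norm (drop_modes S c)) \<longlongrightarrow> 0) (finite_subsets_at_top UNIV)"
proof -
  have "((\<lambda>S. sqrt (2 * T) * sqrt ((ell2_norm (drop_modes S c))\<^sup>2)) \<longlongrightarrow> sqrt (2 * T) * sqrt 0) (finite_subsets_at_top UNIV)"
    unfolding drop_modes_def by (intro tendsto_intros ell2_tail_tendsto assms)
  thus ?thesis by simp
qed

text \<open>On \<open>X\<close> the two sums agree, so their difference only involves tail
  coefficients. The Cauchy property and the convergence over finite sets both follow from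
  this.\<close>

lemma nrm_fsum_diff_le:
  assumes "1 < T" "c \<in> ell2" "finite S" "finite S'" "X \<subseteq> S" "X \<subseteq> S'"
  shows "nrm Lam (\<lambda>x. fsum T S c x - fsum T S' c x) \<le> sqrt (2 * T) * ell2_norm (drop_modes X c)"
proof -
  let ?d = "\<lambda>l. (if l \<in> S then c l else 0) - (if l \<in> S' then c l else 0)"
  have "(\<lambda>x. fsum T S c x - fsum T S' c x) = fsum T (S \<union> S') ?d"
    using assms by (subst (1 2) fsum_restrict_superset[of "S \<union> S'"]) (auto simp: fsum_diff)
  moreover have "?d \<in> ell2" "ell2_norm ?d \<le> 1 * ell2_norm (drop_modes X c)"
    by (rule ell2_comparison[where K = 1, OF drop_modes_ell2[OF assms(2), of X]]; use assms in \<open>auto simp: drop_modes_def\<close>)+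
  moreover have "sqrt (2 * T) * ell2_norm ?d \<le> sqrt (2 * T) * ell2_norm (drop_modes X c)"
    using \<open>ell2_norm ?d \<le> 1 * ell2_norm (drop_modes X c)\<close> assms by (intro mult_left_mono) auto
  moreover have "nrm Lam (fsum T (S \<union> S') ?d) \<le> sqrt (2 * T) * ell2_norm ?d"
    using assms \<open>?d \<in> ell2\<close> by (intro nrm_fsum_ell2) auto
  ultimately show ?thesis by (simp only: order_trans)
qed

text \<open>Completeness is available for sequences, so the limit is first built from the symmetric
  partial sums. The sum over an arbitrary finite \<open>S\<close> is then compared with a symmetric
  one containing \<open>S\<close>, at the cost of the tail outside \<open>S\<close>.\<close>

lemma fext_exists:
  assumes "1 < T" "c \<in> ell2"
  shows "\<exists>g. g \<in> L2 \<and> ((\<lambda>S. L2_norm (\<lambda>x. (\<Sum>l\<in>S. c l * phi T l x) - g x)) \<longlongrightarrow> 0)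
       (finite_subsets_at_top UNIV)"
proof -
  let ?x = "\<lambda>n::nat. fsum T {- int n..int n} c"
  have sub: "\<exists>N. \<forall>n\<ge>N. X \<subseteq> {- int n..int n}" if X: "finite X" for X :: "int set"
  proof -
    have "X \<subseteq> {- int n..int n}" if "n \<ge> (\<Sum>l\<in>X. nat \<bar>l\<bar>)" for n
    proof
      fix l assume "l \<in> X"
      hence "nat \<bar>l\<bar> \<le> (\<Sum>l\<in>X. nat \<bar>l\<bar>)" using X by (intro member_le_sum) auto
      thus "l \<in> {- int n..int n}" using that by auto
    qed
    thus ?thesis by blast
  qed
  have "\<exists>g\<in>sqi Lam. (\<lambda>n. nrm Lam (\<lambda>t. ?x n t - g t)) \<longlonglongrightarrow> 0"
  proof (rule sqi_complete[OF finite_measure_Lam fsum_sqi])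
    fix e :: real assume "0 < e"
    hence "\<forall>\<^sub>F S in finite_subsets_at_top UNIV. dist (sqrt (2 * T) * ell2_norm (drop_modes S c)) 0 < e"
      by (intro tendstoD drop_modes_tendsto assms)
    then obtain X where X: "finite X" "dist (sqrt (2 * T) * ell2_norm (drop_modes X c)) 0 < e"
      unfolding eventually_finite_subsets_at_top by blast
    obtain N where N: "\<And>n. n \<ge> N \<Longrightarrow> X \<subseteq> {- int n..int n}" using sub[OF X(1)] by blast
    have "nrm Lam (\<lambda>t. ?x m t - ?x n t) < e" if "m \<ge> N" "n \<ge> N" for m n
      using nrm_fsum_diff_le[OF assms _ _ N[OF that(1)] N[OF that(2)]] X(2)
      by (simp add: dist_real_def)
    thus "\<exists>N. \<forall>m\<ge>N. \<forall>n\<ge>N. nrm Lam (\<lambda>t. ?x m t - ?x n t) < e" by blast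
  qed
  then obtain g where g: "g \<in> sqi Lam" "(\<lambda>n. nrm Lam (\<lambda>t. ?x n t - g t)) \<longlonglongrightarrow> 0" by blast
  have "nrm Lam (\<lambda>t. fsum T S c t - g t) \<le> sqrt (2 * T) * ell2_norm (drop_modes S c)" if S: "finite S" for S
  proof -
    obtain N where N: "\<And>n. n \<ge> N \<Longrightarrow> S \<subseteq> {- int n..int n}" using sub[OF S] by blast
    have "nrm Lam (\<lambda>t. fsum T S c t - g t) \<le> sqrt (2 * T) * ell2_norm (drop_modes S c) + nrm Lam (\<lambda>t. ?x n t - g t)"
      if "n \<ge> N" for n
      using nrm_triangle[OF fsum_sqi fsum_sqi g(1), of T S c T "{- int n..int n}" c]
        nrm_fsum_diff_le[OF assms S _ subset_refl N[OF that]] by simp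
    moreover have "(\<lambda>n. sqrt (2 * T) * ell2_norm (drop_modes S c) + nrm Lam (\<lambda>t. ?x n t - g t))
        \<longlonglongrightarrow> sqrt (2 * T) * ell2_norm (drop_modes S c) + 0"
      by (intro tendsto_add tendsto_const g)
    ultimately show ?thesis by (intro LIMSEQ_le_const) auto
  qed
  hence "\<forall>\<^sub>F S in finite_subsets_at_top UNIV.
      norm (nrm Lam (\<lambda>t. fsum T S c t - g t)) \<le> sqrt (2 * T) * ell2_norm (drop_modes S c)"
    by (auto simp: eventually_finite_subsets_at_top)
  from Lim_null_comparison[OF this drop_modes_tendsto[OF assms(2)]] g(1) show ?thesis
    by (auto simp: L2_sqi L2_norm_nrm fsum_def intro!: exI[of _ g])
qed

lemma
  assumes "1 < T" "c \<in> ell2"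
  shows fext_sqi: "fext T c \<in> sqi Lam"
    and fext_tendsto: "((\<lambda>S. nrm Lam (\<lambda>x. fsum T S c x - fext T c x)) \<longlongrightarrow> 0) (finite_subsets_at_top UNIV)"
  using someI_ex[OF fext_exists[OF assms]]
  unfolding fext_def[symmetric] by (simp_all add: L2_sqi L2_norm_nrm fsum_def)

text \<open>The function behind \<open>fext\<close> is an arbitrary choice; every computation with
  it goes through this characterization up to null sets.\<close>

lemma fext_unique:
  assumes "1 < T" "c \<in> ell2" "g \<in> sqi Lam"
    "((\<lambda>S. nrm Lam (\<lambda>x. fsum T S c x - g x)) \<longlongrightarrow> 0) (finite_subsets_at_top UNIV)"
  shows "AE x in Lam. fext T c x = g x"
proof -
  note F = fext_sqi[OF assms(1,2)]
  have "nrm Lam (\<lambda>x. fext T c x - g x) \<le>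
      nrm Lam (\<lambda>x. fsum T S c x - fext T c x) + nrm Lam (\<lambda>x. fsum T S c x - g x)" for S
    using nrm_triangle[OF F fsum_sqi assms(3), of T S c]
    by (simp add: nrm_minus_commute[of Lam "fext T c" "fsum T S c"])
  moreover have "((\<lambda>S. nrm Lam (\<lambda>x. fsum T S c x - fext T c x) + nrm Lam (\<lambda>x. fsum T S c x - g x)) \<longlongrightarrow> 0 + 0)
      (finite_subsets_at_top UNIV)"
    by (intro tendsto_add fext_tendsto assms)
  ultimately have "nrm Lam (\<lambda>x. fext T c x - g x) \<le> 0 + 0"
    by (intro tendsto_lowerbound[where F = "finite_subsets_at_top UNIV"]) (auto intro!: always_eventually)
  hence "nrm Lam (\<lambda>x. fext T c x - g x) = 0" by (simp add: order_antisym)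
  from nrm_zero_AE[OF sqi_diff[OF F assms(3)] this] show ?thesis by simp
qed

lemma nrm_fext_le:
  assumes "1 < T" "c \<in> ell2"
  shows "nrm Lam (fext T c) \<le> sqrt (2 * T) * ell2_norm c"
proof -
  have "((\<lambda>S. nrm Lam (fsum T S c)) \<longlongrightarrow> nrm Lam (fext T c)) (finite_subsets_at_top UNIV)"
    by (rule nrm_tendsto[OF fsum_sqi fext_sqi fext_tendsto]) (use assms in auto)
  thus ?thesis
    by (rule tendsto_upperbound)
      (auto simp: eventually_finite_subsets_at_top intro!: nrm_fsum_ell2 assms)
qed

lemma fext_finite:
  assumes "1 < T" "finite S" "\<And>l. l \<notin> S \<Longrightarrow> c l = 0"
  shows "AE x in Lam. fext T c x = fsum T S c x"
proof (rule fext_unique[OF assms(1) ell2_finite_support[OF assms(2,3)] fsum_sqi])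
  have "\<forall>\<^sub>F S' in finite_subsets_at_top UNIV. 0 = nrm Lam (\<lambda>x. fsum T S' c x - fsum T S c x)"
    unfolding eventually_finite_subsets_at_top
  proof (intro exI[of _ S] conjI allI impI)
    fix S' assume "finite S' \<and> S \<subseteq> S' \<and> S' \<subseteq> UNIV"
    hence "fsum T S c = fsum T S' c" using assms(3) by (intro fsum_mono_neutral) auto
    thus "0 = nrm Lam (\<lambda>x. fsum T S' c x - fsum T S c x)" by (simp add: nrm_def)
  qed (use assms in auto)
  thus "((\<lambda>S'. nrm Lam (\<lambda>x. fsum T S' c x - fsum T S c x)) \<longlongrightarrow> 0) (finite_subsets_at_top UNIV)"
    by (rule Lim_transform_eventually[OF tendsto_const])
qed

lemma fext_comb:
  assumes "1 < T" "c \<in> ell2" "d \<in> ell2"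
  shows "AE x in Lam. fext T (\<lambda>l. c l - d l) x = fext T c x - fext T d x"
proof (rule fext_unique[OF assms(1) ell2_diff[OF assms(2,3)]])
  note Fc = fext_sqi[OF assms(1,2)] and Fd = fext_sqi[OF assms(1,3)]
  show "(\<lambda>x. fext T c x - fext T d x) \<in> sqi Lam" by (rule sqi_diff[OF Fc Fd])
  have "nrm Lam (\<lambda>x. fsum T S (\<lambda>l. c l - d l) x - (fext T c x - fext T d x)) \<le>
      nrm Lam (\<lambda>x. fsum T S c x - fext T c x) + nrm Lam (\<lambda>x. fsum T S d x - fext T d x)" for S
    using nrm_diff_le[OF sqi_diff[OF fsum_sqi Fc] sqi_diff[OF fsum_sqi Fd], of T S c T S d]
    by (simp add: fsum_diff algebra_simps)
  moreover have "((\<lambda>S. nrm Lam (\<lambda>x. fsum T S c x - fext T c x) + nrm Lam (\<lambda>x. fsum T S d x - fext T d x))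
      \<longlongrightarrow> 0) (finite_subsets_at_top UNIV)"
    by (intro tendsto_add_zero fext_tendsto assms)
  ultimately show "((\<lambda>S. nrm Lam (\<lambda>x. fsum T S (\<lambda>l. c l - d l) x - (fext T c x - fext T d x))) \<longlongrightarrow> 0)
      (finite_subsets_at_top UNIV)"
    by (rule tendsto_zero_squeeze[OF nrm_nonneg])
qed

section \<open>Density of the range\<close>

text \<open>The linear span of the exponentials in inductive form, so that closure under products
  follows by a double induction on the generators.\<close>

inductive_set trig :: "real \<Rightarrow> (real \<Rightarrow> complex) set" for T where
  base: "(\<lambda>x. exp (\<i> * of_real (freq T l * x))) \<in> trig T"
| comb: "f \<in> trig T \<Longrightarrow> g \<in> trig T \<Longrightarrow> (\<lambda>x. z * f x + g x) \<in> trig T"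

lemma trig_scale: "f \<in> trig T \<Longrightarrow> (\<lambda>x. z * f x) \<in> trig T"
  \<comment> \<open>The zero function is not known to belong to the span yet, so
    \<open>z * f\<close> is written as \<open>(z - 1) * f + f\<close>.\<close>
  using trig.comb[of f T f "z - 1"] by (simp add: algebra_simps)

lemma trig_add: "f \<in> trig T \<Longrightarrow> g \<in> trig T \<Longrightarrow> (\<lambda>x. f x + g x) \<in> trig T"
  using trig.comb[of f T g 1] by simp

lemma trig_mult: "f \<in> trig T \<Longrightarrow> g \<in> trig T \<Longrightarrow> (\<lambda>x. f x * g x) \<in> trig T"
proof (induction rule: trig.induct)
  case (base k)
  from base(1) show ?case
  proof induction
    case (base l)
    show ?case using trig.base[of T "k + l"] by (simp add: freq_def algebra_simps flip: exp_add)
  next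
    case (comb f g z)
    thus ?case using trig.comb[OF comb.IH, of z] by (simp add: algebra_simps)
  qed
next
  case (comb f h z)
  thus ?case using trig.comb[OF comb.IH(1)[OF comb.prems] comb.IH(2)[OF comb.prems], of z]
    by (simp add: algebra_simps)
qed

lemma trig_const: "(\<lambda>x. z) \<in> trig T"
  using trig_scale[OF trig.base[of T 0], of z] by (simp add: freq_def)

lemma trig_continuous: "f \<in> trig T \<Longrightarrow> continuous_on A f"
  by (induction rule: trig.induct) (auto intro!: continuous_intros)

lemma trig_fsum: "f \<in> trig T \<Longrightarrow> \<exists>S c. finite S \<and> f = fsum T S c"
proof (induction rule: trig.induct)
  case (base l)
  show ?case
    by (intro exI[of _ "{l}"] exI[of _ "\<lambda>_. if l = 0 then of_real (sqrt 2) else 1"])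
      (auto simp: fsum_def phi_eq fun_eq_iff)
next
  case (comb f g z)
  then obtain S c S' d where f: "finite S" "f = fsum T S c" "finite S'" "g = fsum T S' d" by blast
  show ?case
    using f by (intro exI[of _ "S \<union> S'"] exI[of _ "\<lambda>l. z * (if l \<in> S then c l else 0) + (if l \<in> S' then d l else 0)"])
      (auto simp: fun_eq_iff fsum_add fsum_cmult fsum_restrict_superset[of "S \<union> S'" S] fsum_restrict_superset[of "S \<union> S'" S'])
qed

text \<open>Cosine and sine of the lowest frequency together separate points at distance less than
  the period \<open>2 * T\<close>. This is where \<open>1 < T\<close> enters: points of the interval
  are at most 2 apart.\<close>

lemma function_ring_trig:
  assumes "1 < T"
  shows "function_ring_on {a. (\<lambda>x. complex_of_real (a x)) \<in> trig T} {-1..1}"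
proof
  fix f assume "f \<in> {a. (\<lambda>x. complex_of_real (a x)) \<in> trig T}"
  hence "continuous_on {-1..1} (\<lambda>x. Re (complex_of_real (f x)))"
    by (intro continuous_on_Re trig_continuous) auto
  thus "continuous_on {-1..1} f" by simp
next
  fix x y :: real assume xy: "x \<in> {-1..1}" "y \<in> {-1..1}" "x \<noteq> y"
  let ?E = "\<lambda>l x. exp (\<i> * of_real (freq T l * x))"
  have "(\<lambda>x. complex_of_real (cos (freq T 1 * x))) \<in> trig T"
    using trig_scale[OF trig_add[OF trig.base[of T 1] trig.base[of T "-1"]], of "1/2"]
    by (simp add: cos_exp_eq freq_def flip: cos_of_real)
  moreover have "(\<lambda>x. complex_of_real (sin (freq T 1 * x))) \<in> trig T"
  proof -
    have "(\<lambda>x. complex_of_real (sin (freq T 1 * x))) = (\<lambda>x. 1/(2*\<i>) * ?E 1 x + (-1/(2*\<i>)) * ?E (-1) x)"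
      unfolding sin_of_real[symmetric] sin_exp_eq
      by (simp add: fun_eq_iff freq_def diff_divide_distrib right_diff_distrib)
    thus ?thesis using trig.comb[OF trig.base[of T 1] trig_scale[OF trig.base[of T "-1"], of "-1/(2*\<i>)"], of "1/(2*\<i>)"]
      by simp
  qed
  moreover have "cos (freq T 1 * x) \<noteq> cos (freq T 1 * y) \<or> sin (freq T 1 * x) \<noteq> sin (freq T 1 * y)"
  proof (rule ccontr)
    assume "\<not> ?thesis"
    then obtain n :: int where n: "freq T 1 * x = freq T 1 * y + 2 * pi * of_int n"
      using sin_cos_eq_iff[of "freq T 1 * x" "freq T 1 * y"] by auto
    hence "pi * (x - y) = pi * (2 * T * of_int n)" using assms by (simp add: freq_def field_simps)
    \<comment> \<open>Equal cosine and sine force the points to differ by a multiple of the period;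
      a nonzero multiple exceeds the length of the interval.\<close>
    hence eq: "x - y = 2 * T * of_int n" by simp
    hence "n \<noteq> 0" using xy by auto
    hence "1 \<le> \<bar>real_of_int n\<bar>" by linarith
    hence "2 * T * 1 \<le> 2 * T * \<bar>real_of_int n\<bar>" using assms by (intro mult_left_mono) auto
    also have "\<dots> = \<bar>x - y\<bar>" unfolding eq using assms by (simp add: abs_mult)
    finally show False using xy assms by auto
  qed
  ultimately have "\<exists>f. f \<in> {a. (\<lambda>x. complex_of_real (a x)) \<in> trig T} \<and> f x \<noteq> f y"
  proof (elim disjE)
    assume "(\<lambda>x. complex_of_real (cos (freq T 1 * x))) \<in> trig T" "cos (freq T 1 * x) \<noteq> cos (freq T 1 * y)"
    thus ?thesis by (intro exI[of _ "\<lambda>x. cos (freq T 1 * x)"] conjI CollectI)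
  next
    assume "(\<lambda>x. complex_of_real (sin (freq T 1 * x))) \<in> trig T" "sin (freq T 1 * x) \<noteq> sin (freq T 1 * y)"
    thus ?thesis by (intro exI[of _ "\<lambda>x. sin (freq T 1 * x)"] conjI CollectI)
  qed
  thus "\<exists>f\<in>{a. (\<lambda>x. complex_of_real (a x)) \<in> trig T}. f x \<noteq> f y" by (simp only: Bex_def)
next
  fix f g assume "f \<in> {a. (\<lambda>x. complex_of_real (a x)) \<in> trig T}" "g \<in> {a. (\<lambda>x. complex_of_real (a x)) \<in> trig T}"
  thus "(\<lambda>x. f x + g x) \<in> {a. (\<lambda>x. complex_of_real (a x)) \<in> trig T}"
    and "(\<lambda>x. f x * g x) \<in> {a. (\<lambda>x. complex_of_real (a x)) \<in> trig T}"
    using trig_add[of "\<lambda>x. of_real (f x)" T "\<lambda>x. of_real (g x)"]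
      trig_mult[of "\<lambda>x. of_real (f x)" T "\<lambda>x. of_real (g x)"] by simp_all
qed (simp_all add: trig_const)

lemma fext_dense:
  assumes "1 < T" "f \<in> L2" "0 < (e::real)"
  shows "\<exists>d\<in>ell2. L2_norm (\<lambda>x. fext T d x - f x) < e"
proof -
  obtain a b where ab: "(\<lambda>x. complex_of_real (a x)) \<in> trig T" "(\<lambda>x. complex_of_real (b x)) \<in> trig T"
    "L2_norm (\<lambda>x. f x - (of_real (a x) + \<i> * of_real (b x))) < e"
    using approx_by_ring[OF function_ring_trig[OF assms(1)] assms(2,3)] by blast
  have "(\<lambda>x. of_real (a x) + \<i> * of_real (b x)) \<in> trig T" by (intro trig_add trig_scale ab)
  from trig_fsum[OF this] obtain S c where S: "finite S" "(\<lambda>x. of_real (a x) + \<i> * of_real (b x)) = fsum T S c"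
    by blast
  let ?d = "\<lambda>l. if l \<in> S then c l else 0"
  have d: "?d \<in> ell2" using S by (intro ell2_finite_support) auto
  have "AE x in Lam. fext T ?d x = fsum T S ?d x" using S by (intro fext_finite assms) auto
  hence "AE x in Lam. fext T ?d x - f x = fsum T S c x - f x" using fsum_restrict[OF S(1), of T c] by auto
  hence "nrm Lam (\<lambda>x. fext T ?d x - f x) = nrm Lam (\<lambda>x. fsum T S c x - f x)"
    using fext_sqi[OF assms(1) d] fsum_sqi assms(2)
    by (intro nrm_AE_cong sqi_measurable sqi_diff) (auto simp: L2_sqi)
  also have "\<dots> = nrm Lam (\<lambda>x. f x - fsum T S c x)" by (rule nrm_minus_commute)
  also have "\<dots> < e" using ab(3) unfolding L2_norm_nrm S(2)[symmetric] .
  finally show ?thesis using d by (auto simp: L2_norm_nrm)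
qed

lemma least_squares_sol_AE:
  assumes "1 < T" "f \<in> L2" "c \<in> least_squares_sol T f"
  shows "AE x in Lam. fext T c x = f x"
proof -
  have c: "c \<in> ell2" "L2_norm (\<lambda>x. fext T c x - f x) = (INF d\<in>ell2. L2_norm (\<lambda>x. fext T d x - f x))"
    using assms(3) by (auto simp: least_squares_sol_def)
  have "L2_norm (\<lambda>x. fext T c x - f x) \<le> e" if e: "0 < e" for e
  proof -
    obtain d where d: "d \<in> ell2" "L2_norm (\<lambda>x. fext T d x - f x) < e" using fext_dense[OF assms(1,2) e] by blast
    have "(INF d\<in>ell2. L2_norm (\<lambda>x. fext T d x - f x)) \<le> L2_norm (\<lambda>x. fext T d x - f x)"
      by (rule cINF_lower[OF _ d(1)]) (auto intro!: bdd_belowI2[where m = 0] simp: L2_norm_nrm)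
    thus ?thesis using d c by simp
  qed
  hence "nrm Lam (\<lambda>x. fext T c x - f x) = 0"
    unfolding L2_norm_nrm by (metis dense_ge nrm_nonneg order_antisym)
  moreover have "(\<lambda>x. fext T c x - f x) \<in> sqi Lam"
    using assms fext_sqi[OF assms(1) c(1)] by (auto simp: L2_sqi intro: sqi_diff)
  ultimately show ?thesis using nrm_zero_AE by fastforce
qed

section \<open>Weak derivatives of Fourier extensions\<close>

text \<open>Coefficients of the term by term derivative of order \<open>j\<close>. The constant mode
  has frequency 0 and receives the factor \<open>0 ^ j\<close>, which is 1 for
  \<open>j = 0\<close>.\<close>

definition dcoef :: "real \<Rightarrow> nat \<Rightarrow> (int \<Rightarrow> complex) \<Rightarrow> int \<Rightarrow> complex" where
  "dcoef T j c = (\<lambda>l. (\<i> * of_real (freq T l)) ^ j * c l)"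

lemma dcoef_0 [simp]: "dcoef T 0 c = c"
  and dcoef_Suc: "dcoef T (Suc 0) (dcoef T j c) = dcoef T (Suc j) c"
  by (simp_all add: dcoef_def mult_ac)

lemma fsum_has_vector_derivative:
  "(fsum T S c has_vector_derivative fsum T S (dcoef T (Suc 0) c) x) (at x within A)"
proof -
  have "(phi T l has_vector_derivative (\<i> * of_real (freq T l)) * phi T l x) (at x within A)" for l
  proof -
    let ?k = "if l = 0 then of_real (1 / sqrt 2) else (1::complex)"
    have "((\<lambda>z. ?k * exp (\<i> * of_real (freq T l) * z)) has_field_derivative
        (\<i> * of_real (freq T l)) * (?k * exp (\<i> * of_real (freq T l) * of_real x))) (at (of_real x))"
      by (auto intro!: derivative_eq_intros)
    from has_vector_derivative_real_field[OF this, of A] show ?thesis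
      by (simp add: phi_eq[abs_def] mult.assoc)
  qed
  hence "((\<lambda>x. \<Sum>l\<in>S. c l * phi T l x) has_vector_derivative (\<Sum>l\<in>S. c l * ((\<i> * of_real (freq T l)) * phi T l x)))
      (at x within A)"
    by (intro has_vector_derivative_sum has_vector_derivative_mult_right)
  thus ?thesis by (simp add: fsum_def[abs_def] dcoef_def mult_ac)
qed

lemma test_fun_sqi: "\<psi> \<in> test_fun \<Longrightarrow> (\<lambda>x. complex_of_real (\<psi> x)) \<in> sqi Lam"
  using continuous_L2 unfolding L2_sqi
  by (auto simp: test_fun_iff intro!: continuous_on_of_real smooth_continuous_on)

lemma fsum_by_parts:
  assumes "\<psi> \<in> test_fun"
  shows "(LINT x|Lam. fsum T S c x * of_real (deriv \<psi> x)) = - (LINT x|Lam. fsum T S (dcoef T (Suc 0) c) x * of_real (\<psi> x))"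
proof -
  from assms obtain a b where ab: "smooth \<psi>" "-1 < a" "b < 1" "\<And>x. x \<notin> {a..b} \<Longrightarrow> \<psi> x = 0"
    by (auto simp: test_fun_iff)
  let ?w = "fsum T S c" and ?w' = "fsum T S (dcoef T (Suc 0) c)"
  let ?F = "\<lambda>x. ?w x * of_real (deriv \<psi> x) + ?w' x * of_real (\<psi> x)"
  have c: "continuous_on {-1..1} (\<lambda>x. ?w x * of_real (deriv \<psi> x))"
    "continuous_on {-1..1} (\<lambda>x. ?w' x * of_real (\<psi> x))"
    by (intro continuous_intros continuous_on_fsum smooth_continuous_on smooth_deriv ab)+
  have "(?F has_integral (?w 1 * of_real (\<psi> 1) - ?w (-1) * of_real (\<psi> (-1)))) {-1..1}"
  proof (rule fundamental_theorem_of_calculus)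
    fix x :: real
    have "((\<lambda>x. complex_of_real (\<psi> x)) has_vector_derivative of_real (deriv \<psi> x)) (at x within {-1..1})"
      by (intro has_vector_derivative_of_real has_field_derivative_at_within[OF smooth_DERIV[OF ab(1)]])
    from has_vector_derivative_mult[OF fsum_has_vector_derivative this]
    show "((\<lambda>x. ?w x * of_real (\<psi> x)) has_vector_derivative ?F x) (at x within {-1..1})" .
  qed simp
  \<comment> \<open>The support of the test function lies strictly inside the interval, so the
    boundary terms vanish.\<close>
  hence "integral {-1..1} ?F = 0" using ab by (intro integral_unique) auto
  hence "(LINT x|Lam. ?F x) = 0"
    by (subst lebesgue_integral_eq_integral) (auto intro!: continuous_imp_integrable_real continuous_on_add c)
  moreover have "(LINT x|Lam. ?F x) = (LINT x|Lam. ?w x * of_real (deriv \<psi> x)) + (LINT x|Lam. ?w' x * of_real (\<psi> x))"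
    by (intro Bochner_Integration.integral_add continuous_imp_integrable_real c)
  ultimately show ?thesis by (simp add: eq_neg_iff_add_eq_0)
qed

lemma test_fun_deriv_pow: "\<psi> \<in> test_fun \<Longrightarrow> (deriv ^^ j) \<psi> \<in> test_fun"
  by (induction j) (auto intro: test_fun_deriv)

lemma fsum_by_parts_pow:
  "\<psi> \<in> test_fun \<Longrightarrow> (LINT x|Lam. fsum T S c x * of_real ((deriv ^^ j) \<psi> x))
     = (-1) ^ j * (LINT x|Lam. fsum T S (dcoef T j c) x * of_real (\<psi> x))"
proof (induction j arbitrary: \<psi>)
  case (Suc j)
  have "(LINT x|Lam. fsum T S c x * of_real ((deriv ^^ Suc j) \<psi> x))
      = (LINT x|Lam. fsum T S c x * of_real ((deriv ^^ j) (deriv \<psi>) x))"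
    by (simp add: funpow_Suc_right del: funpow.simps)
  also have "\<dots> = (-1) ^ j * (LINT x|Lam. fsum T S (dcoef T j c) x * of_real (deriv \<psi> x))"
    by (rule Suc.IH[OF test_fun_deriv[OF Suc.prems]])
  also have "\<dots> = (-1) ^ Suc j * (LINT x|Lam. fsum T S (dcoef T (Suc j) c) x * of_real (\<psi> x))"
    by (simp add: fsum_by_parts[OF Suc.prems] dcoef_Suc)
  finally show ?case .
qed simp

text \<open>Integration by parts holds for finite sums, and pairing with a fixed test function is
  continuous in the L2 norm on both sides, so the identity survives the limit.\<close>

lemma fext_weak_deriv:
  assumes T: "1 < T" and c: "c \<in> ell2" and d: "dcoef T j c \<in> ell2"
  shows "is_weak_deriv j (fext T c) (fext T (dcoef T j c))"
  unfolding is_weak_deriv_def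
proof (intro conjI ballI)
  show "fext T (dcoef T j c) \<in> L2" using fext_sqi[OF T d] by (simp add: L2_sqi)
  fix \<psi> assume psi: "\<psi> \<in> test_fun"
  have "((\<lambda>S. ip Lam (fsum T S c) (\<lambda>x. of_real ((deriv ^^ j) \<psi> x))) \<longlongrightarrow>
      ip Lam (fext T c) (\<lambda>x. of_real ((deriv ^^ j) \<psi> x))) (finite_subsets_at_top UNIV)"
    by (intro ip_tendsto fsum_sqi fext_sqi fext_tendsto T c test_fun_sqi test_fun_deriv_pow psi)
  moreover have "((\<lambda>S. (-1) ^ j * ip Lam (fsum T S (dcoef T j c)) (\<lambda>x. of_real (\<psi> x))) \<longlongrightarrow>
      (-1) ^ j * ip Lam (fext T (dcoef T j c)) (\<lambda>x. of_real (\<psi> x))) (finite_subsets_at_top UNIV)"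
    by (intro tendsto_mult_left ip_tendsto fsum_sqi fext_sqi fext_tendsto T d test_fun_sqi psi)
  moreover have "ip Lam (fsum T S c) (\<lambda>x. of_real ((deriv ^^ j) \<psi> x)) =
      (-1) ^ j * ip Lam (fsum T S (dcoef T j c)) (\<lambda>x. of_real (\<psi> x))" for S
    using fsum_by_parts_pow[OF psi] by (simp add: ip_def)
  ultimately have "ip Lam (fext T c) (\<lambda>x. of_real ((deriv ^^ j) \<psi> x)) =
      (-1) ^ j * ip Lam (fext T (dcoef T j c)) (\<lambda>x. of_real (\<psi> x))"
    by (intro tendsto_unique[OF finite_subsets_at_top_neq_bot]) auto
  thus "(LINT x|Lam. fext T c x * of_real ((deriv ^^ j) \<psi> x)) =
      (-1) ^ j * (LINT x|Lam. fext T (dcoef T j c) x * of_real (\<psi> x))"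
    by (simp add: ip_def)
qed

section \<open>Gagliardo seminorms\<close>

text \<open>The difference quotient whose squared modulus is the Gagliardo integrand. Being linear
  in \<open>w\<close>, it turns the seminorm into an L2 norm over the square, with its triangle
  inequality and Fatou's lemma.\<close>

definition gq :: "real \<Rightarrow> (real \<Rightarrow> complex) \<Rightarrow> real \<times> real \<Rightarrow> complex" where
  "gq \<theta> w z = of_real (\<bar>fst z - snd z\<bar> powr - (1/2 + \<theta>)) * (w (fst z) - w (snd z))"

lemma gagliardo_gq: "gagliardo \<theta> w z = (cmod (gq \<theta> w z))\<^sup>2"
proof -
  have "(\<bar>x - y\<bar> powr - (1/2 + \<theta>))\<^sup>2 = inverse (\<bar>x - y\<bar> powr (1 + 2 * \<theta>))" for x y :: real
    unfolding power2_eq_square powr_add[symmetric] powr_minus[symmetric] by simp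
  moreover obtain x y where "z = (x, y)" by (cases z)
  moreover have "(cmod (gq \<theta> w (x, y)))\<^sup>2 = (\<bar>x - y\<bar> powr - (1/2 + \<theta>))\<^sup>2 * (cmod (w x - w y))\<^sup>2"
    by (simp add: gq_def norm_mult power_mult_distrib)
  ultimately show ?thesis
    by (simp only: gagliardo_def prod.case divide_inverse mult.commute)
qed

lemma gq_measurable:
  assumes "w \<in> borel_measurable Lam"
  shows "gq \<theta> w \<in> borel_measurable (Lam \<Otimes>\<^sub>M Lam)"
proof -
  have [measurable]: "w \<in> borel_measurable Lam" by (fact assms)
  have id: "(\<lambda>x::real. x) \<in> borel_measurable Lam" by (intro continuous_measurable_Lam continuous_intros)
  have [measurable]: "fst \<in> borel_measurable (Lam \<Otimes>\<^sub>M Lam)" "snd \<in> borel_measurable (Lam \<Otimes>\<^sub>M Lam)"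
    by (rule measurable_compose[OF measurable_fst id], rule measurable_compose[OF measurable_snd id])
  show ?thesis unfolding gq_def[abs_def] by measurable
qed

text \<open>Upper bound for the weighted squared increment of a single exponential of frequency
  \<mu>: the modulus of \<open>exp (\<i> * \<mu> * h) - 1\<close> is at most 2 and at most that of
  \<open>\<mu> * h\<close>.\<close>

definition kern :: "real \<Rightarrow> real \<Rightarrow> real \<Rightarrow> real" where
  "kern \<theta> \<mu> h = \<bar>h\<bar> powr - (1 + 2 * \<theta>) * min 4 ((\<mu> * h)\<^sup>2)"

lemma kern_measurable [measurable]: "kern \<theta> \<mu> \<in> borel_measurable borel"
  unfolding kern_def[abs_def] by measurable

lemma kern_nonneg: "0 \<le> kern \<theta> \<mu> h" by (simp add: kern_def)

text \<open>Near 0 the quadratic branch leaves the exponent \<open>1 - 2 * \<theta>\<close>, which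
  is above -1 as \<open>\<theta> < 1\<close>; at infinity the constant branch leaves
  \<open>- (1 + 2 * \<theta>)\<close>, which is below -1 as \<open>0 < \<theta>\<close>.\<close>

lemma kern_integral_finite:
  assumes "0 < \<theta>" "\<theta> < 1"
  shows "(\<integral>\<^sup>+h. ennreal (kern \<theta> 1 h) \<partial>lborel) < \<infinity>"
proof -
  \<comment> \<open>A majorant for positive \<open>h\<close> only; the negative half is covered by
    its reflection \<open>p (- h)\<close>.\<close>
  define p where "p h = (if h \<in> {0..1} then h powr (1 - 2 * \<theta>) else 0)
      + 4 * (if h \<in> {1..} then h powr - (1 + 2 * \<theta>) else 0)" for h :: real
  have pm [measurable]: "p \<in> borel_measurable borel" unfolding p_def by measurable
  have "\<exists>I. (p has_integral I) UNIV"
  proof -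
    have "((\<lambda>h. if h \<in> {0..1} then h powr (1 - 2 * \<theta>) else 0) has_integral
        (1 powr (1 - 2 * \<theta> + 1) / (1 - 2 * \<theta> + 1))) UNIV"
      unfolding has_integral_restrict_UNIV using assms by (intro has_integral_powr_from_0) auto
    moreover have "((\<lambda>h. 4 * (if h \<in> {1..} then h powr - (1 + 2 * \<theta>) else 0)) has_integral
        4 * (-(1 powr (- (1 + 2 * \<theta>) + 1)) / (- (1 + 2 * \<theta>) + 1))) UNIV"
      by (intro has_integral_mult_right, unfold has_integral_restrict_UNIV, intro has_integral_powr_to_inf)
        (use assms in auto)
    ultimately show ?thesis unfolding p_def by - (rule exI, rule has_integral_add)
  qed
  then obtain I where I: "(p has_integral I) UNIV" by blast
  have pI: "(\<integral>\<^sup>+h. ennreal (p h) \<partial>lborel) = ennreal I"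
    by (rule nn_integral_has_integral_lborel[OF _ _ I]) (auto simp: p_def)
  have pI': "(\<integral>\<^sup>+h. ennreal (p (- h)) \<partial>lborel) = ennreal I"
    using nn_integral_real_affine[of "\<lambda>h. ennreal (p h)" "-1" 0] pI by simp
  have "kern \<theta> 1 h \<le> p h + p (- h)" for h
  proof -
    have pos: "kern \<theta> 1 h \<le> p h" if h0: "0 \<le> h" for h
    proof -
      have *: "h powr - (1 + 2 * \<theta>) * h\<^sup>2 = h powr (1 - 2 * \<theta>)" if "0 < h"
      proof -
        have "h\<^sup>2 = h powr 2" using that powr_realpow[of h 2] by simp
        thus ?thesis by (simp flip: powr_add)
      qed
      consider "h = 0" | "0 < h" "h \<le> 1" | "1 < h" using h0 by linarith
      thus ?thesis
      proof cases
        case 2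
        have "kern \<theta> 1 h \<le> h powr - (1 + 2 * \<theta>) * h\<^sup>2"
          using 2 unfolding kern_def by (intro mult_mono) auto
        also have "\<dots> \<le> p h" using 2 * by (auto simp: p_def)
        finally show ?thesis .
      next
        case 3
        have "kern \<theta> 1 h \<le> h powr - (1 + 2 * \<theta>) * 4"
          using 3 unfolding kern_def by (intro mult_mono) auto
        also have "\<dots> \<le> p h" using 3 by (auto simp: p_def)
        finally show ?thesis .
      qed (simp add: kern_def p_def)
    qed
    have "0 \<le> p h" "0 \<le> p (- h)" by (auto simp: p_def)
    moreover have "kern \<theta> 1 (- h) = kern \<theta> 1 h" by (simp add: kern_def)
    ultimately show ?thesis using pos[of h] pos[of "- h"] by (cases "0 \<le> h") auto
  qed
  hence "(\<integral>\<^sup>+h. ennreal (kern \<theta> 1 h) \<partial>lborel) \<le> (\<integral>\<^sup>+h. ennreal (p h) + ennreal (p (- h)) \<partial>lborel)"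
    by (intro nn_integral_mono) (auto simp: p_def ennreal_leI simp flip: ennreal_plus)
  also have "\<dots> = (\<integral>\<^sup>+h. ennreal (p h) \<partial>lborel) + (\<integral>\<^sup>+h. ennreal (p (- h)) \<partial>lborel)"
    by (intro nn_integral_add) auto
  also have "\<dots> < \<infinity>" unfolding pI pI' by simp
  finally show ?thesis .
qed

definition kernI :: "real \<Rightarrow> real" where
  "kernI \<theta> = enn2real (\<integral>\<^sup>+h. ennreal (kern \<theta> 1 h) \<partial>lborel)"

lemma kernI_nonneg [simp]: "0 \<le> kernI \<theta>" by (simp add: kernI_def)

text \<open>The substitution \<open>h = u / \<mu>\<close> extracts the power
  \<open>2 * \<theta>\<close> of the frequency, which is how a fractional derivative of order
  \<theta> appears.\<close>

lemma kern_integral: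
  assumes "0 < \<theta>" "\<theta> < 1"
  shows "(\<integral>\<^sup>+h. ennreal (kern \<theta> \<mu> h) \<partial>lborel) = ennreal (\<bar>\<mu>\<bar> powr (2 * \<theta>) * kernI \<theta>)"
proof (cases "\<mu> = 0")
  case True
  thus ?thesis by (simp add: kern_def)
next
  case False
  have "kern \<theta> \<mu> (0 + (1 / \<mu>) * u) = \<bar>\<mu>\<bar> powr (1 + 2 * \<theta>) * kern \<theta> 1 u" for u
    using False by (simp add: kern_def powr_mult powr_minus abs_divide powr_divide field_simps)
      (use False in \<open>simp flip: powr_add\<close>)
  hence "(\<integral>\<^sup>+h. ennreal (kern \<theta> \<mu> h) \<partial>lborel)
      = ennreal \<bar>1 / \<mu>\<bar> * (\<integral>\<^sup>+u. ennreal (\<bar>\<mu>\<bar> powr (1 + 2 * \<theta>) * kern \<theta> 1 u) \<partial>lborel)"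
    using False by (subst nn_integral_real_affine[of _ "1 / \<mu>" 0]) auto
  also have "(\<integral>\<^sup>+u. ennreal (\<bar>\<mu>\<bar> powr (1 + 2 * \<theta>) * kern \<theta> 1 u) \<partial>lborel)
      = ennreal (\<bar>\<mu>\<bar> powr (1 + 2 * \<theta>)) * (\<integral>\<^sup>+u. ennreal (kern \<theta> 1 u) \<partial>lborel)"
    by (simp add: ennreal_mult kern_nonneg nn_integral_cmult)
  also have "(\<integral>\<^sup>+u. ennreal (kern \<theta> 1 u) \<partial>lborel) = ennreal (kernI \<theta>)"
    using kern_integral_finite[OF assms] by (simp add: kernI_def)
  also have "ennreal \<bar>1 / \<mu>\<bar> * (ennreal (\<bar>\<mu>\<bar> powr (1 + 2 * \<theta>)) * ennreal (kernI \<theta>))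
      = ennreal (\<bar>\<mu>\<bar> powr (2 * \<theta>) * kernI \<theta>)"
    using False by (simp add: powr_add mult.assoc flip: ennreal_mult)
  finally show ?thesis .
qed

lemma nn_integral_Lam:
  "(\<integral>\<^sup>+x. f x \<partial>Lam) = (\<integral>\<^sup>+x. f x * indicator {-1..1} x \<partial>lborel)"
  by (simp add: nn_integral_restrict_space nn_integral_completion)

text \<open>Both indicators are required, as an increment counts only if both of its end points lie
  in the interval. The extended nonnegative values allow Tonelli without integrability
  conditions.\<close>

definition shift_diff :: "(real \<Rightarrow> complex) \<Rightarrow> real \<Rightarrow> real \<Rightarrow> ennreal" where
  "shift_diff w h x = ennreal ((cmod (w (x + h) - w x))\<^sup>2) * indicator {-1..1} x * indicator {-1..1} (x + h)"

text \<open>Substituting \<open>y = x + h\<close> and exchanging the integrals separates the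
  singular weight, which depends on \<open>h\<close> alone, from the energy of the
  increments.\<close>

lemma gagliardo_nn_integral:
  assumes w: "continuous_on UNIV w"
  shows "(\<integral>\<^sup>+z. ennreal ((cmod (gq \<theta> w z))\<^sup>2) \<partial>(Lam \<Otimes>\<^sub>M Lam))
    = (\<integral>\<^sup>+h. ennreal (\<bar>h\<bar> powr - (1 + 2 * \<theta>)) * (\<integral>\<^sup>+x. shift_diff w h x \<partial>lborel) \<partial>lborel)"
proof -
  interpret sigma_finite_measure Lam
    using finite_measure_Lam by (rule finite_measure.axioms)
  have wm [measurable]: "w \<in> borel_measurable borel" using w by (rule borel_measurable_continuous_onI)
  have gm [measurable]: "gq \<theta> w \<in> borel_measurable (borel \<Otimes>\<^sub>M borel)"
    unfolding gq_def[abs_def] by measurable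
  have pm: "gq \<theta> w \<in> borel_measurable (Lam \<Otimes>\<^sub>M Lam)"
    by (intro gq_measurable continuous_measurable_Lam continuous_on_subset[OF w]) auto
  have sq: "ennreal ((cmod (gq \<theta> w (x, x + h)))\<^sup>2) * indicator {-1..1} (x + h) * indicator {-1..1} x
      = ennreal (\<bar>h\<bar> powr - (1 + 2 * \<theta>)) * shift_diff w h x" for x h
    unfolding gagliardo_gq[symmetric] powr_minus
    by (simp add: gagliardo_def shift_diff_def norm_minus_commute divide_inverse mult_ac flip: ennreal_mult
        split: split_indicator)
  have inner: "(\<integral>\<^sup>+y. ennreal ((cmod (gq \<theta> w (x, y)))\<^sup>2) * indicator {-1..1} y \<partial>lborel)
      = (\<integral>\<^sup>+h. ennreal ((cmod (gq \<theta> w (x, x + h)))\<^sup>2) * indicator {-1..1} (x + h) \<partial>lborel)" for x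
    by (subst nn_integral_real_affine[of _ 1 x]) auto
  have "(\<integral>\<^sup>+z. ennreal ((cmod (gq \<theta> w z))\<^sup>2) \<partial>(Lam \<Otimes>\<^sub>M Lam))
      = (\<integral>\<^sup>+x. \<integral>\<^sup>+y. ennreal ((cmod (gq \<theta> w (x, y)))\<^sup>2) \<partial>Lam \<partial>Lam)"
    using pm by (intro nn_integral_fst[symmetric]) auto
  also have "\<dots> = (\<integral>\<^sup>+x. (\<integral>\<^sup>+y. ennreal ((cmod (gq \<theta> w (x, y)))\<^sup>2) * indicator {-1..1} y \<partial>lborel)
      * indicator {-1..1} x \<partial>lborel)"
    unfolding nn_integral_Lam ..
  also have "\<dots> = (\<integral>\<^sup>+x. (\<integral>\<^sup>+h. ennreal ((cmod (gq \<theta> w (x, x + h)))\<^sup>2) * indicator {-1..1} (x + h) \<partial>lborel)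
      * indicator {-1..1} x \<partial>lborel)"
    by (simp only: inner)
  also have "\<dots> = (\<integral>\<^sup>+x. (\<integral>\<^sup>+h. ennreal (\<bar>h\<bar> powr - (1 + 2 * \<theta>)) * shift_diff w h x \<partial>lborel) \<partial>lborel)"
    by (subst nn_integral_multc[symmetric]) (auto simp: sq)
  also have "\<dots> = (\<integral>\<^sup>+h. (\<integral>\<^sup>+x. ennreal (\<bar>h\<bar> powr - (1 + 2 * \<theta>)) * shift_diff w h x \<partial>lborel) \<partial>lborel)"
    unfolding shift_diff_def by (intro lborel_pair.Fubini') measurable
  also have "\<dots> = (\<integral>\<^sup>+h. ennreal (\<bar>h\<bar> powr - (1 + 2 * \<theta>)) * (\<integral>\<^sup>+x. shift_diff w h x \<partial>lborel) \<partial>lborel)"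
    unfolding shift_diff_def by (intro nn_integral_cong nn_integral_cmult) measurable
  finally show ?thesis .
qed

text \<open>The index set is general because the estimate is used in two ways: with one term for
  each frequency of a trigonometric sum, and in \<open>tower_gagliardo\<close> with a single term of
  artificial frequency \<open>1 / t\<close>.\<close>

lemma gagliardo_le:
  assumes w: "continuous_on UNIV w" and th: "0 < \<theta>" "\<theta> < 1" and S: "finite S" and B: "\<And>l. l \<in> S \<Longrightarrow> 0 \<le> B l"
    and D: "\<And>h. (\<integral>\<^sup>+x. shift_diff w h x \<partial>lborel) \<le> ennreal (\<Sum>l\<in>S. B l * min 4 ((\<mu> l * h)\<^sup>2))"
  shows "gq \<theta> w \<in> sqi (Lam \<Otimes>\<^sub>M Lam)"
    and "(nrm (Lam \<Otimes>\<^sub>M Lam) (gq \<theta> w))\<^sup>2 \<le> kernI \<theta> * (\<Sum>l\<in>S. B l * \<bar>\<mu> l\<bar> powr (2 * \<theta>))"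
proof -
  let ?R = "kernI \<theta> * (\<Sum>l\<in>S. B l * \<bar>\<mu> l\<bar> powr (2 * \<theta>))"
  have R: "0 \<le> ?R" using B by (intro mult_nonneg_nonneg sum_nonneg) auto
  have "(\<integral>\<^sup>+z. ennreal ((cmod (gq \<theta> w z))\<^sup>2) \<partial>(Lam \<Otimes>\<^sub>M Lam))
    \<le> (\<integral>\<^sup>+h. ennreal (\<bar>h\<bar> powr - (1 + 2 * \<theta>)) * ennreal (\<Sum>l\<in>S. B l * min 4 ((\<mu> l * h)\<^sup>2)) \<partial>lborel)"
    unfolding gagliardo_nn_integral[OF w] by (intro nn_integral_mono mult_left_mono D) auto
  also have "\<dots> = (\<integral>\<^sup>+h. (\<Sum>l\<in>S. ennreal (B l) * ennreal (kern \<theta> (\<mu> l) h)) \<partial>lborel)"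
  proof (rule nn_integral_cong)
    fix h :: real
    have "ennreal (\<bar>h\<bar> powr - (1 + 2 * \<theta>)) * ennreal (\<Sum>l\<in>S. B l * min 4 ((\<mu> l * h)\<^sup>2))
        = ennreal (\<Sum>l\<in>S. B l * kern \<theta> (\<mu> l) h)"
      using B by (subst ennreal_mult[symmetric]) (auto simp: sum_distrib_left kern_def mult_ac intro!: sum_nonneg)
    also have "\<dots> = (\<Sum>l\<in>S. ennreal (B l) * ennreal (kern \<theta> (\<mu> l) h))"
      using B kern_nonneg by (subst sum_ennreal[symmetric]) (auto simp: ennreal_mult)
    finally show "ennreal (\<bar>h\<bar> powr - (1 + 2 * \<theta>)) * ennreal (\<Sum>l\<in>S. B l * min 4 ((\<mu> l * h)\<^sup>2))
        = (\<Sum>l\<in>S. ennreal (B l) * ennreal (kern \<theta> (\<mu> l) h))" .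
  qed
  also have "\<dots> = (\<Sum>l\<in>S. ennreal (B l) * (\<integral>\<^sup>+h. ennreal (kern \<theta> (\<mu> l) h) \<partial>lborel))"
    by (subst nn_integral_sum) (auto simp: nn_integral_cmult)
  also have "\<dots> = (\<Sum>l\<in>S. ennreal (B l * (\<bar>\<mu> l\<bar> powr (2 * \<theta>) * kernI \<theta>)))"
    using B by (intro sum.cong refl) (simp add: kern_integral[OF th] ennreal_mult)
  also have "\<dots> = ennreal ?R"
    using B by (subst sum_ennreal) (auto simp: sum_distrib_left mult_ac)
  finally have *: "(\<integral>\<^sup>+z. ennreal ((cmod (gq \<theta> w z))\<^sup>2) \<partial>(Lam \<Otimes>\<^sub>M Lam)) \<le> ennreal ((sqrt ?R)\<^sup>2)"
    using R by simp
  have m: "gq \<theta> w \<in> borel_measurable (Lam \<Otimes>\<^sub>M Lam)"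
    by (intro gq_measurable continuous_measurable_Lam continuous_on_subset[OF w]) auto
  show "gq \<theta> w \<in> sqi (Lam \<Otimes>\<^sub>M Lam)" using sqi_nrm_leI(1)[OF m *] R by simp
  have "nrm (Lam \<Otimes>\<^sub>M Lam) (gq \<theta> w) \<le> sqrt ?R" using sqi_nrm_leI(2)[OF m *] R by simp
  hence "(nrm (Lam \<Otimes>\<^sub>M Lam) (gq \<theta> w))\<^sup>2 \<le> (sqrt ?R)\<^sup>2" by (intro power_mono) auto
  thus "(nrm (Lam \<Otimes>\<^sub>M Lam) (gq \<theta> w))\<^sup>2 \<le> ?R" using R by simp
qed

lemma cmod_exp_minus_one_square_le: "(cmod (exp (\<i> * of_real t) - 1))\<^sup>2 \<le> min 4 (t\<^sup>2)"
proof -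
  have "cmod (exp (\<i> * of_real t) - 1) \<le> cmod (exp (\<i> * of_real t)) + cmod 1" by (rule norm_triangle_ineq4)
  hence "cmod (exp (\<i> * of_real t) - 1) \<le> 2" by simp
  hence "(cmod (exp (\<i> * of_real t) - 1))\<^sup>2 \<le> 2\<^sup>2" by (intro power_mono) auto
  moreover have "(cmod (exp (\<i> * of_real t) - 1))\<^sup>2 = (2 * sin (t / 2))\<^sup>2"
    unfolding cis_conv_exp[symmetric] cmod_power2
    using sin_cos_squared_add[of t] cos_double_sin[of "t/2"] by (simp add: power2_eq_square algebra_simps)
  moreover have "(2 * sin (t / 2))\<^sup>2 \<le> t\<^sup>2"
    using abs_sin_x_le_abs_x[of "t / 2"] by (subst abs_le_square_iff[symmetric]) (simp add: abs_mult)
  ultimately show ?thesis by simp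
qed

text \<open>A shift by \<open>h\<close> multiplies each coefficient by a unimodular number, so an
  increment of the sum is again a trigonometric sum, to which the Parseval bound applies.\<close>

lemma gagliardo_fsum:
  assumes T: "1 < T" and th: "0 < \<theta>" "\<theta> < 1" and S: "finite S"
  shows "gq \<theta> (fsum T S c) \<in> sqi (Lam \<Otimes>\<^sub>M Lam)"
    and "(nrm (Lam \<Otimes>\<^sub>M Lam) (gq \<theta> (fsum T S c)))\<^sup>2
      \<le> kernI \<theta> * (\<Sum>l\<in>S. 2 * T * (cmod (c l))\<^sup>2 * \<bar>freq T l\<bar> powr (2 * \<theta>))"
proof -
  have "(\<integral>\<^sup>+x. shift_diff (fsum T S c) h x \<partial>lborel)
      \<le> ennreal (\<Sum>l\<in>S. 2 * T * (cmod (c l))\<^sup>2 * min 4 ((freq T l * h)\<^sup>2))" for h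
  proof -
    let ?d = "\<lambda>l. (exp (\<i> * of_real (freq T l * h)) - 1) * c l"
    have "fsum T S c (x + h) - fsum T S c x = fsum T S ?d x" for x
      unfolding fsum_def phi_shift sum_subtractf[symmetric]
      by (intro sum.cong refl) (simp add: algebra_simps)
    hence "(\<integral>\<^sup>+x. shift_diff (fsum T S c) h x \<partial>lborel) \<le> (\<integral>\<^sup>+x. ennreal ((cmod (fsum T S ?d x))\<^sup>2) \<partial>Lam)"
      unfolding shift_diff_def nn_integral_Lam by (intro nn_integral_mono) (auto split: split_indicator)
    also have "\<dots> = ennreal ((nrm Lam (fsum T S ?d))\<^sup>2)" by (rule nn_integral_sqi[OF fsum_sqi])
    also have "\<dots> \<le> ennreal (2 * T * (\<Sum>l\<in>S. (cmod (?d l))\<^sup>2))"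
      by (intro ennreal_leI nrm_fsum_le T S)
    also have "\<dots> \<le> ennreal (2 * T * (\<Sum>l\<in>S. (cmod (c l))\<^sup>2 * min 4 ((freq T l * h)\<^sup>2)))"
    proof (intro ennreal_leI mult_left_mono sum_mono)
      fix l
      have "(cmod (?d l))\<^sup>2 = (cmod (c l))\<^sup>2 * (cmod (exp (\<i> * of_real (freq T l * h)) - 1))\<^sup>2"
        by (simp only: norm_mult power_mult_distrib mult.commute)
      also have "\<dots> \<le> (cmod (c l))\<^sup>2 * min 4 ((freq T l * h)\<^sup>2)"
        by (intro mult_left_mono cmod_exp_minus_one_square_le) simp
      finally show "(cmod (?d l))\<^sup>2 \<le> (cmod (c l))\<^sup>2 * min 4 ((freq T l * h)\<^sup>2)" .
    qed (use T in simp)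
    finally show ?thesis by (simp add: sum_distrib_left mult.assoc)
  qed
  from gagliardo_le[OF continuous_on_fsum th S _ this] T
  show "gq \<theta> (fsum T S c) \<in> sqi (Lam \<Otimes>\<^sub>M Lam)"
    "(nrm (Lam \<Otimes>\<^sub>M Lam) (gq \<theta> (fsum T S c)))\<^sup>2
      \<le> kernI \<theta> * (\<Sum>l\<in>S. 2 * T * (cmod (c l))\<^sup>2 * \<bar>freq T l\<bar> powr (2 * \<theta>))" by simp_all
qed

section \<open>Passage to the limit in the Gagliardo seminorm\<close>

lemma AE_pair_both:
  assumes "finite_measure M" "AE x in M. P x"
  shows "AE z in M \<Otimes>\<^sub>M M. P (fst z) \<and> P (snd z)"
proof -
  interpret finite_measure M by fact
  obtain N where N: "N \<in> null_sets M" "{x \<in> space M. \<not> P x} \<subseteq> N"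
    using assms(2) by (auto simp: eventually_ae_filter)
  have "N \<times> space M \<union> space M \<times> N \<in> null_sets (M \<Otimes>\<^sub>M M)"
    using N(1) by (intro null_sets.Un times_in_null_sets1 times_in_null_sets2) auto
  moreover have "{z \<in> space (M \<Otimes>\<^sub>M M). \<not> (P (fst z) \<and> P (snd z))} \<subseteq> N \<times> space M \<union> space M \<times> N"
    using N(2) by (auto simp: space_pair_measure)
  ultimately show ?thesis by (rule AE_I')
qed

lemma gq_AE_cong:
  assumes "AE x in Lam. w x = w' x"
  shows "AE z in Lam \<Otimes>\<^sub>M Lam. gq \<theta> w z = gq \<theta> w' z"
  using AE_pair_both[OF finite_measure_Lam assms] by eventually_elim (simp add: gq_def)

lemma fext_subseq:
  assumes "1 < T" "c \<in> ell2"
  shows "\<exists>S::nat \<Rightarrow> int set. (\<forall>n. finite (S n)) \<and> (AE x in Lam. (\<lambda>n. fsum T (S n) c x) \<longlonglongrightarrow> fext T c x)"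
proof -
  have "\<exists>S. finite S \<and> nrm Lam (\<lambda>x. fsum T S c x - fext T c x) < 1 / real (Suc n)" for n
  proof -
    have "\<forall>\<^sub>F S in finite_subsets_at_top UNIV. dist (nrm Lam (\<lambda>x. fsum T S c x - fext T c x)) 0 < 1 / real (Suc n)"
      by (intro tendstoD fext_tendsto assms) auto
    then obtain S where "finite S" "dist (nrm Lam (\<lambda>x. fsum T S c x - fext T c x)) 0 < 1 / real (Suc n)"
      unfolding eventually_finite_subsets_at_top by blast
    thus ?thesis by (auto simp: dist_real_def)
  qed
  then obtain S where S: "\<And>n. finite (S n)" "\<And>n. nrm Lam (\<lambda>x. fsum T (S n) c x - fext T c x) < 1 / real (Suc n)"
    by metis
  have "(\<lambda>n. nrm Lam (\<lambda>x. fsum T (S n) c x - fext T c x)) \<longlonglongrightarrow> 0"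
  proof (rule tendsto_zero_squeeze[where g = "\<lambda>n. 1 / real (Suc n)"])
    show "(\<lambda>n. 1 / real (Suc n)) \<longlonglongrightarrow> 0" using LIMSEQ_inverse_real_of_nat by (simp add: inverse_eq_divide)
  qed (use S(2) in \<open>auto intro: less_imp_le\<close>)
  from sqi_tendsto_AE_subseq[OF fsum_sqi fext_sqi[OF assms] this]
  obtain r where "AE x in Lam. (\<lambda>n. fsum T (S (r n)) c x) \<longlonglongrightarrow> fext T c x" by blast
  thus ?thesis using S(1) by (intro exI[of _ "\<lambda>n. S (r n)"]) simp
qed

text \<open>The bound for finite sums is uniform in the index set, and along a subsequence the sums
  converge almost everywhere, so Fatou on the square gives both claims.\<close>

lemma gagliardo_fext:
  assumes T: "1 < T" and th: "0 < \<theta>" "\<theta> < 1" and c: "c \<in> ell2"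
    and d: "(\<lambda>l. of_real (\<bar>freq T l\<bar> powr \<theta>) * c l) \<in> ell2"
  shows "gq \<theta> (fext T c) \<in> sqi (Lam \<Otimes>\<^sub>M Lam)"
    and "nrm (Lam \<Otimes>\<^sub>M Lam) (gq \<theta> (fext T c))
      \<le> sqrt (2 * T * kernI \<theta>) * ell2_norm (\<lambda>l. of_real (\<bar>freq T l\<bar> powr \<theta>) * c l)"
proof -
  let ?d = "\<lambda>l. of_real (\<bar>freq T l\<bar> powr \<theta>) * c l"
  obtain S where S: "\<And>n::nat. finite (S n)" "AE x in Lam. (\<lambda>n. fsum T (S n) c x) \<longlonglongrightarrow> fext T c x"
    using fext_subseq[OF T c] by blast
  have lim: "AE z in Lam \<Otimes>\<^sub>M Lam. (\<lambda>n. gq \<theta> (fsum T (S n) c) z) \<longlonglongrightarrow> gq \<theta> (fext T c) z"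
    using AE_pair_both[OF finite_measure_Lam S(2)]
    by eventually_elim (auto simp: gq_def intro!: tendsto_intros)
  have le: "nrm (Lam \<Otimes>\<^sub>M Lam) (gq \<theta> (fsum T S c)) \<le> sqrt (2 * T * kernI \<theta>) * ell2_norm ?d" if S: "finite S" for S
  proof (rule power2_le_imp_le)
    have "(nrm (Lam \<Otimes>\<^sub>M Lam) (gq \<theta> (fsum T S c)))\<^sup>2
        \<le> kernI \<theta> * (\<Sum>l\<in>S. 2 * T * (cmod (c l))\<^sup>2 * \<bar>freq T l\<bar> powr (2 * \<theta>))"
      by (rule gagliardo_fsum[OF T th S])
    also have "\<dots> = 2 * T * kernI \<theta> * (\<Sum>l\<in>S. (cmod (?d l))\<^sup>2)"
    proof -
      have "(\<bar>freq T l\<bar> powr \<theta>)\<^sup>2 = \<bar>freq T l\<bar> powr (2 * \<theta>)" for l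
        by (simp add: power2_eq_square flip: powr_add)
      thus ?thesis by (simp add: sum_distrib_left norm_mult power_mult_distrib mult_ac)
    qed
    also have "\<dots> \<le> 2 * T * kernI \<theta> * (ell2_norm ?d)\<^sup>2"
      using T by (intro mult_left_mono ell2_sum_le d S) auto
    finally show "(nrm (Lam \<Otimes>\<^sub>M Lam) (gq \<theta> (fsum T S c)))\<^sup>2 \<le> (sqrt (2 * T * kernI \<theta>) * ell2_norm ?d)\<^sup>2"
      using T by (simp add: power_mult_distrib)
  qed (use T in simp)
  have m: "gq \<theta> (fext T c) \<in> borel_measurable (Lam \<Otimes>\<^sub>M Lam)"
    by (intro gq_measurable sqi_measurable fext_sqi T c)
  from sqi_fatou[OF gagliardo_fsum(1)[OF T th S(1)] m lim, where B = "sqrt (2 * T * kernI \<theta>) * ell2_norm ?d"] le[OF S(1)] T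
  show "gq \<theta> (fext T c) \<in> sqi (Lam \<Otimes>\<^sub>M Lam)"
    "nrm (Lam \<Otimes>\<^sub>M Lam) (gq \<theta> (fext T c)) \<le> sqrt (2 * T * kernI \<theta>) * ell2_norm ?d" by auto
qed

section \<open>Sobolev norms of Fourier extensions\<close>

text \<open>The components of the Sobolev norm as one finite family, so that Minkowski's inequality for
  \<open>L2_set\<close> applies; the Gagliardo seminorm sits at the index \<open>\<lfloor>q\<rfloor> + 1\<close>.\<close>

definition sob_comp :: "real \<Rightarrow> (nat \<Rightarrow> real \<Rightarrow> complex) \<Rightarrow> nat \<Rightarrow> real" where
  "sob_comp q W i = (if i \<le> nat \<lfloor>q\<rfloor> then nrm Lam (W i)
     else if frac q > 0 then nrm (Lam \<Otimes>\<^sub>M Lam) (gq (frac q) (W (nat \<lfloor>q\<rfloor>))) else 0)"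

definition sob_of :: "real \<Rightarrow> (nat \<Rightarrow> real \<Rightarrow> complex) \<Rightarrow> real" where
  "sob_of q W = L2_set (sob_comp q W) {..Suc (nat \<lfloor>q\<rfloor>)}"

text \<open>The family \<open>W\<close> provides explicit derivatives, which keeps calculations away
  from the choice made in \<open>weak_deriv\<close>.\<close>

definition sob_rep :: "real \<Rightarrow> (real \<Rightarrow> complex) \<Rightarrow> (nat \<Rightarrow> real \<Rightarrow> complex) \<Rightarrow> bool" where
  "sob_rep q g W \<longleftrightarrow> g \<in> L2 \<and> (\<forall>j\<le>nat \<lfloor>q\<rfloor>. is_weak_deriv j g (W j)) \<and>
     (frac q > 0 \<longrightarrow> gq (frac q) (W (nat \<lfloor>q\<rfloor>)) \<in> sqi (Lam \<Otimes>\<^sub>M Lam))"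

lemma sob_comp_nonneg: "0 \<le> sob_comp q W i"
  by (simp add: sob_comp_def)

lemma sob_of_eq:
  "sob_of q W = sqrt ((\<Sum>j\<le>nat \<lfloor>q\<rfloor>. (nrm Lam (W j))\<^sup>2)
     + (if frac q > 0 then (nrm (Lam \<Otimes>\<^sub>M Lam) (gq (frac q) (W (nat \<lfloor>q\<rfloor>))))\<^sup>2 else 0))"
  by (auto simp: sob_of_def L2_set_def sob_comp_def)

lemma sobolev_norm_weak: "sobolev_norm q g = sob_of q (\<lambda>j. weak_deriv j g)"
  by (simp add: sobolev_norm_def sob_of_eq L2_norm_nrm nrm_square gagliardo_gq[abs_def])

lemma weak_deriv_props:
  assumes "is_weak_deriv j g w"
  shows "is_weak_deriv j g (weak_deriv j g)" "AE x in Lam. weak_deriv j g x = w x"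
proof -
  show 1: "is_weak_deriv j g (weak_deriv j g)" unfolding weak_deriv_def by (rule someI[of "is_weak_deriv j g", OF assms])
  show "AE x in Lam. weak_deriv j g x = w x" by (rule is_weak_deriv_unique[OF 1 assms])
qed

lemma is_weak_deriv_sqi: "is_weak_deriv j g w \<Longrightarrow> w \<in> sqi Lam"
  by (simp add: is_weak_deriv_def L2_sqi)

text \<open>Two weak derivatives agree almost everywhere, and a null set of the interval spoils only
  a null set of the square, so each component of the norm is the same for \<open>W\<close> as for
  the chosen derivatives.\<close>

lemma sob_rep_sobolev:
  assumes "sob_rep q g W"
  shows "g \<in> sobolev q" "sobolev_norm q g = sob_of q W"
proof -
  let ?m = "nat \<lfloor>q\<rfloor>"
  have W: "is_weak_deriv j g (W j)" if "j \<le> ?m" for j using assms that by (auto simp: sob_rep_def)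
  have G: "gq (frac q) (weak_deriv ?m g) \<in> borel_measurable (Lam \<Otimes>\<^sub>M Lam)"
    "gq (frac q) (W ?m) \<in> borel_measurable (Lam \<Otimes>\<^sub>M Lam)"
    by (intro gq_measurable sqi_measurable is_weak_deriv_sqi[OF weak_deriv_props(1)[OF W]] is_weak_deriv_sqi[OF W]; simp)+
  have ae: "AE z in Lam \<Otimes>\<^sub>M Lam. gq (frac q) (W ?m) z = gq (frac q) (weak_deriv ?m g) z"
    by (rule gq_AE_cong) (use weak_deriv_props(2)[OF W[of ?m]] in auto)
  have "frac q > 0 \<longrightarrow> gq (frac q) (weak_deriv ?m g) \<in> sqi (Lam \<Otimes>\<^sub>M Lam)"
    using assms sqi_AE_cong[OF _ ae G(1)] by (auto simp: sob_rep_def)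
  thus "g \<in> sobolev q"
    using assms W unfolding sobolev_def sob_rep_def
    by (auto simp: sqi_def gagliardo_gq[abs_def])
  have "nrm Lam (weak_deriv j g) = nrm Lam (W j)" if "j \<le> ?m" for j
    using W[OF that] by (intro nrm_AE_cong sqi_measurable weak_deriv_props(2))
      (auto intro: is_weak_deriv_sqi weak_deriv_props(1))
  moreover have "nrm (Lam \<Otimes>\<^sub>M Lam) (gq (frac q) (weak_deriv ?m g)) = nrm (Lam \<Otimes>\<^sub>M Lam) (gq (frac q) (W ?m))"
    using ae by (intro nrm_AE_cong G) auto
  ultimately show "sobolev_norm q g = sob_of q W"
    unfolding sobolev_norm_weak sob_of_def by (intro L2_set_cong) (auto simp: sob_comp_def)
qed

lemma sobolev_sob_rep:
  assumes "g \<in> sobolev q" shows "sob_rep q g (\<lambda>j. weak_deriv j g)"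
proof -
  let ?m = "nat \<lfloor>q\<rfloor>"
  have W: "is_weak_deriv j g (weak_deriv j g)" if "j \<le> ?m" for j
    using assms that weak_deriv_props(1) by (auto simp: sobolev_def)
  have "gq (frac q) (weak_deriv ?m g) \<in> borel_measurable (Lam \<Otimes>\<^sub>M Lam)"
    by (intro gq_measurable sqi_measurable is_weak_deriv_sqi[OF W]) simp
  thus ?thesis using assms W by (auto simp: sob_rep_def sobolev_def sqi_def gagliardo_gq[abs_def])
qed

lemma gq_add: "gq \<theta> (\<lambda>x. g x + k x) z = gq \<theta> g z + gq \<theta> k z"
  and gq_cmult: "gq \<theta> (\<lambda>x. c * g x) z = c * gq \<theta> g z"
  by (simp_all add: gq_def algebra_simps)

lemma is_weak_deriv_add:
  assumes "is_weak_deriv j g w" "is_weak_deriv j k v" "g \<in> L2" "k \<in> L2"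
  shows "is_weak_deriv j (\<lambda>x. g x + k x) (\<lambda>x. w x + v x)"
  unfolding is_weak_deriv_def
proof (intro conjI ballI)
  note ws = is_weak_deriv_sqi[OF assms(1)] is_weak_deriv_sqi[OF assms(2)]
  show "(\<lambda>x. w x + v x) \<in> L2" using ws by (simp add: L2_sqi sqi_add)
  fix \<psi> assume psi: "\<psi> \<in> test_fun"
  have "ip Lam (\<lambda>x. g x + k x) (\<lambda>x. of_real ((deriv ^^ j) \<psi> x))
      = (-1) ^ j * ip Lam (\<lambda>x. w x + v x) (\<lambda>x. of_real (\<psi> x))"
    using assms ws test_fun_sqi[OF psi] test_fun_sqi[OF test_fun_deriv_pow[OF psi]] psi
    by (simp add: ip_add_left L2_sqi) (simp add: ip_def is_weak_deriv_def distrib_left)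
  thus "(LINT x|Lam. (g x + k x) * of_real ((deriv ^^ j) \<psi> x)) = (-1) ^ j * (LINT x|Lam. (w x + v x) * of_real (\<psi> x))"
    by (simp add: ip_def)
qed

lemma is_weak_deriv_cmult:
  assumes "is_weak_deriv j g w"
  shows "is_weak_deriv j (\<lambda>x. z * g x) (\<lambda>x. z * w x)"
  using assms sqi_cmult[of w Lam z] unfolding is_weak_deriv_def L2_sqi by (simp add: mult.assoc)

lemma sobolev_add:
  assumes "g \<in> sobolev q" "k \<in> sobolev q"
  shows "(\<lambda>x. g x + k x) \<in> sobolev q"
    and "sobolev_norm q (\<lambda>x. g x + k x) \<le> sobolev_norm q g + sobolev_norm q k"
proof -
  let ?W = "\<lambda>j. weak_deriv j g" and ?V = "\<lambda>j. weak_deriv j k" and ?m = "nat \<lfloor>q\<rfloor>"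
  note G = sobolev_sob_rep[OF assms(1)] and K = sobolev_sob_rep[OF assms(2)]
  have rep: "sob_rep q (\<lambda>x. g x + k x) (\<lambda>j x. ?W j x + ?V j x)"
    using G K unfolding sob_rep_def
    by (auto simp: gq_add[abs_def] L2_sqi intro!: sqi_add is_weak_deriv_add)
  show "(\<lambda>x. g x + k x) \<in> sobolev q" by (rule sob_rep_sobolev(1)[OF rep])
  have "sob_comp q (\<lambda>j x. ?W j x + ?V j x) i \<le> sob_comp q ?W i + sob_comp q ?V i" for i
    using G K unfolding sob_comp_def sob_rep_def
    by (auto simp: gq_add[abs_def] intro!: nrm_add_le is_weak_deriv_sqi)
  hence "sob_of q (\<lambda>j x. ?W j x + ?V j x) \<le> L2_set (\<lambda>i. sob_comp q ?W i + sob_comp q ?V i) {..Suc ?m}"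
    unfolding sob_of_def by (intro L2_set_mono) (auto simp: sob_comp_nonneg)
  also have "\<dots> \<le> sob_of q ?W + sob_of q ?V" unfolding sob_of_def by (rule L2_set_triangle_ineq)
  finally show "sobolev_norm q (\<lambda>x. g x + k x) \<le> sobolev_norm q g + sobolev_norm q k"
    unfolding sob_rep_sobolev(2)[OF rep] unfolding sobolev_norm_weak .
qed

lemma sobolev_cmult:
  assumes "g \<in> sobolev q"
  shows "sobolev_norm q (\<lambda>x. z * g x) = cmod z * sobolev_norm q g"
proof -
  let ?W = "\<lambda>j. weak_deriv j g"
  note G = sobolev_sob_rep[OF assms(1)]
  have rep: "sob_rep q (\<lambda>x. z * g x) (\<lambda>j x. z * ?W j x)"
    using G unfolding sob_rep_def
    by (auto simp: gq_cmult[abs_def] L2_sqi intro!: sqi_cmult is_weak_deriv_cmult)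
  have "sob_comp q (\<lambda>j x. z * ?W j x) = (\<lambda>i. cmod z * sob_comp q ?W i)"
    by (auto simp: fun_eq_iff sob_comp_def gq_cmult[abs_def] nrm_cmult)
  thus ?thesis
    unfolding sob_rep_sobolev(2)[OF rep] unfolding sobolev_norm_weak
    by (simp add: sob_of_def L2_set_right_distrib)
qed

lemma sobolev_norm_nonneg: "0 \<le> sobolev_norm q g"
  by (simp add: sobolev_norm_weak sob_of_def)

text \<open>The algebraic part of the theorem asserts a Sobolev bound with constant 1, which
  presupposes a suitable choice among the equivalent norms. A positive multiple of
  \<open>sobolev_norm\<close> will serve.\<close>

lemma equivalent_sobolev_norm_scaled:
  assumes "0 < \<kappa>"
  shows "equivalent_sobolev_norm q (\<lambda>g. \<kappa> * sobolev_norm q g)"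
  unfolding equivalent_sobolev_norm_def
proof (intro conjI ballI allI)
  fix g k assume "g \<in> sobolev q" "k \<in> sobolev q"
  thus "\<kappa> * sobolev_norm q (\<lambda>x. g x + k x) \<le> \<kappa> * sobolev_norm q g + \<kappa> * sobolev_norm q k"
    using assms sobolev_add(2)[of g q k] by (simp flip: distrib_left)
next
  show "\<exists>a>0. \<exists>b. \<forall>g\<in>sobolev q. a * sobolev_norm q g \<le> \<kappa> * sobolev_norm q g \<and> \<kappa> * sobolev_norm q g \<le> b * sobolev_norm q g"
    using assms by (intro exI[of _ \<kappa>]) auto
qed (simp add: sobolev_cmult)

lemma is_weak_deriv_AE_cong:
  assumes "is_weak_deriv j g w" "AE x in Lam. g x = g' x" "g \<in> L2" "g' \<in> L2"
  shows "is_weak_deriv j g' w"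
  unfolding is_weak_deriv_def
proof (intro conjI ballI)
  show "w \<in> L2" using assms by (simp add: is_weak_deriv_def)
  fix \<psi> assume psi: "\<psi> \<in> test_fun"
  have "ip Lam g (\<lambda>x. of_real ((deriv ^^ j) \<psi> x)) = ip Lam g' (\<lambda>x. of_real ((deriv ^^ j) \<psi> x))"
    using assms test_fun_sqi[OF test_fun_deriv_pow[OF psi]] unfolding L2_sqi
    by (intro ip_AE_cong sqi_measurable)
  thus "(LINT x|Lam. g' x * of_real ((deriv ^^ j) \<psi> x)) = (-1) ^ j * (LINT x|Lam. w x * of_real (\<psi> x))"
    using assms(1) psi by (simp add: is_weak_deriv_def ip_def)
qed

lemma sob_rep_AE_cong:
  assumes "sob_rep q g W" "AE x in Lam. g x = g' x" "g' \<in> L2"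
  shows "sob_rep q g' W"
  using assms is_weak_deriv_AE_cong[OF _ assms(2) _ assms(3)] unfolding sob_rep_def by auto

section \<open>Algebraic weights against powers of the frequency\<close>

lemma weight_le:
  assumes "0 \<le> t" "t \<le> p"
  shows "\<bar>real_of_int l\<bar> powr t \<le> alg_weight p (of_int \<bar>l\<bar>)"
proof (cases "l = 0")
  case False
  hence l: "1 \<le> \<bar>real_of_int l\<bar>" by linarith
  have "\<bar>real_of_int l\<bar> powr t \<le> \<bar>real_of_int l\<bar> powr p" using l assms by (intro powr_mono) auto
  also have "\<dots> = sqrt (\<bar>real_of_int l\<bar> powr (2 * p))"
    using l by (intro real_sqrt_unique[symmetric]) (auto simp: power2_eq_square simp flip: powr_add)
  also have "\<dots> \<le> alg_weight p (of_int \<bar>l\<bar>)" unfolding alg_weight_def by (intro real_sqrt_le_mono) simp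
  finally show ?thesis .
qed (simp add: alg_weight_def)

lemma weight_ge_1: "1 \<le> alg_weight p x"
  by (simp add: alg_weight_def)

lemma weight_mono:
  assumes "0 \<le> q" "q \<le> p"
  shows "alg_weight q (of_int \<bar>l\<bar>) \<le> alg_weight p (of_int \<bar>l\<bar>)"
proof (cases "l = 0")
  case False
  hence "1 \<le> \<bar>real_of_int l\<bar>" by linarith
  thus ?thesis using assms unfolding alg_weight_def by (intro real_sqrt_le_mono add_left_mono powr_mono) auto
qed (simp add: alg_weight_def)

lemma dcoef_bound:
  assumes "1 < T" "0 \<le> p" "real j \<le> p"
  shows "cmod (dcoef T j c l) \<le> pi ^ j * cmod (diag_op (alg_weight p) c l)"
proof -
  have "\<bar>freq T l\<bar> ^ j \<le> pi ^ j * \<bar>real_of_int l\<bar> ^ j"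
  proof -
    have "\<bar>freq T l\<bar> \<le> pi * \<bar>real_of_int l\<bar>"
      using assms by (simp add: freq_def abs_mult field_simps mult_left_mono)
        (simp add: mult_le_cancel_left1 mult_le_cancel_right1)
    thus ?thesis unfolding power_mult_distrib[symmetric] by (rule power_mono) simp
  qed
  also have "\<bar>real_of_int l\<bar> ^ j \<le> alg_weight p (of_int \<bar>l\<bar>)"
  \<comment> \<open>At base 0 and exponent 0 the two powers differ: \<open>powr\<close> gives 0 and
    \<open>^\<close> gives 1.\<close>
  proof (cases "l = 0 \<or> j = 0")
    case True
    thus ?thesis using weight_ge_1[of p "of_int \<bar>l\<bar>"] by (cases j) auto
  next
    case False
    hence "\<bar>real_of_int l\<bar> ^ j = \<bar>real_of_int l\<bar> powr (real j)" by (simp add: powr_realpow)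
    thus ?thesis using weight_le[of "real j" p l] assms by simp
  qed
  hence "pi ^ j * \<bar>real_of_int l\<bar> ^ j \<le> pi ^ j * alg_weight p (of_int \<bar>l\<bar>)"
    by (intro mult_left_mono) auto
  finally have "\<bar>freq T l\<bar> ^ j * cmod (c l) \<le> pi ^ j * alg_weight p (of_int \<bar>l\<bar>) * cmod (c l)"
    by (intro mult_right_mono) auto
  thus ?thesis using weight_ge_1[of p "of_int \<bar>l\<bar>"]
    by (simp add: dcoef_def diag_op_def norm_mult norm_power mult.assoc)
qed

lemma frac_freq_bound:
  assumes "1 < T" "0 \<le> p" "real m + \<theta> \<le> p" "0 < \<theta>"
  shows "cmod (of_real (\<bar>freq T l\<bar> powr \<theta>) * dcoef T m c l) \<le> pi powr (real m + \<theta>) * cmod (diag_op (alg_weight p) c l)"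
proof (cases "l = 0")
  case False
  have f: "\<bar>freq T l\<bar> \<le> pi * \<bar>real_of_int l\<bar>" "0 < \<bar>freq T l\<bar>"
    using assms False by (simp_all add: freq_def abs_mult field_simps mult_left_mono)
  have "\<bar>freq T l\<bar> powr \<theta> * \<bar>freq T l\<bar> ^ m = \<bar>freq T l\<bar> powr (real m + \<theta>)"
    using f by (simp add: powr_add powr_realpow)
  also have "\<dots> \<le> (pi * \<bar>real_of_int l\<bar>) powr (real m + \<theta>)"
    using f assms by (intro powr_mono2) auto
  also have "\<dots> = pi powr (real m + \<theta>) * \<bar>real_of_int l\<bar> powr (real m + \<theta>)" by (simp add: powr_mult)
  also have "\<dots> \<le> pi powr (real m + \<theta>) * alg_weight p (of_int \<bar>l\<bar>)"
    using assms by (intro mult_left_mono weight_le) auto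
  finally have "(\<bar>freq T l\<bar> powr \<theta> * \<bar>freq T l\<bar> ^ m) * cmod (c l)
      \<le> pi powr (real m + \<theta>) * alg_weight p (of_int \<bar>l\<bar>) * cmod (c l)"
    by (intro mult_right_mono) auto
  thus ?thesis using weight_ge_1[of p "of_int \<bar>l\<bar>"]
    by (simp add: dcoef_def diag_op_def norm_mult norm_power mult.assoc)
qed (use assms in \<open>simp add: freq_def\<close>)

lemma fext_sob_rep:
  assumes T: "1 < T" and p: "0 \<le> p" and c: "c \<in> diag_dom (alg_weight p)"
  shows "sob_rep p (fext T c) (\<lambda>j. fext T (dcoef T j c))"
proof -
  let ?m = "nat \<lfloor>p\<rfloor>"
  have mp: "real ?m \<le> p" using p by linarith
  have d: "diag_op (alg_weight p) c \<in> ell2" "c \<in> ell2" using c by (auto simp: diag_dom_def)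
  have dc: "dcoef T j c \<in> ell2" if "j \<le> ?m" for j
    using that mp by (intro ell2_comparison(1)[OF d(1) dcoef_bound[OF T p]]) auto
  have "gq (frac p) (fext T (dcoef T ?m c)) \<in> sqi (Lam \<Otimes>\<^sub>M Lam)" if fr: "frac p > 0"
  proof (rule gagliardo_fext(1)[OF T fr frac_lt_1 dc])
    have "real ?m + frac p \<le> p" using p by (simp add: frac_def)
    thus "(\<lambda>l. of_real (\<bar>freq T l\<bar> powr frac p) * dcoef T ?m c l) \<in> ell2"
      using fr by (intro ell2_comparison(1)[OF d(1) frac_freq_bound[OF T p]]) auto
  qed simp
  thus ?thesis unfolding sob_rep_def
    using fext_sqi[OF T d(2)] fext_weak_deriv[OF T d(2) dc] by (auto simp: L2_sqi)
qed

text \<open>Every component of the norm is a Fourier multiplier whose symbol is at most a power of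
  \<open>pi\<close> times the weight, because \<open>T > 1\<close> makes the frequency at most
  \<open>pi\<close> times the index.\<close>

lemma fext_sobolev_bound:
  assumes T: "1 < T" and p: "0 \<le> p"
  shows "\<exists>C>0. \<forall>c\<in>diag_dom (alg_weight p). sob_of p (\<lambda>j. fext T (dcoef T j c)) \<le> C * ell2_norm (diag_op (alg_weight p) c)"
proof -
  let ?m = "nat \<lfloor>p\<rfloor>"
  define K where "K i = (if i \<le> ?m then sqrt (2 * T) * pi ^ i
    else sqrt (2 * T * kernI (frac p)) * pi powr (real ?m + frac p))" for i
  have K0: "0 \<le> K i" for i using T by (simp add: K_def)
  have mp: "real ?m \<le> p" using p by linarith
  \<comment> \<open>The added 1 makes the constant strictly positive; the norm in the theorem is
    obtained by dividing by it.\<close>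
  have "sob_of p (\<lambda>j. fext T (dcoef T j c)) \<le> (L2_set K {..Suc ?m} + 1) * ell2_norm (diag_op (alg_weight p) c)"
    if c: "c \<in> diag_dom (alg_weight p)" for c
  proof -
    let ?D = "diag_op (alg_weight p) c"
    have d: "?D \<in> ell2" "c \<in> ell2" using c by (auto simp: diag_dom_def)
    have dc: "dcoef T j c \<in> ell2" "ell2_norm (dcoef T j c) \<le> pi ^ j * ell2_norm ?D" if "j \<le> ?m" for j
      using that mp by (intro ell2_comparison[OF d(1) dcoef_bound[OF T p]]; simp)+
    have "sob_comp p (\<lambda>j. fext T (dcoef T j c)) i \<le> K i * ell2_norm ?D" for i
    proof -
      consider "i \<le> ?m" | "\<not> i \<le> ?m" "frac p > 0" | "\<not> i \<le> ?m" "\<not> frac p > 0" by blast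
      thus ?thesis
      proof cases
        case 1
        have "nrm Lam (fext T (dcoef T i c)) \<le> sqrt (2 * T) * ell2_norm (dcoef T i c)"
          by (rule nrm_fext_le[OF T dc(1)[OF 1]])
        also have "\<dots> \<le> sqrt (2 * T) * (pi ^ i * ell2_norm ?D)"
          using T by (intro mult_left_mono dc(2) 1) auto
        finally show ?thesis using 1 by (simp add: sob_comp_def K_def)
      next
        case 2
        have "real ?m + frac p \<le> p" using p by (simp add: frac_def)
        note * = ell2_comparison[OF d(1) frac_freq_bound[OF T p this 2(2)] powr_ge_zero]
        have "nrm (Lam \<Otimes>\<^sub>M Lam) (gq (frac p) (fext T (dcoef T ?m c)))
            \<le> sqrt (2 * T * kernI (frac p)) * ell2_norm (\<lambda>l. of_real (\<bar>freq T l\<bar> powr frac p) * dcoef T ?m c l)"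
          by (intro gagliardo_fext(2)[OF T 2(2) frac_lt_1 dc(1)] *) auto
        also have "\<dots> \<le> sqrt (2 * T * kernI (frac p)) * (pi powr (real ?m + frac p) * ell2_norm ?D)"
          using T by (intro mult_left_mono *) auto
        finally show ?thesis using 2 by (simp add: sob_comp_def K_def)
      qed (use K0[of i] in \<open>simp add: sob_comp_def\<close>)
    qed
    hence "sob_of p (\<lambda>j. fext T (dcoef T j c)) \<le> L2_set (\<lambda>i. K i * ell2_norm ?D) {..Suc ?m}"
      unfolding sob_of_def by (intro L2_set_mono) (auto simp: sob_comp_nonneg)
    also have "\<dots> = L2_set K {..Suc ?m} * ell2_norm ?D" by (simp add: L2_set_left_distrib)
    also have "\<dots> \<le> (L2_set K {..Suc ?m} + 1) * ell2_norm ?D" by (intro mult_right_mono) auto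
    finally show ?thesis .
  qed
  moreover have "0 < L2_set K {..Suc ?m} + 1" by (intro add_nonneg_pos L2_set_nonneg) simp
  ultimately show ?thesis by blast
qed

section \<open>Interpolation on the interval\<close>

lemma nn_integral_lebesgue_on:
  "(\<integral>\<^sup>+x. f x \<partial>lebesgue_on {a..b}) = (\<integral>\<^sup>+x. f x * indicator {a..b::real} x \<partial>lborel)"
  by (simp add: nn_integral_restrict_space nn_integral_completion)

lemma continuous_sqi_interval:
  fixes f :: "real \<Rightarrow> complex"
  assumes "continuous_on {a..b} f" shows "f \<in> sqi (lebesgue_on {a..b})"
proof -
  have "integrable (lebesgue_on {a..b}) (\<lambda>x. (cmod (f x))\<^sup>2)"
    by (intro continuous_imp_integrable_real continuous_intros assms)
  thus ?thesis using continuous_imp_measurable_on_sets_lebesgue[OF assms] by (simp add: sqi_def)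
qed

text \<open>The part of the squared norm of \<open>g\<close> that lies within distance
  \<open>h\<close> of \<open>x\<close>. It controls all increments from \<open>x\<close> to points
  at most \<open>h\<close> away, and its integral over \<open>x\<close> is computable.\<close>

definition local_energy :: "(real \<Rightarrow> complex) \<Rightarrow> real \<Rightarrow> real \<Rightarrow> ennreal" where
  "local_energy g h x = (\<integral>\<^sup>+s. ennreal ((cmod (g s))\<^sup>2) * indicator {-1..1} s * indicator {x - h..x + h} s \<partial>lborel)"

lemma local_energy_eq:
  "local_energy g h x = (\<integral>\<^sup>+s. ennreal ((cmod (g s))\<^sup>2) * indicator {-1..1} s * (if \<bar>s - x\<bar> \<le> h then 1 else 0) \<partial>lborel)"
  unfolding local_energy_def by (intro nn_integral_cong) (auto split: split_indicator)

lemma local_energy_measurable: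
  assumes "continuous_on UNIV g" shows "local_energy g h \<in> borel_measurable borel"
proof -
  have [measurable]: "g \<in> borel_measurable borel" using assms by (rule borel_measurable_continuous_onI)
  show ?thesis unfolding local_energy_eq[abs_def] by measurable
qed

text \<open>The increment is the inner product of the derivative with the constant 1 over the
  segment; Cauchy-Schwarz contributes the length of the segment.\<close>

lemma increment_le_local_energy:
  assumes d: "\<And>x. (f has_vector_derivative g x) (at x)" and c: "continuous_on UNIV g"
    and xy: "x \<in> {-1..1}" "y \<in> {-1..1}" "\<bar>x - y\<bar> \<le> h"
  shows "ennreal ((cmod (f y - f x))\<^sup>2) \<le> ennreal h * local_energy g h x"
proof -
  have *: "ennreal ((cmod (f b - f a))\<^sup>2) \<le> ennreal h * local_energy g h x"
    if ab: "a \<le> b" "{a..b} \<subseteq> {-1..1}" "{a..b} \<subseteq> {x - h..x + h}" "b - a \<le> h" for a b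
  proof -
    let ?M = "lebesgue_on {a..b}"
    have ca: "continuous_on {a..b} g" using c by (rule continuous_on_subset) simp
    have gs: "g \<in> sqi ?M" by (rule continuous_sqi_interval[OF ca])
    have os: "(\<lambda>_. 1) \<in> sqi ?M" by (intro continuous_sqi_interval continuous_intros)
    have "(g has_integral (f b - f a)) {a..b}"
      using ab(1) d by (intro fundamental_theorem_of_calculus) (auto intro: has_vector_derivative_at_within)
    hence "ip ?M g (\<lambda>_. 1) = f b - f a"
      unfolding ip_def using continuous_imp_integrable_real[OF ca]
      by (simp add: lebesgue_integral_eq_integral integral_unique)
    hence "cmod (f b - f a) \<le> nrm ?M g * nrm ?M (\<lambda>_. 1)" using cmod_ip_le[OF gs os] by simp
    hence "(cmod (f b - f a))\<^sup>2 \<le> (nrm ?M g * nrm ?M (\<lambda>_. 1))\<^sup>2" by (rule power_mono) simp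
    also have "\<dots> = (b - a) * (nrm ?M g)\<^sup>2"
      using ab(1) by (simp add: power_mult_distrib nrm_square space_restrict_space measure_restrict_space)
    also have "\<dots> \<le> h * (nrm ?M g)\<^sup>2" using ab by (intro mult_right_mono) auto
    finally have "ennreal ((cmod (f b - f a))\<^sup>2) \<le> ennreal h * ennreal ((nrm ?M g)\<^sup>2)"
      using ab by (simp add: ennreal_leI flip: ennreal_mult)
    also have "ennreal ((nrm ?M g)\<^sup>2) \<le> local_energy g h x"
      unfolding nn_integral_sqi[OF gs, symmetric] nn_integral_lebesgue_on local_energy_def
      using ab by (intro nn_integral_mono) (auto split: split_indicator)
    finally show ?thesis by (simp add: mult_left_mono)
  qed
  show ?thesis
  proof (cases "x \<le> y")
    case True
    thus ?thesis using xy by (intro *) auto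
  next
    case False
    have "ennreal ((cmod (f x - f y))\<^sup>2) \<le> ennreal h * local_energy g h x" using False xy by (intro *) auto
    thus ?thesis by (simp add: norm_minus_commute)
  qed
qed

text \<open>By Tonelli, each point \<open>s\<close> is counted for those \<open>x\<close> within
  distance \<open>h\<close>, a set of length \<open>2 * h\<close>.\<close>

lemma integral_local_energy:
  assumes c: "continuous_on UNIV g" and h: "0 \<le> h"
  shows "(\<integral>\<^sup>+x. local_energy g h x * indicator {-1..1} x \<partial>lborel) \<le> ennreal (2 * h * (nrm Lam g)\<^sup>2)"
proof -
  have [measurable]: "g \<in> borel_measurable borel" using c by (rule borel_measurable_continuous_onI)
  have gs: "g \<in> sqi Lam" using c continuous_L2 by (auto simp: L2_sqi intro: continuous_on_subset)
  let ?e = "\<lambda>s. ennreal ((cmod (g s))\<^sup>2) * indicator {-1..1} s"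
  have "(\<integral>\<^sup>+x. local_energy g h x * indicator {-1..1} x \<partial>lborel) \<le> (\<integral>\<^sup>+x. local_energy g h x \<partial>lborel)"
    by (intro nn_integral_mono) (auto split: split_indicator)
  also have "\<dots> = (\<integral>\<^sup>+x. (\<integral>\<^sup>+s. ?e s * (if \<bar>s - x\<bar> \<le> h then 1 else 0) \<partial>lborel) \<partial>lborel)"
    by (simp only: local_energy_eq)
  also have "\<dots> = (\<integral>\<^sup>+s. (\<integral>\<^sup>+x. ?e s * (if \<bar>s - x\<bar> \<le> h then 1 else 0) \<partial>lborel) \<partial>lborel)"
    by (intro lborel_pair.Fubini') measurable
  also have "\<dots> = (\<integral>\<^sup>+s. ?e s * (\<integral>\<^sup>+x. indicator {s - h..s + h} x \<partial>lborel) \<partial>lborel)"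
  proof (rule nn_integral_cong)
    fix s :: real
    have "(\<integral>\<^sup>+x. ?e s * (if \<bar>s - x\<bar> \<le> h then 1 else 0) \<partial>lborel) = (\<integral>\<^sup>+x. ?e s * indicator {s - h..s + h} x \<partial>lborel)"
      by (intro nn_integral_cong) (auto split: split_indicator)
    thus "(\<integral>\<^sup>+x. ?e s * (if \<bar>s - x\<bar> \<le> h then 1 else 0) \<partial>lborel) = ?e s * (\<integral>\<^sup>+x. indicator {s - h..s + h} x \<partial>lborel)"
      by (simp add: nn_integral_cmult)
  qed
  also have "\<dots> = (\<integral>\<^sup>+s. ?e s * ennreal (2 * h) \<partial>lborel)"
    using h by (intro nn_integral_cong) simp
  also have "\<dots> = ennreal ((nrm Lam g)\<^sup>2) * ennreal (2 * h)"
    by (subst nn_integral_multc) (auto simp: nn_integral_Lam[symmetric] nn_integral_sqi[OF gs])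
  finally show ?thesis using h by (simp add: ennreal_mult mult_ac)
qed

lemma shift_diff_le_derivative:
  assumes d: "\<And>x. (f has_vector_derivative g x) (at x)" and c: "continuous_on UNIV g"
  shows "(\<integral>\<^sup>+x. shift_diff f h x \<partial>lborel) \<le> ennreal (2 * h\<^sup>2 * (nrm Lam g)\<^sup>2)"
proof -
  have "(\<integral>\<^sup>+x. shift_diff f h x \<partial>lborel)
      \<le> (\<integral>\<^sup>+x. ennreal \<bar>h\<bar> * (local_energy g \<bar>h\<bar> x * indicator {-1..1} x) \<partial>lborel)"
  proof (rule nn_integral_mono)
    fix x :: real
    show "shift_diff f h x \<le> ennreal \<bar>h\<bar> * (local_energy g \<bar>h\<bar> x * indicator {-1..1} x)"
      using increment_le_local_energy[OF d c, of x "x + h" "\<bar>h\<bar>"]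
      by (auto simp: shift_diff_def split: split_indicator)
  qed
  also have "\<dots> = ennreal \<bar>h\<bar> * (\<integral>\<^sup>+x. local_energy g \<bar>h\<bar> x * indicator {-1..1} x \<partial>lborel)"
    using local_energy_measurable[OF c] by (intro nn_integral_cmult) auto
  also have "\<dots> \<le> ennreal \<bar>h\<bar> * ennreal (2 * \<bar>h\<bar> * (nrm Lam g)\<^sup>2)"
    by (intro mult_left_mono integral_local_energy c) auto
  also have "\<dots> = ennreal (2 * h\<^sup>2 * (nrm Lam g)\<^sup>2)"
  proof -
    have "\<bar>h\<bar> * (2 * \<bar>h\<bar> * (nrm Lam g)\<^sup>2) = 2 * (\<bar>h\<bar> * \<bar>h\<bar>) * (nrm Lam g)\<^sup>2" by simp
    also have "\<bar>h\<bar> * \<bar>h\<bar> = h\<^sup>2" by (simp add: power2_eq_square)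
    finally show ?thesis by (subst ennreal_mult[symmetric]) auto
  qed
  finally show ?thesis .
qed

lemma shifted_nn_integral:
  assumes c: "continuous_on UNIV f"
  shows "(\<integral>\<^sup>+x. ennreal ((cmod (f (x + h)))\<^sup>2) * indicator {-1..1} (x + h) \<partial>lborel) = ennreal ((nrm Lam f)\<^sup>2)"
proof -
  have [measurable]: "f \<in> borel_measurable borel" using c by (rule borel_measurable_continuous_onI)
  have fs: "f \<in> sqi Lam" using c continuous_L2 by (auto simp: L2_sqi intro: continuous_on_subset)
  have "(\<integral>\<^sup>+x. ennreal ((cmod (f x))\<^sup>2) * indicator {-1..1} x \<partial>lborel)
      = (\<integral>\<^sup>+x. ennreal ((cmod (f (h + x)))\<^sup>2) * indicator {-1..1} (h + x) \<partial>lborel)"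
    by (subst nn_integral_real_affine[of _ 1 h]) auto
  thus ?thesis by (simp add: nn_integral_Lam[symmetric] nn_integral_sqi[OF fs] add.commute)
qed

text \<open>The bound for large shifts. With \<open>shift_diff_le_derivative\<close> for small ones
  it produces the minimum demanded by \<open>gagliardo_le\<close>.\<close>

lemma shift_diff_le_norm:
  assumes c: "continuous_on UNIV f"
  shows "(\<integral>\<^sup>+x. shift_diff f h x \<partial>lborel) \<le> ennreal (4 * (nrm Lam f)\<^sup>2)"
proof -
  have [measurable]: "f \<in> borel_measurable borel" using c by (rule borel_measurable_continuous_onI)
  have "(\<integral>\<^sup>+x. shift_diff f h x \<partial>lborel) \<le> (\<integral>\<^sup>+x. ennreal 2 * (ennreal ((cmod (f (x + h)))\<^sup>2) * indicator {-1..1} (x + h))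
      + ennreal 2 * (ennreal ((cmod (f (x + 0)))\<^sup>2) * indicator {-1..1} (x + 0)) \<partial>lborel)"
  proof (rule nn_integral_mono)
    fix x :: real
    have "(cmod (f (x + h) - f x))\<^sup>2 \<le> 2 * (cmod (f (x + h)))\<^sup>2 + 2 * (cmod (f x))\<^sup>2"
      using cmod_add_square_le[of "f (x + h)" "- f x"] by simp
    hence "ennreal ((cmod (f (x + h) - f x))\<^sup>2) \<le> ennreal (2 * (cmod (f (x + h)))\<^sup>2 + 2 * (cmod (f x))\<^sup>2)"
      by (rule ennreal_leI)
    also have "\<dots> = ennreal 2 * ennreal ((cmod (f (x + h)))\<^sup>2) + ennreal 2 * ennreal ((cmod (f x))\<^sup>2)"
      by (simp add: ennreal_mult)
    finally have "ennreal ((cmod (f (x + h) - f x))\<^sup>2)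
        \<le> ennreal 2 * ennreal ((cmod (f (x + h)))\<^sup>2) + ennreal 2 * ennreal ((cmod (f x))\<^sup>2)" .
    thus "shift_diff f h x \<le> ennreal 2 * (ennreal ((cmod (f (x + h)))\<^sup>2) * indicator {-1..1} (x + h))
      + ennreal 2 * (ennreal ((cmod (f (x + 0)))\<^sup>2) * indicator {-1..1} (x + 0))"
      by (auto simp: shift_diff_def split: split_indicator)
  qed
  also have "\<dots> = ennreal 2 * ennreal ((nrm Lam f)\<^sup>2) + ennreal 2 * ennreal ((nrm Lam f)\<^sup>2)"
    unfolding shifted_nn_integral[OF c, symmetric, of h]
    by (subst nn_integral_add; simp add: nn_integral_cmult)
      (simp add: shifted_nn_integral[OF c] shifted_nn_integral[OF c, of 0, simplified])
  also have "\<dots> = ennreal (2 * (nrm Lam f)\<^sup>2 + 2 * (nrm Lam f)\<^sup>2)"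
    by (subst ennreal_plus) (simp_all add: ennreal_mult)
  also have "\<dots> = ennreal (4 * (nrm Lam f)\<^sup>2)" by simp
  finally show ?thesis .
qed

text \<open>The difference quotient is taken to the right for \<open>x \<le> 0\<close> and to the left for \<open>x > 0\<close>,
  which keeps it inside the interval.\<close>

lemma landau_inequality:
  assumes d1: "\<And>x. (f has_vector_derivative f1 x) (at x)" and d2: "\<And>x. (f1 has_vector_derivative f2 x) (at x)"
    and c: "continuous_on UNIV f2" and h: "0 < h" "h \<le> 1"
  shows "h * nrm Lam f1 \<le> 3 * nrm Lam f + 3 * h\<^sup>2 * nrm Lam f2"
proof -
  have cf: "continuous_on UNIV f" "continuous_on UNIV f1"
    using d1 d2 by (meson continuous_at_imp_continuous_on has_vector_derivative_continuous)+
  have [measurable]: "f \<in> borel_measurable borel" "f1 \<in> borel_measurable borel" "f2 \<in> borel_measurable borel"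
    using cf c by (auto intro: borel_measurable_continuous_onI)
  have sq: "f \<in> sqi Lam" "f1 \<in> sqi Lam" "f2 \<in> sqi Lam"
    using cf c continuous_L2 by (auto simp: L2_sqi intro: continuous_on_subset)
  let ?I = "\<lambda>x::real. indicator {-1..1} x :: ennreal"
  let ?V = "local_energy f2 h"
  let ?N = "\<lambda>f x. ennreal ((cmod (f x))\<^sup>2) * ?I x"
  have pt: "ennreal (h\<^sup>2) * ?N f1 x \<le> ennreal 3 * (?N f (x + h) + ?N f (x + - h) + ?N f x) + ennreal (3 * h ^ 3) * (?V x * ?I x)" for x
  proof (cases "x \<in> {-1..1}")
    case True
    have "?V x \<le> (\<integral>\<^sup>+x. ?N f2 x \<partial>lborel)" unfolding local_energy_def
      by (intro nn_integral_mono) (auto split: split_indicator)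
    also have "\<dots> < top" unfolding nn_integral_Lam[symmetric] nn_integral_sqi[OF sq(3)] by simp
    finally obtain V where V: "?V x = ennreal V" "0 \<le> V" by (cases "?V x") auto
    define y where "y = (if x \<le> 0 then x + h else x + - h)"
    have y: "y \<in> {-1..1}" "\<bar>y - x\<bar> = h" using True h by (auto simp: y_def)
    \<comment> \<open>Taylor expansion of first order: along the segment \<open>f1\<close> deviates
      from \<open>f1 x\<close> by at most \<open>sqrt (h * V)\<close>, by the increment estimate
      applied to \<open>f1\<close>.\<close>
    have "cmod (f y - f x - (y - x) *\<^sub>R f1 x) \<le> norm (y - x) * sqrt (h * V)"
    proof (rule vector_differentiable_bound_linearization[where S = "closed_segment x y"])
      fix z assume z: "z \<in> closed_segment x y"
      show "(f has_vector_derivative f1 z) (at z within closed_segment x y)"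
        by (rule has_vector_derivative_at_within[OF d1])
      have "z \<in> {-1..1}" "\<bar>x - z\<bar> \<le> h"
        using z y True by (auto simp: closed_segment_eq_real_ivl split: if_splits)
      from increment_le_local_energy[OF d2 c True this]
      have "(cmod (f1 z - f1 x))\<^sup>2 \<le> h * V" using V h by (simp flip: ennreal_mult)
      thus "cmod (f1 z - f1 x) \<le> sqrt (h * V)" by (rule real_le_rsqrt)
    qed auto
    hence "cmod (f y - f x - of_real (y - x) * f1 x) \<le> sqrt (h * V) * h"
      using y(2) by (simp add: scaleR_conv_of_real mult.commute)
    moreover have "h * cmod (f1 x) = cmod (of_real (y - x) * f1 x)" using y(2) unfolding norm_mult norm_of_real by simp
    moreover have "cmod (of_real (y - x) * f1 x) \<le> cmod (f y - f x) + cmod (f y - f x - of_real (y - x) * f1 x)"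
      using norm_triangle_ineq4[of "f y - f x" "f y - f x - of_real (y - x) * f1 x"] by simp
    moreover have "cmod (f y - f x) \<le> cmod (f y) + cmod (f x)" by (rule norm_triangle_ineq4)
    ultimately have "h * cmod (f1 x) \<le> cmod (f y) + cmod (f x) + sqrt (h * V) * h" by linarith
    hence "(h * cmod (f1 x))\<^sup>2 \<le> (cmod (f y) + cmod (f x) + sqrt (h * V) * h)\<^sup>2"
      using h by (intro power_mono) auto
    also have "\<dots> \<le> 3 * ((cmod (f y))\<^sup>2 + (cmod (f x))\<^sup>2 + (sqrt (h * V) * h)\<^sup>2)"
    proof -
      have "(a + b + c)\<^sup>2 \<le> 3 * (a\<^sup>2 + b\<^sup>2 + c\<^sup>2)" for a b c :: real
        using sum_squares_ge_zero[of "a - b" "b - c"] zero_le_square[of "a - c"]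
        by (simp add: power2_eq_square algebra_simps)
      thus ?thesis .
    qed
    also have "(sqrt (h * V) * h)\<^sup>2 = h ^ 3 * V" using h V by (simp add: power_mult_distrib power3_eq_cube power2_eq_square)
    finally have "h\<^sup>2 * (cmod (f1 x))\<^sup>2 \<le> 3 * ((cmod (f y))\<^sup>2 + (cmod (f x))\<^sup>2) + 3 * h ^ 3 * V"
      by (simp add: power_mult_distrib)
    hence "ennreal (h\<^sup>2 * (cmod (f1 x))\<^sup>2) \<le> ennreal (3 * ((cmod (f y))\<^sup>2 + (cmod (f x))\<^sup>2) + 3 * h ^ 3 * V)"
      by (rule ennreal_leI)
    also have "\<dots> = ennreal 3 * (ennreal ((cmod (f y))\<^sup>2) + ennreal ((cmod (f x))\<^sup>2)) + ennreal (3 * h ^ 3) * ennreal V"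
      using h V by (simp add: ennreal_mult ennreal_plus)
    \<comment> \<open>The point \<open>y\<close> depends on the sign of \<open>x\<close>. Bounding
      by the sum of both shifts, each with its own indicator, leaves terms whose integrals are
      translates of the norm of \<open>f\<close>.\<close>
    also have "ennreal ((cmod (f y))\<^sup>2) \<le> ?N f (x + h) + ?N f (x + - h)"
      using y(1) unfolding y_def by (auto split: if_splits simp: add_increasing add_increasing2)
    finally show ?thesis using True V h by (simp add: ennreal_mult add.assoc mult_left_mono add_mono)
  qed simp
  have Vm: "(\<lambda>x. ?V x * ?I x) \<in> borel_measurable lborel"
    using local_energy_measurable[OF c] by auto
  have N: "(\<integral>\<^sup>+x. ?N f1 x \<partial>lborel) = ennreal ((nrm Lam f1)\<^sup>2)" "(\<integral>\<^sup>+x. ?N f x \<partial>lborel) = ennreal ((nrm Lam f)\<^sup>2)"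
    unfolding nn_integral_Lam[symmetric] nn_integral_sqi[OF sq(2)] nn_integral_sqi[OF sq(1)] by simp_all
  have "ennreal (h\<^sup>2 * (nrm Lam f1)\<^sup>2) = (\<integral>\<^sup>+x. ennreal (h\<^sup>2) * ?N f1 x \<partial>lborel)"
    by (subst nn_integral_cmult) (auto simp: N ennreal_mult)
  also have "\<dots> \<le> (\<integral>\<^sup>+x. ennreal 3 * (?N f (x + h) + ?N f (x + - h) + ?N f x) + ennreal (3 * h ^ 3) * (?V x * ?I x) \<partial>lborel)"
    by (intro nn_integral_mono pt)
  also have "\<dots> = ennreal 3 * ((\<integral>\<^sup>+x. ?N f (x + h) \<partial>lborel) + (\<integral>\<^sup>+x. ?N f (x + - h) \<partial>lborel) + (\<integral>\<^sup>+x. ?N f x \<partial>lborel))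
      + ennreal (3 * h ^ 3) * (\<integral>\<^sup>+x. ?V x * ?I x \<partial>lborel)"
    using Vm by (simp add: nn_integral_add nn_integral_cmult)
  also have "\<dots> \<le> ennreal 3 * (ennreal ((nrm Lam f)\<^sup>2) + ennreal ((nrm Lam f)\<^sup>2) + ennreal ((nrm Lam f)\<^sup>2))
      + ennreal (3 * h ^ 3) * ennreal (2 * h * (nrm Lam f2)\<^sup>2)"
    unfolding shifted_nn_integral[OF cf(1)] N
    using h by (intro add_mono mult_left_mono integral_local_energy c order_refl) auto
  also have "\<dots> = ennreal (3 * ((nrm Lam f)\<^sup>2 + (nrm Lam f)\<^sup>2 + (nrm Lam f)\<^sup>2)
      + 3 * h ^ 3 * (2 * h * (nrm Lam f2)\<^sup>2))"
  proof -
    have "ennreal (3 * (a + a + a) + b * c) = ennreal 3 * (ennreal a + ennreal a + ennreal a) + ennreal b * ennreal c"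
      if "0 \<le> a" "0 \<le> b" "0 \<le> c" for a b c
      using that by (simp only: ennreal_plus ennreal_mult add_nonneg_nonneg mult_nonneg_nonneg zero_le_numeral)
    from this[of "(nrm Lam f)\<^sup>2" "3 * h ^ 3" "2 * h * (nrm Lam f2)\<^sup>2", symmetric] show ?thesis
      using h by (simp only: zero_le_power2 zero_le_power mult_nonneg_nonneg zero_le_numeral less_imp_le)
  qed
  also have "\<dots> = ennreal (9 * (nrm Lam f)\<^sup>2 + 6 * h ^ 4 * (nrm Lam f2)\<^sup>2)"
    by (simp add: eval_nat_numeral algebra_simps)
  finally have "(h * nrm Lam f1)\<^sup>2 \<le> 9 * (nrm Lam f)\<^sup>2 + 6 * h ^ 4 * (nrm Lam f2)\<^sup>2"
    using h by (subst (asm) ennreal_le_iff) (auto simp: power_mult_distrib)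
  \<comment> \<open>Completing the square: the mixed term is nonnegative and the coefficient 6 is
    below 9.\<close>
  also have "\<dots> \<le> (3 * nrm Lam f + 3 * h\<^sup>2 * nrm Lam f2)\<^sup>2"
  proof -
    have "0 \<le> h\<^sup>2 * (nrm Lam f * nrm Lam f2)" "0 \<le> h ^ 4 * (nrm Lam f2)\<^sup>2" using h by auto
    thus ?thesis by (simp add: power2_sum power_mult_distrib mult_ac)
  qed
  finally show ?thesis by (rule power2_le_imp_le) simp
qed

text \<open>Interpolation is stated for whole chains of derivatives, so that the induction on the
  order can pass to the chain without its bottom level.\<close>

definition tower :: "(nat \<Rightarrow> real \<Rightarrow> complex) \<Rightarrow> bool" where
  "tower w \<longleftrightarrow> (\<forall>j x. (w j has_vector_derivative w (Suc j) x) (at x))"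

lemma tower_continuous: "tower w \<Longrightarrow> continuous_on A (w j)"
  unfolding tower_def by (meson continuous_at_imp_continuous_on has_vector_derivative_continuous)

lemma tower_Suc: "tower w \<Longrightarrow> tower (\<lambda>j. w (Suc j))"
  by (simp add: tower_def)

text \<open>Induction on the order: Landau's inequality with step \<open>\<eta> t\<close> bounds the first level by the
  second one with a factor \<open>\<eta>\<close>, small enough to absorb the bound that the induction hypothesis for
  the derived tower gives for the second level.\<close>

lemma tower_interpolation:
  "\<exists>C\<ge>1. \<forall>w t. tower w \<longrightarrow> 0 < t \<longrightarrow> t \<le> 1 \<longrightarrow>
     (\<forall>j\<le>Suc K. t ^ j * nrm Lam (w j) \<le> C * (nrm Lam (w 0) + t ^ Suc K * nrm Lam (w (Suc K))))"
proof (induction K)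
  case 0
  have "t ^ j * nrm Lam (w j) \<le> 1 * (nrm Lam (w 0) + t ^ Suc 0 * nrm Lam (w (Suc 0)))"
    if "0 < t" "j \<le> Suc 0" for w and t :: real and j
  proof -
    have "j = 0 \<or> j = Suc 0" using that by auto
    thus ?thesis using that by (elim disjE) auto
  qed
  thus ?case by (intro exI[of _ 1] conjI allI impI) auto
next
  case (Suc K)
  then obtain C where C: "1 \<le> C" and IH: "\<And>w t j. tower w \<Longrightarrow> 0 < t \<Longrightarrow> t \<le> 1 \<Longrightarrow> j \<le> Suc K \<Longrightarrow>
      t ^ j * nrm Lam (w j) \<le> C * (nrm Lam (w 0) + t ^ Suc K * nrm Lam (w (Suc K)))" by blast
  \<comment> \<open>The constant is what remains after inserting the bound
    \<open>36 * C * a 0 + a (Suc (Suc K))\<close> for \<open>a 1\<close> into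
    \<open>step\<close>.\<close>
  have "t ^ j * nrm Lam (w j) \<le> (36 * C\<^sup>2 + 2 * C) * (nrm Lam (w 0) + t ^ Suc (Suc K) * nrm Lam (w (Suc (Suc K))))"
    if w: "tower w" and t: "0 < t" "t \<le> 1" and j: "j \<le> Suc (Suc K)" for w t j
  proof -
    define a where "a j = t ^ j * nrm Lam (w j)" for j
    have a0: "0 \<le> a j" for j using t by (simp add: a_def)
    \<comment> \<open>The induction hypothesis for the derived tower, multiplied by \<open>t\<close>
      to restore the scaling.\<close>
    have step: "a (Suc j) \<le> C * (a 1 + a (Suc (Suc K)))" if "j \<le> Suc K" for j
    proof -
      have "t * (t ^ j * nrm Lam (w (Suc j))) \<le> t * (C * (nrm Lam (w (Suc 0)) + t ^ Suc K * nrm Lam (w (Suc (Suc K)))))"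
        using IH[OF tower_Suc[OF w] t that] t by (intro mult_left_mono) auto
      thus ?thesis by (simp add: a_def algebra_simps)
    qed
    \<comment> \<open>With \<open>\<eta> * C = 1 / 6\<close> the coefficient of \<open>a 1\<close>
      on the right becomes \<open>18 / 36\<close>, that is one half, and can be absorbed on the
      left.\<close>
    define \<eta> where "\<eta> = 1 / (6 * C)"
    have eta: "0 < \<eta>" "\<eta> \<le> 1" using C by (auto simp: \<eta>_def)
    have "(\<eta> * t) * nrm Lam (w 1) \<le> 3 * nrm Lam (w 0) + 3 * (\<eta> * t)\<^sup>2 * nrm Lam (w 2)"
      using w tower_continuous[OF w] eta t mult_le_one[of \<eta> t]
      by (intro landau_inequality) (auto simp: tower_def numeral_2_eq_2)
    hence "\<eta> * a 1 \<le> 3 * a 0 + 3 * \<eta>\<^sup>2 * a 2"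
      by (simp add: a_def power_mult_distrib mult_ac)
    also have "\<dots> \<le> 3 * a 0 + 3 * \<eta>\<^sup>2 * (C * (a 1 + a (Suc (Suc K))))"
      using step[of 1] by (intro add_left_mono mult_left_mono) (auto simp: numeral_2_eq_2)
    finally have eta_a1: "\<eta> * a 1 \<le> 3 * a 0 + 3 * \<eta>\<^sup>2 * (C * (a 1 + a (Suc (Suc K))))" .
    have e: "\<eta> * C = 1 / 6" using C by (simp add: \<eta>_def)
    have "a 1 = 6 * (\<eta> * C) * a 1" unfolding e by simp
    also have "\<dots> = 6 * C * (\<eta> * a 1)" by simp
    also have "\<dots> \<le> 6 * C * (3 * a 0 + 3 * \<eta>\<^sup>2 * (C * (a 1 + a (Suc (Suc K)))))"
      using C by (intro mult_left_mono eta_a1) auto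
    also have "\<dots> = 18 * C * a 0 + 18 * (\<eta> * C) * (\<eta> * C) * (a 1 + a (Suc (Suc K)))"
      by (simp add: power2_eq_square algebra_simps)
    also have "\<dots> = 18 * C * a 0 + (a 1 + a (Suc (Suc K))) / 2" unfolding e by simp
    finally have "a 1 \<le> 18 * C * a 0 + (a 1 + a (Suc (Suc K))) / 2" .
    hence a1: "a 1 \<le> 36 * C * a 0 + a (Suc (Suc K))" by (simp add: field_simps)
    have CC: "1 \<le> 36 * C\<^sup>2 + 2 * C" using C by (simp add: add_increasing)
    have "a j \<le> (36 * C\<^sup>2 + 2 * C) * (a 0 + a (Suc (Suc K)))"
    proof (cases j)
      case 0
      have "a 0 \<le> 1 * (a 0 + a (Suc (Suc K)))" using a0 by simp
      also have "\<dots> \<le> (36 * C\<^sup>2 + 2 * C) * (a 0 + a (Suc (Suc K)))"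
        using a0 CC by (intro mult_right_mono add_nonneg_nonneg) auto
      finally show ?thesis using 0 by simp
    next
      case (Suc i)
      have "a (Suc i) \<le> C * (a 1 + a (Suc (Suc K)))" using Suc j by (intro step) auto
      also have "\<dots> \<le> C * (36 * C * a 0 + 2 * a (Suc (Suc K)))"
        using a1 C by (intro mult_left_mono) auto
      also have "\<dots> = 36 * C\<^sup>2 * a 0 + 2 * C * a (Suc (Suc K))" by (simp add: power2_eq_square algebra_simps)
      also have "\<dots> \<le> (36 * C\<^sup>2 + 2 * C) * a 0 + (36 * C\<^sup>2 + 2 * C) * a (Suc (Suc K))"
        using C a0 by (intro add_mono mult_right_mono) auto
      finally show ?thesis using Suc by (simp add: distrib_left)
    qed
    thus ?thesis by (simp add: a_def)
  qed
  moreover have "1 \<le> 36 * C\<^sup>2 + 2 * C" using C by (simp add: add_increasing)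
  ultimately show ?case by blast
qed

text \<open>For distances beyond \<open>t\<close> the norm of the function bounds the increments,
  for shorter ones that of its derivative. Together they look like one exponential of frequency
  \<open>1 / t\<close>, whence the factor \<open>t powr - \<theta>\<close>.\<close>

lemma tower_gagliardo:
  assumes w: "tower w" and th: "0 < \<theta>" "\<theta> < 1" and t: "0 < t" and B: "nrm Lam (w m) \<le> B" "t * nrm Lam (w (Suc m)) \<le> B"
  shows "nrm (Lam \<Otimes>\<^sub>M Lam) (gq \<theta> (w m)) \<le> sqrt (2 * kernI \<theta>) * B * t powr - \<theta>"
proof -
  have B0: "0 \<le> B" using B(1) nrm_nonneg[of Lam "w m"] by linarith
  have D: "(\<integral>\<^sup>+x. shift_diff (w m) h x \<partial>lborel) \<le> ennreal (\<Sum>l\<in>{()}. 2 * B\<^sup>2 * min 4 ((1 / t * h)\<^sup>2))" for h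
  proof -
    have "4 * (nrm Lam (w m))\<^sup>2 \<le> 4 * B\<^sup>2" using B by (intro mult_left_mono power_mono) auto
    also have "\<dots> \<le> 2 * B\<^sup>2 * 4" by simp
    finally have 1: "(\<integral>\<^sup>+x. shift_diff (w m) h x \<partial>lborel) \<le> ennreal (2 * B\<^sup>2 * 4)"
      by (rule order_trans[OF shift_diff_le_norm[OF tower_continuous[OF w]] ennreal_leI])
    have "(t * nrm Lam (w (Suc m)))\<^sup>2 \<le> B\<^sup>2" using B t by (intro power_mono) auto
    hence "2 * h\<^sup>2 * (nrm Lam (w (Suc m)))\<^sup>2 \<le> 2 * B\<^sup>2 * (1 / t * h)\<^sup>2"
      using t mult_left_mono[of "(t * nrm Lam (w (Suc m)))\<^sup>2" "B\<^sup>2" "2 * h\<^sup>2"]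
      by (simp add: power_mult_distrib power_divide field_simps)
    hence 2: "(\<integral>\<^sup>+x. shift_diff (w m) h x \<partial>lborel) \<le> ennreal (2 * B\<^sup>2 * (1 / t * h)\<^sup>2)"
      using w by (intro order_trans[OF shift_diff_le_derivative[OF _ tower_continuous[OF w, of _ "Suc m"]] ennreal_leI])
        (auto simp: tower_def)
    show ?thesis using 1 2 by (simp add: min_def)
  qed
  have "(nrm (Lam \<Otimes>\<^sub>M Lam) (gq \<theta> (w m)))\<^sup>2 \<le> kernI \<theta> * (2 * B\<^sup>2 * \<bar>1 / t\<bar> powr (2 * \<theta>))"
    using gagliardo_le(2)[OF tower_continuous[OF w] th _ _ D] by simp
  also have "\<bar>1 / t\<bar> powr (2 * \<theta>) = (t powr - \<theta>)\<^sup>2"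
    using t by (simp add: powr_divide powr_minus power2_eq_square inverse_eq_divide flip: powr_add)
  finally have "(nrm (Lam \<Otimes>\<^sub>M Lam) (gq \<theta> (w m)))\<^sup>2 \<le> (sqrt (2 * kernI \<theta>) * B * t powr - \<theta>)\<^sup>2"
    by (simp add: power_mult_distrib mult_ac)
  thus ?thesis by (rule power2_le_imp_le) (use B0 in simp)
qed

section \<open>Interpolation for trigonometric sums and Fourier extensions\<close>

lemma fsum_tower: "tower (\<lambda>j. fsum T S (dcoef T j c))"
  using fsum_has_vector_derivative[of T S "dcoef T j c" _ UNIV for j]
  by (simp add: tower_def dcoef_Suc[unfolded One_nat_def])

lemma fsum_sob_rep:
  assumes "1 < T" "0 \<le> q" "finite S"
  shows "sob_rep q (fsum T S c) (\<lambda>j. fsum T S (dcoef T j c))"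
proof -
  have "is_weak_deriv j (fsum T S c) (fsum T S (dcoef T j c))" for j
    unfolding is_weak_deriv_def using fsum_sqi fsum_by_parts_pow by (auto simp: L2_sqi)
  thus ?thesis unfolding sob_rep_def
    using fsum_sqi gagliardo_fsum(1)[OF assms(1) _ frac_lt_1 assms(3)] by (auto simp: L2_sqi)
qed

text \<open>The constant is independent of the set of frequencies. The restriction to
  \<open>\<bar>l\<bar> \<le> 1 / t\<close> lets the weighted norm of order \<open>p\<close> control
  a derivative of order above \<open>p\<close>, at the cost of the matching power of
  \<open>t\<close>; tower interpolation and \<open>tower_gagliardo\<close> then give every order
  between.\<close>

lemma fsum_interpolation:
  assumes T: "1 < T" and p: "0 < p" and q: "0 \<le> q" "q \<le> p"
  shows "\<exists>C>0. \<forall>S c t A. finite S \<longrightarrow> 0 < t \<longrightarrow> t \<le> 1 \<longrightarrow> 0 \<le> A \<longrightarrow> (\<forall>l\<in>S. \<bar>real_of_int l\<bar> \<le> 1 / t) \<longrightarrow>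
     c \<in> diag_dom (alg_weight p) \<longrightarrow> ell2_norm (diag_op (alg_weight p) c) \<le> A \<longrightarrow>
     nrm Lam (fsum T S c) \<le> A * t powr p \<longrightarrow>
     sobolev_norm q (fsum T S c) \<le> C * A * t powr (p - q)"
proof -
  define m where "m = nat \<lfloor>q\<rfloor>"
  \<comment> \<open>The top order \<open>Suc K\<close> must be at least \<open>p\<close>, and also
    at least \<open>Suc m\<close>, since the fractional seminorm at level \<open>m\<close> uses the
    next derivative.\<close>
  define K where "K = nat \<lceil>p\<rceil>"
  have mq: "real m \<le> q" "real m + frac q = q" using q by (auto simp: m_def frac_def)
  have mK: "m \<le> K" "p \<le> real (Suc K)" using q p by (auto simp: m_def K_def) linarith+
  obtain C1 where C1: "1 \<le> C1" and ti: "\<And>w t j. tower w \<Longrightarrow> 0 < t \<Longrightarrow> t \<le> 1 \<Longrightarrow> j \<le> Suc K \<Longrightarrow>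
      t ^ j * nrm Lam (w j) \<le> C1 * (nrm Lam (w 0) + t ^ Suc K * nrm Lam (w (Suc K)))"
    using tower_interpolation[of K] by blast
  define C2 where "C2 = C1 * (1 + sqrt (2 * T) * pi ^ Suc K)"
  have C2: "1 \<le> C2" using C1 T unfolding C2_def by (intro mult_ge1_I) auto
  define k where "k i = (if i \<le> m then C2 else sqrt (2 * kernI (frac q)) * C2)" for i
  have k0: "0 \<le> k i" for i using C2 by (simp add: k_def)
  have "sobolev_norm q (fsum T S c) \<le> (L2_set k {..Suc m} + 1) * A * t powr (p - q)"
    if S: "finite S" and t: "0 < t" "t \<le> 1" and A: "0 \<le> A" and SL: "\<And>l. l \<in> S \<Longrightarrow> \<bar>real_of_int l\<bar> \<le> 1 / t"
      and c: "c \<in> diag_dom (alg_weight p)" and cA: "ell2_norm (diag_op (alg_weight p) c) \<le> A"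
      and w0: "nrm Lam (fsum T S c) \<le> A * t powr p" for S c t A
  proof -
    let ?w = "\<lambda>j. fsum T S (dcoef T j c)" and ?D = "diag_op (alg_weight p) c"
    have D: "?D \<in> ell2" using c by (simp add: diag_dom_def)
    have top: "t ^ Suc K * nrm Lam (?w (Suc K)) \<le> sqrt (2 * T) * pi ^ Suc K * A * t powr p"
    proof -
      \<comment> \<open>Cutting the rescaled coefficients off outside \<open>S\<close> makes the
        pointwise comparison valid for all indices.\<close>
      define d where "d l = (if l \<in> S then of_real (t ^ Suc K) * dcoef T (Suc K) c l else 0)" for l
      have "cmod (d l) \<le> (pi ^ Suc K * t powr p) * cmod (?D l)" for l
      proof (cases "l \<in> S \<and> l \<noteq> 0")
        case True
        let ?x = "\<bar>real_of_int l\<bar>"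
        have x: "1 \<le> ?x" "t * ?x \<le> 1" using True SL[of l] t by (auto simp: field_simps)
        have f: "\<bar>freq T l\<bar> \<le> pi * ?x"
          using T by (simp add: freq_def abs_mult field_simps mult_left_mono)
            (simp add: mult_le_cancel_left1 mult_le_cancel_right1)
        have "t ^ Suc K * \<bar>freq T l\<bar> ^ Suc K \<le> t ^ Suc K * (pi * ?x) ^ Suc K"
          using f t by (intro mult_left_mono power_mono) auto
        also have "\<dots> = pi ^ Suc K * (t * ?x) ^ Suc K" by (simp only: power_mult_distrib mult_ac)
        also have "(t * ?x) ^ Suc K = (t * ?x) powr real (Suc K)"
          using t x by (intro powr_realpow[symmetric]) auto
        \<comment> \<open>As \<open>t * ?x\<close> is at most 1, lowering the exponent from
          \<open>Suc K\<close> to \<open>p\<close> can only increase the power.\<close>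
        also have "\<dots> \<le> (t * ?x) powr p" using x t mK by (intro powr_mono') auto
        also have "\<dots> = t powr p * ?x powr p" using t by (simp add: powr_mult)
        also have "\<dots> \<le> t powr p * alg_weight p (of_int \<bar>l\<bar>)"
          using p by (intro mult_left_mono weight_le) auto
        finally have "t ^ Suc K * \<bar>freq T l\<bar> ^ Suc K \<le> pi ^ Suc K * (t powr p * alg_weight p (of_int \<bar>l\<bar>))"
          by simp
        hence "(t ^ Suc K * \<bar>freq T l\<bar> ^ Suc K) * cmod (c l) \<le> (pi ^ Suc K * (t powr p * alg_weight p (of_int \<bar>l\<bar>))) * cmod (c l)"
          by (rule mult_right_mono) simp
        moreover have "cmod (d l) = (t ^ Suc K * \<bar>freq T l\<bar> ^ Suc K) * cmod (c l)"
          using True t by (simp add: d_def dcoef_def norm_mult norm_power del: power_Suc)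
        moreover have "(pi ^ Suc K * t powr p) * cmod (?D l) = (pi ^ Suc K * (t powr p * alg_weight p (of_int \<bar>l\<bar>))) * cmod (c l)"
          using weight_ge_1[of p "of_int \<bar>l\<bar>"] by (simp add: diag_op_def norm_mult del: power_Suc)
        ultimately show ?thesis by (simp only:)
      qed (auto simp: d_def dcoef_def freq_def)
      from ell2_comparison[OF D this]
      have d: "d \<in> ell2" "ell2_norm d \<le> pi ^ Suc K * t powr p * ell2_norm ?D" by simp_all
      have "(\<lambda>x. of_real (t ^ Suc K) * ?w (Suc K) x) = fsum T S d"
        unfolding fun_eq_iff fsum_cmult[symmetric] by (auto simp: fsum_def d_def)
      hence "t ^ Suc K * nrm Lam (?w (Suc K)) = nrm Lam (fsum T S d)"
        using nrm_cmult[of Lam "of_real (t ^ Suc K)" "?w (Suc K)"] t by (simp add: norm_power del: power_Suc of_real_power)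
      also have "\<dots> \<le> sqrt (2 * T) * ell2_norm d" by (rule nrm_fsum_ell2[OF T S d(1)])
      also have "\<dots> \<le> sqrt (2 * T) * (pi ^ Suc K * t powr p * A)"
        using d(2) cA T order_trans[OF d(2) mult_left_mono[OF cA]] by (intro mult_left_mono) auto
      finally show ?thesis by (simp add: mult_ac del: power_Suc)
    qed
    have lev: "t ^ j * nrm Lam (?w j) \<le> C2 * A * t powr p" if "j \<le> Suc K" for j
    proof -
      have "t ^ j * nrm Lam (?w j) \<le> C1 * (nrm Lam (?w 0) + t ^ Suc K * nrm Lam (?w (Suc K)))"
        by (rule ti[OF fsum_tower t that])
      also have "\<dots> \<le> C1 * (A * t powr p + sqrt (2 * T) * pi ^ Suc K * A * t powr p)"
        using C1 w0 top by (intro mult_left_mono add_mono) auto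
      finally show ?thesis by (simp add: C2_def algebra_simps del: power_Suc)
    qed
    have lev': "nrm Lam (?w j) \<le> C2 * A * t powr (p - real j)" if "j \<le> Suc K" for j
    proof -
      have "nrm Lam (?w j) = (t ^ j * nrm Lam (?w j)) * t powr - real j"
        using t by (simp add: powr_minus powr_realpow)
      also have "\<dots> \<le> (C2 * A * t powr p) * t powr - real j" by (intro mult_right_mono lev that) auto
      finally show ?thesis by (simp add: mult.assoc flip: powr_add)
    qed
    have "sob_comp q ?w i \<le> k i * (A * t powr (p - q))" for i
    proof -
      consider "i \<le> m" | "\<not> i \<le> m" "frac q > 0" | "\<not> i \<le> m" "\<not> frac q > 0" by blast
      thus ?thesis
      proof cases
        case 1
        have "nrm Lam (?w i) \<le> C2 * A * t powr (p - real i)" using 1 mK by (intro lev') auto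
        also have "\<dots> \<le> C2 * A * t powr (p - q)"
          using 1 mq C2 A t by (intro mult_left_mono powr_mono') auto
        finally show ?thesis using 1 by (simp add: sob_comp_def k_def m_def mult.assoc)
      next
        case 2
        have B: "nrm Lam (?w m) \<le> C2 * A * t powr (p - real m)" using mK by (intro lev') auto
        have "t * nrm Lam (?w (Suc m)) \<le> t * (C2 * A * t powr (p - real (Suc m)))"
          using mK t by (intro mult_left_mono lev') auto
        also have "\<dots> = C2 * A * t powr (p - real m)"
        proof -
          have "t * t powr (p - real (Suc m)) = t powr (p - real m)"
            using t powr_add[of t 1 "p - real (Suc m)"] by simp
          thus ?thesis by (simp add: mult_ac)
        qed
        finally have B': "t * nrm Lam (?w (Suc m)) \<le> C2 * A * t powr (p - real m)" .
        have "nrm (Lam \<Otimes>\<^sub>M Lam) (gq (frac q) (?w m)) \<le> sqrt (2 * kernI (frac q)) * (C2 * A * t powr (p - real m)) * t powr - frac q"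
          by (rule tower_gagliardo[OF fsum_tower 2(2) frac_lt_1 t(1) B B'])
        also have "\<dots> = sqrt (2 * kernI (frac q)) * C2 * A * t powr (p - q)"
        proof -
          have "t powr (p - real m) * t powr - frac q = t powr (p - q)"
            using mq(2) by (simp flip: powr_add) (simp add: algebra_simps)
          thus ?thesis by (simp add: mult.assoc)
        qed
        finally show ?thesis using 2 by (simp add: sob_comp_def k_def m_def mult.assoc)
      next
        case 3
        thus ?thesis using k0[of i] A by (simp add: sob_comp_def m_def)
      qed
    qed
    hence "sob_of q ?w \<le> L2_set (\<lambda>i. k i * (A * t powr (p - q))) {..Suc m}"
      unfolding sob_of_def m_def by (intro L2_set_mono) (auto simp: sob_comp_nonneg)
    also have "\<dots> = L2_set k {..Suc m} * (A * t powr (p - q))" using A by (simp add: L2_set_left_distrib)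
    also have "\<dots> \<le> (L2_set k {..Suc m} + 1) * (A * t powr (p - q))" using A by (intro mult_right_mono) auto
    finally show ?thesis using sob_rep_sobolev(2)[OF fsum_sob_rep[OF T q(1) S]] by (simp add: mult.assoc)
  qed
  moreover have "0 < L2_set k {..Suc m} + 1" by (intro add_nonneg_pos L2_set_nonneg) simp
  ultimately show ?thesis by blast
qed

lemma fext_interpolation:
  assumes T: "1 < T" and p: "0 < p" and q: "0 \<le> q" "q \<le> p"
  shows "\<exists>C>0. \<forall>c \<epsilon> A. c \<in> diag_dom (alg_weight p) \<longrightarrow> 0 < \<epsilon> \<longrightarrow> \<epsilon> \<le> 1 \<longrightarrow> 0 \<le> A \<longrightarrow>
     ell2_norm (diag_op (alg_weight p) c) \<le> A \<longrightarrow> nrm Lam (fext T c) \<le> A * \<epsilon> \<longrightarrow>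
     sobolev_norm q (fext T c) \<le> C * A * \<epsilon> powr ((p - q) / p)"
proof -
  obtain C1 where C1: "0 < C1" and low: "\<And>S c t A. finite S \<Longrightarrow> 0 < t \<Longrightarrow> t \<le> 1 \<Longrightarrow> 0 \<le> A \<Longrightarrow>
     (\<And>l. l \<in> S \<Longrightarrow> \<bar>real_of_int l\<bar> \<le> 1 / t) \<Longrightarrow>
     c \<in> diag_dom (alg_weight p) \<Longrightarrow> ell2_norm (diag_op (alg_weight p) c) \<le> A \<Longrightarrow>
     nrm Lam (fsum T S c) \<le> A * t powr p \<Longrightarrow> sobolev_norm q (fsum T S c) \<le> C1 * A * t powr (p - q)"
    using fsum_interpolation[OF T p q] by metis
  obtain C2 where C2: "0 < C2" and bd: "\<And>c. c \<in> diag_dom (alg_weight q) \<Longrightarrow>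
      sob_of q (\<lambda>j. fext T (dcoef T j c)) \<le> C2 * ell2_norm (diag_op (alg_weight q) c)"
    using fext_sobolev_bound[OF T q(1)] by blast
  \<comment> \<open>The low part is the whole minus the high part. Their L2 norms are at most
    \<open>A * \<epsilon>\<close> and \<open>sqrt (2 * T) * (A * \<epsilon>)\<close>.\<close>
  define K where "K = 1 + sqrt (2 * T)"
  have K: "1 \<le> K" using T by (simp add: K_def)
  have "sobolev_norm q (fext T c) \<le> (C1 * K + C2 * sqrt 2) * A * \<epsilon> powr ((p - q) / p)"
    if c: "c \<in> diag_dom (alg_weight p)" and e: "0 < \<epsilon>" "\<epsilon> \<le> 1" and A: "0 \<le> A"
      and cA: "ell2_norm (diag_op (alg_weight p) c) \<le> A" and fA: "nrm Lam (fext T c) \<le> A * \<epsilon>" for c \<epsilon> A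
  proof -
    \<comment> \<open>Chosen so that \<open>t powr p = \<epsilon>\<close>: the weight of order
      \<open>p\<close> then exceeds \<open>1 / \<epsilon>\<close> on the high frequencies, which
      makes the high part small in L2 as well.\<close>
    define t where "t = \<epsilon> powr (1 / p)"
    have t: "0 < t" "t \<le> 1" using e p by (auto simp: t_def intro: powr_le1)
    have tp: "t powr p = \<epsilon>" "t powr (p - q) = \<epsilon> powr ((p - q) / p)"
      using e p by (simp_all add: t_def powr_powr)
    define S where "S = {l::int. \<bar>real_of_int l\<bar> \<le> 1 / t}"
    have "S \<subseteq> {- \<lfloor>1 / t\<rfloor>..\<lfloor>1 / t\<rfloor>}"
    proof
      fix l assume "l \<in> S"
      hence "real_of_int l \<le> 1 / t" "real_of_int (- l) \<le> 1 / t" unfolding S_def by auto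
      hence "l \<le> \<lfloor>1 / t\<rfloor>" "- l \<le> \<lfloor>1 / t\<rfloor>" by (simp_all only: le_floor_iff)
      thus "l \<in> {- \<lfloor>1 / t\<rfloor>..\<lfloor>1 / t\<rfloor>}" by auto
    qed
    hence S: "finite S" by (rule finite_subset) simp
    let ?D = "diag_op (alg_weight p) c"
    have D: "?D \<in> ell2" "c \<in> ell2" using c by (auto simp: diag_dom_def)
    define lo where "lo l = (if l \<in> S then c l else 0)" for l
    define hi where "hi l = (if l \<in> S then 0 else c l)" for l
    have hi1: "cmod (hi l) \<le> t powr p * cmod (?D l)"
      and hi2: "cmod (diag_op (alg_weight q) hi l) \<le> (sqrt 2 * t powr (p - q)) * cmod (?D l)" for l
    proof -
      have "cmod (hi l) \<le> t powr p * cmod (?D l) \<and> cmod (diag_op (alg_weight q) hi l) \<le> (sqrt 2 * t powr (p - q)) * cmod (?D l)"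
      proof (cases "l \<in> S")
        case False
        let ?x = "\<bar>real_of_int l\<bar>"
        have x: "1 / t < ?x" using False by (simp add: S_def)
        have "1 \<le> 1 / t" using t by simp
        hence x1: "1 < ?x" "1 < t * ?x" using x t by (linarith, simp add: field_simps)
        have pw: "t powr a * ?x powr a \<ge> 1" if "0 \<le> a" for a
          using x1 t that by (simp add: ge_one_powr_ge_zero flip: powr_mult)
        have wl: "?x powr p \<le> alg_weight p (of_int \<bar>l\<bar>)" using p by (intro weight_le) auto
        have "1 * cmod (c l) \<le> (t powr p * alg_weight p (of_int \<bar>l\<bar>)) * cmod (c l)"
          using pw[of p] p mult_left_mono[OF wl, of "t powr p"] by (intro mult_right_mono) auto
        hence 1: "cmod (hi l) \<le> t powr p * cmod (?D l)"
          using False weight_ge_1[of p "of_int \<bar>l\<bar>"] by (simp add: hi_def diag_op_def norm_mult mult.assoc)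
        \<comment> \<open>For nonzero frequency the summand 1 in the weight is at most the power,
          hence the factor \<open>sqrt 2\<close>.\<close>
        have "alg_weight q (of_int \<bar>l\<bar>) \<le> sqrt 2 * ?x powr q"
        proof -
          have "1 \<le> ?x powr (2 * q)" using x1 q by (intro ge_one_powr_ge_zero) auto
          hence "alg_weight q (of_int \<bar>l\<bar>) \<le> sqrt (2 * ?x powr (2 * q))"
            unfolding alg_weight_def by (intro real_sqrt_le_mono) simp
          also have "?x powr (2 * q) = (?x powr q)\<^sup>2" by (simp add: power2_eq_square flip: powr_add)
          finally show ?thesis by (simp add: real_sqrt_mult)
        qed
        also have "\<dots> \<le> sqrt 2 * (t powr (p - q) * alg_weight p (of_int \<bar>l\<bar>))"
        proof (intro mult_left_mono)
          have "?x powr q * 1 \<le> ?x powr q * (t powr (p - q) * ?x powr (p - q))"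
            using pw[of "p - q"] q by (intro mult_left_mono) auto
          also have "\<dots> = t powr (p - q) * ?x powr p" using x1 by (simp flip: powr_add)
          also have "\<dots> \<le> t powr (p - q) * alg_weight p (of_int \<bar>l\<bar>)" by (intro mult_left_mono wl) auto
          finally show "?x powr q \<le> t powr (p - q) * alg_weight p (of_int \<bar>l\<bar>)" by simp
        qed simp
        finally have "alg_weight q (of_int \<bar>l\<bar>) * cmod (c l) \<le> sqrt 2 * (t powr (p - q) * alg_weight p (of_int \<bar>l\<bar>)) * cmod (c l)"
          by (rule mult_right_mono) simp
        hence "cmod (diag_op (alg_weight q) hi l) \<le> (sqrt 2 * t powr (p - q)) * cmod (?D l)"
          using False weight_ge_1[of p "of_int \<bar>l\<bar>"] weight_ge_1[of q "of_int \<bar>l\<bar>"]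
          by (simp add: hi_def diag_op_def norm_mult mult.assoc)
        thus ?thesis using 1 by blast
      qed (simp add: hi_def diag_op_def)
      thus "cmod (hi l) \<le> t powr p * cmod (?D l)"
        "cmod (diag_op (alg_weight q) hi l) \<le> (sqrt 2 * t powr (p - q)) * cmod (?D l)" by auto
    qed
    have hiE: "hi \<in> ell2" "ell2_norm hi \<le> t powr p * ell2_norm ?D"
      by (rule ell2_comparison[OF D(1) hi1]; simp)+
    have hiQ: "diag_op (alg_weight q) hi \<in> ell2"
      "ell2_norm (diag_op (alg_weight q) hi) \<le> (sqrt 2 * t powr (p - q)) * ell2_norm ?D"
      by (rule ell2_comparison[OF D(1) hi2]; simp)+
    have hid: "hi \<in> diag_dom (alg_weight q)" using hiE hiQ by (simp add: diag_dom_def)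
    have loE: "lo \<in> ell2" by (rule ell2_comparison(1)[OF D(2), where K = 1]) (auto simp: lo_def)
    have "lo = (\<lambda>l. c l - hi l)" by (auto simp: lo_def hi_def)
    hence "AE x in Lam. fext T lo x = fext T c x - fext T hi x" using fext_comb[OF T D(2) hiE(1)] by simp
    moreover have "AE x in Lam. fext T lo x = fsum T S lo x" by (rule fext_finite[OF T S]) (simp add: lo_def)
    moreover have "fsum T S lo = fsum T S c" unfolding lo_def using fsum_restrict[OF S] by simp
    ultimately have ae: "AE x in Lam. fsum T S c x = fext T c x - fext T hi x" by auto
    note Fs = fext_sqi[OF T D(2)] fext_sqi[OF T hiE(1)]
    have nhi: "nrm Lam (fext T hi) \<le> sqrt (2 * T) * (A * \<epsilon>)"
    proof -
      have "nrm Lam (fext T hi) \<le> sqrt (2 * T) * ell2_norm hi" by (rule nrm_fext_le[OF T hiE(1)])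
      also have "\<dots> \<le> sqrt (2 * T) * (t powr p * A)"
        using T hiE(2) order_trans[OF hiE(2) mult_left_mono[OF cA]] by (intro mult_left_mono) auto
      finally show ?thesis by (simp add: tp mult.commute)
    qed
    have "nrm Lam (fsum T S c) = nrm Lam (\<lambda>x. fext T c x - fext T hi x)"
      using Fs by (intro nrm_AE_cong ae sqi_measurable fsum_sqi sqi_diff)
    also have "\<dots> \<le> A * \<epsilon> + sqrt (2 * T) * (A * \<epsilon>)"
      using nrm_diff_le[OF Fs] fA nhi by linarith
    finally have nlo: "nrm Lam (fsum T S c) \<le> (K * A) * t powr p" by (simp add: K_def tp algebra_simps)
    have "ell2_norm ?D \<le> K * A" using cA K A mult_right_mono[of 1 K A] by simp
    hence lowS: "sobolev_norm q (fsum T S c) \<le> C1 * (K * A) * t powr (p - q)"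
      using K A by (intro low[OF S t _ _ c _ nlo]) (auto simp: S_def)
    have hiR: "sob_rep q (fext T hi) (\<lambda>j. fext T (dcoef T j hi))" by (rule fext_sob_rep[OF T q(1) hid])
    have "sobolev_norm q (fext T hi) \<le> C2 * ell2_norm (diag_op (alg_weight q) hi)"
      unfolding sob_rep_sobolev(2)[OF hiR] by (rule bd[OF hid])
    also have "\<dots> \<le> C2 * ((sqrt 2 * t powr (p - q)) * A)"
      using C2 order_trans[OF hiQ(2) mult_left_mono[OF cA]] by (intro mult_left_mono) auto
    finally have hiS: "sobolev_norm q (fext T hi) \<le> C2 * ((sqrt 2 * t powr (p - q)) * A)" .
    have loM: "fsum T S c \<in> sobolev q" by (rule sob_rep_sobolev(1)[OF fsum_sob_rep[OF T q(1) S]])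
    note sumM = sobolev_add[OF loM sob_rep_sobolev(1)[OF hiR]]
    \<comment> \<open>The extension is only almost everywhere the sum of its two parts, so the
      derivatives of the sum are transferred to it.\<close>
    have "AE x in Lam. fsum T S c x + fext T hi x = fext T c x" using ae by auto
    from sob_rep_AE_cong[OF sobolev_sob_rep[OF sumM(1)] this] Fs(1)
    have "sobolev_norm q (fext T c) = sob_of q (\<lambda>j. weak_deriv j (\<lambda>x. fsum T S c x + fext T hi x))"
      by (intro sob_rep_sobolev(2)) (simp add: L2_sqi)
    also have "\<dots> = sobolev_norm q (\<lambda>x. fsum T S c x + fext T hi x)" by (rule sobolev_norm_weak[symmetric])
    also have "\<dots> \<le> C1 * (K * A) * t powr (p - q) + C2 * ((sqrt 2 * t powr (p - q)) * A)"
      using sumM(2) lowS hiS by linarith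
    also have "\<dots> = (C1 * K + C2 * sqrt 2) * A * \<epsilon> powr ((p - q) / p)"
      unfolding tp by (simp add: algebra_simps)
    finally show ?thesis .
  qed
  moreover have "0 < C1 * K + C2 * sqrt 2" using C1 C2 K by (intro add_pos_pos mult_pos_pos) auto
  ultimately show ?thesis by blast
qed

section \<open>Regularization by truncated singular value decomposition\<close>

text \<open>The lower bound 1 makes the inverse diagonal operator a contraction on
  \<open>ell2\<close>; the growth condition is the source of compactness, used in the concrete form
  that the singular values tend to 0.\<close>

locale weight =
  fixes h :: "real \<Rightarrow> real"
  assumes weight_ge: "1 \<le> h (of_int \<bar>l\<bar>)"
    and weight_tendsto: "\<exists>L::int. \<forall>l. L < \<bar>l\<bar> \<longrightarrow> H \<le> h (of_int \<bar>l\<bar>)"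
begin

text \<open>The operator is injective because the weight never vanishes, and it maps its domain onto
  all of \<open>ell2\<close> because division by the weight is bounded.\<close>

lemma diag_inv_eq:
  assumes "y \<in> ell2"
  shows "diag_inv h y \<in> diag_dom h" "diag_op h (diag_inv h y) = y"
    and "diag_inv h y = (\<lambda>l. y l / of_real (h (of_int \<bar>l\<bar>)))"
proof -
  let ?c = "\<lambda>l. y l / of_real (h (of_int \<bar>l\<bar>))"
  have h0: "h (of_int \<bar>l\<bar>) \<noteq> 0" for l using weight_ge[of l] by auto
  have inj: "inj_on (diag_op h) (diag_dom h)"
    unfolding inj_on_def diag_op_def using h0 by (auto simp: fun_eq_iff)
  have "cmod (?c l) \<le> 1 * cmod (y l)" for l
    using weight_ge[of l] by (simp add: norm_divide divide_le_eq mult_le_cancel_left1)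
  hence "?c \<in> ell2" by (intro ell2_comparison(1)[OF assms, where K = 1]) auto
  moreover have op: "diag_op h ?c = y" using h0 by (simp add: diag_op_def)
  ultimately have c: "?c \<in> diag_dom h" using assms by (simp add: diag_dom_def)
  show "diag_inv h y = ?c" unfolding diag_inv_def
    using the_inv_into_f_f[OF inj c] by (simp only: op)
  thus "diag_inv h y \<in> diag_dom h" "diag_op h (diag_inv h y) = y" using c op by simp_all
qed

lemma diag_inv_op:
  assumes "c \<in> diag_dom h" shows "diag_inv h (diag_op h c) = c"
proof -
  have "h (of_int \<bar>l\<bar>) \<noteq> 0" for l using weight_ge[of l] by auto
  thus ?thesis using assms by (subst diag_inv_eq(3)) (auto simp: diag_dom_def diag_op_def)
qed

text \<open>Bessel's inequality makes every coordinate of \<open>v i\<close> tend to 0, and the inverse weight is small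
  on all but finitely many coordinates. Hence the cutoff index is a maximum over a finite set.\<close>

lemma singular_values_null:
  assumes T: "1 < T" and sys: "singular_system T h \<sigma> v u" and e: "0 < e"
  shows "\<exists>k\<ge>1. \<sigma> k \<le> e"
proof -
  have v: "v i \<in> ell2" and u: "u i \<in> sqi Lam" and vv: "\<And>j. 1 \<le> j \<Longrightarrow> ell2_inner (v i) (v j) = (if i = j then 1 else 0)"
    and uu: "L2_inner (u i) (u i) = 1"
    and Gv: "AE x in Lam. Gop T h (v i) x = of_real (\<sigma> i) * u i x" and s0: "0 < \<sigma> i" if "1 \<le> i" for i
    using sys that by (auto simp: singular_system_def L2_sqi)
  have coord: "(\<lambda>i. (cmod (v (Suc i) l))\<^sup>2) \<longlonglongrightarrow> 0" for l
  proof -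
    \<comment> \<open>Bessel for the unit sequence at \<open>l\<close>: its inner products with the
      \<open>v i\<close> are the conjugated coordinates, whose squares are thus summable in
      \<open>i\<close>.\<close>
    let ?e = "\<lambda>k. if k = l then 1 else (0::complex)"
    have E: "?e \<in> ell2" by (rule ell2_finite_support[of "{l}"]) auto
    have nE: "(ell2_norm ?e)\<^sup>2 = 1"
      unfolding ell2_norm_square
      by (subst infsum_cong_neutral[where T = "{l}" and g = "\<lambda>_. 1"]) auto
    have ip: "ell2_inner ?e (v i) = cnj (v i l)" if "1 \<le> i" for i
      unfolding ell2_inner_def
      by (subst infsum_cong_neutral[where T = "{l}" and g = "\<lambda>k. cnj (v i k)"]) auto
    have B: "(\<Sum>i<n. (cmod (v (Suc i) l))\<^sup>2) \<le> 1" for n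
    proof -
      have "(\<Sum>i<n. (cmod (ip (count_space UNIV) ?e (v (Suc i))))\<^sup>2) \<le> (nrm (count_space UNIV) ?e)\<^sup>2"
        using v vv E by (intro bessel) (auto simp: ell2_sqi[symmetric] ell2_inner_ip[symmetric])
      thus ?thesis using nE E v ip
        by (simp add: ell2_inner_ip[symmetric] ell2_norm_nrm[symmetric])
    qed
    have "summable (\<lambda>i. (cmod (v (Suc i) l))\<^sup>2)"
      by (rule bounded_imp_summable[of _ 1], simp, subst lessThan_Suc_atMost[symmetric], rule B)
    thus ?thesis by (rule summable_LIMSEQ_zero)
  qed
  \<comment> \<open>Where the weight is at least \<open>H\<close>, the contribution to the norm of
    the extension is at most \<open>e / 2\<close>. The finitely many other coordinates supply the
    second half.\<close>
  define H where "H = max 1 (2 * sqrt (2 * T) / e)"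
  have H: "1 \<le> H" "sqrt (2 * T) / H \<le> e / 2"
    using e T by (auto simp: H_def max_def field_simps)
  obtain L :: int where L: "\<And>l. L < \<bar>l\<bar> \<Longrightarrow> H \<le> h (of_int \<bar>l\<bar>)" using weight_tendsto[of H] by blast
  have "(\<lambda>i. sqrt (\<Sum>l\<in>{-L..L}. (cmod (v (Suc i) l))\<^sup>2)) \<longlonglongrightarrow> sqrt (\<Sum>l\<in>{-L..L}. 0)"
    by (intro tendsto_real_sqrt tendsto_sum coord)
  from LIMSEQ_D[OF this, of "e / (2 * sqrt (2 * T))"] e T
  obtain i where "norm (sqrt (\<Sum>l\<in>{-L..L}. (cmod (v (Suc i) l))\<^sup>2) - sqrt (\<Sum>l\<in>{-L..L}. 0)) < e / (2 * sqrt (2 * T))"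
    by fastforce
  hence i: "sqrt (\<Sum>l\<in>{-L..L}. (cmod (v (Suc i) l))\<^sup>2) < e / (2 * sqrt (2 * T))" by (simp add: sum_nonneg)
  let ?v = "v (Suc i)" and ?c = "diag_inv h (v (Suc i))"
  let ?a = "sqrt (\<Sum>l\<in>{-L..L}. (cmod (?v l))\<^sup>2)"
  have vE: "?v \<in> ell2" using v by simp
  have v1: "ell2_norm ?v = 1"
  proof -
    have "complex_of_real ((nrm (count_space UNIV) ?v)\<^sup>2) = 1"
      using vv[of "Suc i" "Suc i"] vE by (simp add: ell2_inner_ip ip_self)
    hence "(nrm (count_space UNIV) ?v)\<^sup>2 = 1" by (simp only: of_real_eq_1_iff)
    thus ?thesis using vE by (simp add: ell2_norm_nrm power2_eq_1_iff) (metis nrm_nonneg not_one_le_zero neg_0_le_iff_le)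
  qed
  have "ell2_norm ?c \<le> ?a + 1 / H"
  proof (rule ell2_normI(2))
    fix S :: "int set" assume S: "finite S"
    have le: "(cmod (?c l))\<^sup>2 \<le> (if l \<in> {-L..L} then (cmod (?v l))\<^sup>2 else 0) + (1 / H)\<^sup>2 * (cmod (?v l))\<^sup>2" for l
    proof (cases "l \<in> {-L..L}")
      case True
      have "cmod (?c l) \<le> cmod (?v l)" using weight_ge[of l]
        by (simp add: diag_inv_eq(3)[OF vE] norm_divide divide_le_eq mult_le_cancel_left1)
      hence "(cmod (?c l))\<^sup>2 \<le> (cmod (?v l))\<^sup>2" by (intro power_mono) auto
      thus ?thesis using True by (simp add: add_increasing2)
    next
      case False
      hence "H \<le> h (of_int \<bar>l\<bar>)" by (intro L) auto
      hence "cmod (?c l) \<le> 1 / H * cmod (?v l)" using H(1) weight_ge[of l]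
        by (simp add: diag_inv_eq(3)[OF vE] norm_divide divide_left_mono)
      hence "(cmod (?c l))\<^sup>2 \<le> (1 / H * cmod (?v l))\<^sup>2" by (intro power_mono) auto
      thus ?thesis using False by (auto simp: power_mult_distrib power_divide)
    qed
    have "(\<Sum>l\<in>S. (cmod (?c l))\<^sup>2) \<le> (\<Sum>l\<in>S. if l \<in> {-L..L} then (cmod (?v l))\<^sup>2 else 0) + (1 / H)\<^sup>2 * (\<Sum>l\<in>S. (cmod (?v l))\<^sup>2)"
      using sum_mono[of S, OF le] by (simp add: sum.distrib sum_distrib_left)
    also have "(\<Sum>l\<in>S. if l \<in> {-L..L} then (cmod (?v l))\<^sup>2 else 0) = (\<Sum>l\<in>S \<inter> {-L..L}. (cmod (?v l))\<^sup>2)"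
      by (rule sum.inter_restrict[symmetric, OF S])
    also have "\<dots> \<le> (\<Sum>l\<in>{-L..L}. (cmod (?v l))\<^sup>2)" by (intro sum_mono2) auto
    also have "\<dots> = ?a\<^sup>2" by (simp add: sum_nonneg)
    also have "(\<Sum>l\<in>S. (cmod (?v l))\<^sup>2) \<le> 1" using ell2_sum_le[OF vE S] v1 by simp
    hence "(1 / H)\<^sup>2 * (\<Sum>l\<in>S. (cmod (?v l))\<^sup>2) \<le> (1 / H)\<^sup>2 * 1" by (intro mult_left_mono) auto
    finally have "(\<Sum>l\<in>S. (cmod (?c l))\<^sup>2) \<le> ?a\<^sup>2 + (1 / H)\<^sup>2" by simp
    also have "\<dots> \<le> (?a + 1 / H)\<^sup>2" using H(1) by (simp add: power2_sum sum_nonneg)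
    finally show "(\<Sum>l\<in>S. (cmod (?c l))\<^sup>2) \<le> (?a + 1 / H)\<^sup>2" .
  qed (use H in \<open>simp add: sum_nonneg\<close>)
  moreover have cE: "?c \<in> ell2" using diag_inv_eq(1)[OF vE] by (simp add: diag_dom_def)
  ultimately have "nrm Lam (fext T ?c) \<le> sqrt (2 * T) * (?a + 1 / H)"
    using T by (intro order_trans[OF nrm_fext_le[OF T cE]] mult_left_mono) auto
  also have "\<dots> = sqrt (2 * T) * ?a + sqrt (2 * T) / H" by (simp add: distrib_left)
  also have "\<dots> \<le> e / 2 + e / 2"
  proof (rule add_mono[OF _ H(2)])
    have "sqrt (2 * T) * ?a \<le> sqrt (2 * T) * (e / (2 * sqrt (2 * T)))" using i T by (intro mult_left_mono) auto
    also have "\<dots> = e / 2" using T by simp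
    finally show "sqrt (2 * T) * ?a \<le> e / 2" .
  qed
  finally have "nrm Lam (fext T ?c) \<le> e" by simp
  moreover have "nrm Lam (fext T ?c) = nrm Lam (\<lambda>x. of_real (\<sigma> (Suc i)) * u (Suc i) x)"
    using Gv[of "Suc i"] u[of "Suc i"] fext_sqi[OF T cE]
    by (intro nrm_AE_cong sqi_measurable sqi_cmult) (auto simp: Gop_def)
  moreover have "nrm Lam (u (Suc i)) = 1"
  proof -
    have "complex_of_real ((nrm Lam (u (Suc i)))\<^sup>2) = 1" using uu[of "Suc i"] by (simp add: L2_inner_ip ip_self)
    hence "(nrm Lam (u (Suc i)))\<^sup>2 = 1" by (simp only: of_real_eq_1_iff)
    thus ?thesis by (simp add: power2_eq_1_iff) (metis nrm_nonneg not_one_le_zero neg_0_le_iff_le)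
  qed
  ultimately have "\<sigma> (Suc i) \<le> e" using s0[of "Suc i"] by (simp add: nrm_cmult)
  thus ?thesis by (intro exI[of _ "Suc i"]) auto
qed

lemma cutoff_less_iff:
  assumes T: "1 < T" and sys: "singular_system T h \<sigma> v u" and e: "0 < \<epsilon>" "\<epsilon> < \<sigma> 1" and k: "1 \<le> k"
  shows "\<epsilon> < \<sigma> k \<longleftrightarrow> k \<le> cutoff \<sigma> \<epsilon>"
proof -
  let ?S = "{k. 1 \<le> k \<and> \<epsilon> < \<sigma> k}"
  have dec1: "\<sigma> (Suc i) \<le> \<sigma> i" if "1 \<le> i" for i
    using sys that unfolding singular_system_def by blast
  have dec: "\<sigma> j \<le> \<sigma> i" if "1 \<le> i" "i \<le> j" for i j
    using that(2)
  proof (induction rule: dec_induct)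
    case (step n)
    thus ?case using dec1[of n] that(1) by linarith
  qed simp
  obtain m where m: "1 \<le> m" "\<sigma> m \<le> \<epsilon>" using singular_values_null[OF T sys e(1)] by blast
  have "k < m" if "k \<in> ?S" for k
    using dec[of m k] m that by (cases "k < m") auto
  hence fin: "finite ?S" using finite_subset[of ?S "{..<m}"] by blast
  \<comment> \<open>On the natural numbers \<open>Sup\<close> is a true maximum only for finite
    nonempty sets; index 1 is a member because \<open>\<epsilon> < \<sigma> 1\<close>.\<close>
  have ne: "?S \<noteq> {}" using e by auto
  have Max: "cutoff \<sigma> \<epsilon> = Max ?S" unfolding cutoff_def using fin ne by (rule cSup_eq_Max)
  show ?thesis
  proof
    assume "\<epsilon> < \<sigma> k"
    thus "k \<le> cutoff \<sigma> \<epsilon>" unfolding Max using fin k by (intro Max_ge) auto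
  next
    assume "k \<le> cutoff \<sigma> \<epsilon>"
    moreover have "cutoff \<sigma> \<epsilon> \<in> ?S" unfolding Max by (rule Max_in[OF fin ne])
    ultimately show "\<epsilon> < \<sigma> k" using dec[OF k, of "cutoff \<sigma> \<epsilon>"] by auto
  qed
qed

end

text \<open>The weighted error is \<open>y1 - y2\<close>. Here \<open>y1\<close> is the noise
  filtered by the truncated inverse, of norm at most \<open>sqrt 2\<close>, and \<open>y2\<close> is
  the part of the exact weighted coefficients outside the first singular vectors, of norm at most
  \<open>C0 * E\<close>. These are the two summands of \<open>A\<close>.\<close>

lemma tsvd_error:
  assumes T: "1 < T" and hr: "weight hr" and hs: "\<And>l. 0 < hs (of_int \<bar>l::int\<bar>)"
    and adm: "admissible T hr hs f E C0 cd \<sigma> v u"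
    and e: "0 < \<epsilon>" "\<epsilon> < \<sigma> 1" and fe: "fe \<in> noisy f \<epsilon>"
  defines "c \<equiv> reg_sol hr \<sigma> v u \<epsilon> fe" and "A \<equiv> sqrt 2 + C0 * E"
  shows "c - cd \<in> diag_dom hr" "ell2_norm (diag_op hr (c - cd)) \<le> A"
    "AE x in Lam. fext T c x - f x = fext T (c - cd) x" "nrm Lam (fext T (c - cd)) \<le> A * \<epsilon>"
    "(\<lambda>x. fext T c x - f x) \<in> L2" "0 \<le> A"
proof -
  interpret weight hr by (fact hr)
  let ?C = "count_space (UNIV :: int set)"
  have f: "f \<in> sqi Lam" and wb: "weighted_best_approx T hs f cd" and E: "0 < E" "ell2_norm (diag_op hs cd) \<le> E"
    and C0: "\<And>l::int. hr (of_int \<bar>l\<bar>) / hs (of_int \<bar>l\<bar>) \<le> C0" and sys: "singular_system T hr \<sigma> v u"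
    using adm by (auto simp: admissible_def L2_sqi)
  have cd: "cd \<in> ell2" "diag_op hs cd \<in> ell2" "cd \<in> least_squares_sol T f"
    using wb by (auto simp: weighted_best_approx_def diag_dom_def)
  \<comment> \<open>The sign of \<open>C0\<close> is read off from the ratio of the weights at
    frequency 0.\<close>
  have "0 < hr (of_int \<bar>0\<bar>) / hs (of_int \<bar>0\<bar>)"
    using weight_ge[of 0] hs[of 0] by (intro divide_pos_pos) auto
  hence C0p: "0 \<le> C0" using C0[of 0] by linarith
  have "cmod (diag_op hr cd l) \<le> C0 * cmod (diag_op hs cd l)" for l
  proof -
    have "hr (of_int \<bar>l\<bar>) \<le> C0 * hs (of_int \<bar>l\<bar>)" using C0[of l] hs[of l] by (simp add: divide_le_eq)
    hence "hr (of_int \<bar>l\<bar>) * cmod (cd l) \<le> C0 * hs (of_int \<bar>l\<bar>) * cmod (cd l)" by (rule mult_right_mono) simp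
    thus ?thesis using hs[of l] weight_ge[of l] by (simp add: diag_op_def norm_mult mult.assoc)
  qed
  from ell2_comparison[OF cd(2) this C0p]
  have xd: "diag_op hr cd \<in> ell2" "ell2_norm (diag_op hr cd) \<le> C0 * E"
    using mult_left_mono[OF E(2) C0p] by auto
  let ?x = "diag_op hr cd" and ?\<eta> = "cutoff \<sigma> \<epsilon>"
  have cdd: "cd \<in> diag_dom hr" using cd xd by (simp add: diag_dom_def)
  have Gx: "Gop T hr ?x = fext T cd" by (simp add: Gop_def diag_inv_op[OF cdd])
  have fcd: "AE x in Lam. fext T cd x = f x" using least_squares_sol_AE[OF T _ cd(3)] f by (simp add: L2_sqi)
  have v: "v i \<in> sqi ?C" and vv: "\<And>j. 1 \<le> j \<Longrightarrow> ip ?C (v i) (v j) = (if i = j then 1 else 0)"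
    and u: "u i \<in> sqi Lam" and uu: "\<And>j. 1 \<le> j \<Longrightarrow> ip Lam (u i) (u j) = (if i = j then 1 else 0)"
    and s0: "0 < \<sigma> i" and adj: "\<And>c. c \<in> ell2 \<Longrightarrow> L2_inner (Gop T hr c) (u i) = ell2_inner c (\<lambda>l. of_real (\<sigma> i) * v i l)"
    if "1 \<le> i" for i
    using sys that by (auto simp: singular_system_def L2_sqi ell2_sqi L2_inner_ip ell2_inner_ip[unfolded ell2_sqi])
  have x: "?x \<in> sqi ?C" using xd by (simp add: ell2_sqi)
  define g where "g x = fe x - f x" for x
  have feL: "fe \<in> sqi Lam" "\<And>x. x \<in> {-1..1} \<Longrightarrow> cmod (fe x - f x) \<le> \<epsilon>"
    using fe by (auto simp: noisy_def L2_sqi)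
  have g: "g \<in> sqi Lam" unfolding g_def[abs_def] using feL f by (intro sqi_diff)
  have gn: "nrm Lam g \<le> sqrt 2 * \<epsilon>"
    unfolding L2_norm_nrm[symmetric] using g feL(2) e by (intro L2_norm_le_bound) (auto simp: L2_sqi g_def)
  \<comment> \<open>Exact data satisfy \<open>f = Gop T hr ?x\<close> almost everywhere, so the
    adjoint relation expresses their coefficients through those of \<open>?x\<close>.\<close>
  have fu: "ip Lam f (u i) = of_real (\<sigma> i) * ip ?C ?x (v i)" if "1 \<le> i" for i
  proof -
    have "ip Lam f (u i) = ip Lam (fext T cd) (u i)"
      using f u[OF that] fext_sqi[OF T cd(1)] fcd by (intro ip_AE_cong sqi_measurable) auto
    also have "\<dots> = ell2_inner ?x (\<lambda>l. of_real (\<sigma> i) * v i l)" using adj[OF that xd(1)] by (simp add: Gx L2_inner_ip)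
    also have "\<dots> = ip ?C ?x (\<lambda>l. of_real (\<sigma> i) * v i l)"
      using x sqi_cmult[OF v[OF that]] by (intro ell2_inner_ip) (auto simp: ell2_sqi)
    finally show ?thesis by (simp add: ip_cmult_right)
  qed
  define a where "a i = of_real (1 / \<sigma> i) * ip Lam g (u i)" for i
  have te: "of_real (1 / \<sigma> i) * ip Lam fe (u i) = a i + ip ?C ?x (v i)" if "1 \<le> i" for i
  proof -
    have "ip Lam fe (u i) = ip Lam g (u i) + ip Lam f (u i)"
      unfolding g_def[abs_def] using ip_diff_left[OF feL(1) f u[OF that]] by simp
    thus ?thesis using s0[OF that] by (simp add: fu[OF that] a_def distrib_left)
  qed
  define y1 where "y1 = (\<lambda>l. \<Sum>i=1..?\<eta>. a i * v i l)"
  define y2 where "y2 = (\<lambda>l. ?x l - (\<Sum>i=1..?\<eta>. ip ?C ?x (v i) * v i l))"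
  define y where "y = (\<lambda>l. y1 l - y2 l)"
  have tsE: "tsvd \<sigma> v u ?\<eta> fe = (\<lambda>l. y l + ?x l)"
  proof
    fix l
    have "tsvd \<sigma> v u ?\<eta> fe l = (\<Sum>i=1..?\<eta>. (a i + ip ?C ?x (v i)) * v i l)"
      unfolding tsvd_def L2_inner_ip by (intro sum.cong refl) (simp only: te atLeastAtMost_iff)
    thus "tsvd \<sigma> v u ?\<eta> fe l = y l + ?x l"
      by (simp add: y_def y1_def y2_def distrib_right sum.distrib)
  qed
  have y1: "y1 \<in> sqi ?C" unfolding y1_def using v by (intro sqi_sum sqi_cmult) auto
  have y2: "y2 \<in> sqi ?C" unfolding y2_def using v x by (intro sqi_diff sqi_sum sqi_cmult) auto
  have y: "y \<in> ell2" unfolding y_def ell2_sqi by (rule sqi_diff[OF y1 y2])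
  have big: "\<epsilon> < \<sigma> i" if "i \<in> {1..?\<eta>}" for i using cutoff_less_iff[OF T sys e, of i] that by auto
  have small: "\<sigma> i \<le> \<epsilon>" if "?\<eta> < i" for i using cutoff_less_iff[OF T sys e, of i] that by fastforce
  have bessu: "(\<Sum>i=1..n. (cmod (ip Lam g (u i)))\<^sup>2) \<le> (nrm Lam g)\<^sup>2" for n
    using u uu g by (intro bessel) auto
  have bessv: "(\<Sum>i=1..n. (cmod (ip ?C ?x (v i)))\<^sup>2) \<le> (nrm ?C ?x)\<^sup>2" for n
    using v vv x by (intro bessel) auto
  have n1: "nrm ?C y1 \<le> sqrt 2"
  proof (rule power2_le_imp_le)
    have "(nrm ?C y1)\<^sup>2 = (\<Sum>i=1..?\<eta>. (cmod (a i))\<^sup>2)"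
      unfolding y1_def using v vv by (intro nrm_orthonormal_sum) auto
    also have "\<dots> \<le> (\<Sum>i=1..?\<eta>. (1 / \<epsilon>)\<^sup>2 * (cmod (ip Lam g (u i)))\<^sup>2)"
    proof (rule sum_mono)
      fix i assume i: "i \<in> {1..?\<eta>}"
      have "1 / \<sigma> i \<le> 1 / \<epsilon>" using big[OF i] e by (intro divide_left_mono) auto
      moreover have "0 < 1 / \<sigma> i" using s0[of i] i by simp
      ultimately have "(1 / \<sigma> i)\<^sup>2 \<le> (1 / \<epsilon>)\<^sup>2" by (intro power_mono) auto
      moreover have "(cmod (a i))\<^sup>2 = (1 / \<sigma> i)\<^sup>2 * (cmod (ip Lam g (u i)))\<^sup>2"
        unfolding a_def norm_mult power_mult_distrib norm_of_real power2_abs ..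
      ultimately show "(cmod (a i))\<^sup>2 \<le> (1 / \<epsilon>)\<^sup>2 * (cmod (ip Lam g (u i)))\<^sup>2"
        by (simp only: mult_right_mono zero_le_power2)
    qed
    also have "\<dots> = (1 / \<epsilon>)\<^sup>2 * (\<Sum>i=1..?\<eta>. (cmod (ip Lam g (u i)))\<^sup>2)" by (simp only: sum_distrib_left)
    also have "\<dots> \<le> (1 / \<epsilon>)\<^sup>2 * (sqrt 2 * \<epsilon>)\<^sup>2"
      using order_trans[OF bessu power_mono[OF gn nrm_nonneg]] by (intro mult_left_mono) auto
    also have "\<dots> = (sqrt 2)\<^sup>2" using e by (simp add: power_mult_distrib power_divide)
    finally show "(nrm ?C y1)\<^sup>2 \<le> (sqrt 2)\<^sup>2" .
  qed simp
  have n2: "nrm ?C y2 \<le> C0 * E"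
  proof -
    have "(nrm ?C y2)\<^sup>2 = (nrm ?C ?x)\<^sup>2 - 2 * Re (\<Sum>i=1..?\<eta>. cnj (ip ?C ?x (v i)) * ip ?C ?x (v i)) + (\<Sum>i=1..?\<eta>. (cmod (ip ?C ?x (v i)))\<^sup>2)"
      unfolding y2_def using v vv x by (intro nrm_diff_orthonormal_sum) auto
    also have "Re (\<Sum>i=1..?\<eta>. cnj (ip ?C ?x (v i)) * ip ?C ?x (v i)) = (\<Sum>i=1..?\<eta>. (cmod (ip ?C ?x (v i)))\<^sup>2)"
      by (simp add: cmod_power2 flip: power2_eq_square)
    finally have "(nrm ?C y2)\<^sup>2 \<le> (nrm ?C ?x)\<^sup>2" by (simp add: sum_nonneg)
    hence "nrm ?C y2 \<le> nrm ?C ?x" by (rule power2_le_imp_le) simp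
    thus ?thesis using xd by (simp add: ell2_norm_nrm)
  qed
  show A0: "0 \<le> A" using C0p E unfolding A_def by (intro add_nonneg_nonneg mult_nonneg_nonneg) auto
  have ny: "ell2_norm y \<le> A"
    using nrm_diff_le[OF y1 y2] n1 n2 y unfolding y_def A_def by (simp add: ell2_norm_nrm)
  have tE: "tsvd \<sigma> v u ?\<eta> fe \<in> ell2"
    unfolding tsE using sqi_add[OF y[unfolded ell2_sqi] x] by (simp add: ell2_sqi)
  have c: "c \<in> diag_dom hr" "diag_op hr c = (\<lambda>l. y l + ?x l)"
    using diag_inv_eq(1,2)[OF tE] unfolding c_def reg_sol_def tsE by auto
  have opd: "diag_op hr (c - cd) = y"
  proof
    fix l
    have "diag_op hr (c - cd) l = diag_op hr c l - ?x l" by (simp add: diag_op_def right_diff_distrib)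
    thus "diag_op hr (c - cd) l = y l" by (simp add: c(2))
  qed
  have cE: "c \<in> ell2" using c(1) by (simp add: diag_dom_def)
  have cdE: "c - cd \<in> ell2" using ell2_diff[OF cE cd(1)] by (simp add: fun_diff_def)
  show dd: "c - cd \<in> diag_dom hr" using cdE y by (simp add: diag_dom_def opd)
  show "ell2_norm (diag_op hr (c - cd)) \<le> A" using ny by (simp add: opd)
  have "AE x in Lam. fext T (c - cd) x = fext T c x - fext T cd x"
    using fext_comb[OF T cE cd(1)] by (simp add: fun_diff_def)
  thus "AE x in Lam. fext T c x - f x = fext T (c - cd) x" using fcd by eventually_elim simp
  show "(\<lambda>x. fext T c x - f x) \<in> L2" unfolding L2_sqi by (intro sqi_diff fext_sqi T cE f)
  have Gy: "Gop T hr y = fext T (c - cd)" using diag_inv_op[OF dd] by (simp add: Gop_def opd)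
  \<comment> \<open>Up to the cutoff the factor \<open>\<sigma> i\<close> cancels the amplification
    exactly and leaves the noise coefficient; past it only the exact coefficient remains, with
    \<open>\<sigma> i \<le> \<epsilon>\<close>.\<close>
  have yv: "cmod (of_real (\<sigma> i) * ell2_inner y (v i)) \<le> (if i \<le> ?\<eta> then cmod (ip Lam g (u i)) else \<epsilon> * cmod (ip ?C ?x (v i)))"
    if i: "1 \<le> i" for i
  proof -
    have eq: "ell2_inner y (v i) = ip ?C y1 (v i) - ip ?C y2 (v i)"
      using y v[OF i] ip_diff_left[OF y1 y2 v[OF i]] unfolding y_def by (simp add: ell2_inner_ip ell2_sqi)
    have s: "ip ?C (\<lambda>l. \<Sum>j=1..?\<eta>. b j * v j l) (v i) = (if i \<le> ?\<eta> then b i else 0)" for b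
    proof -
      have "ip ?C (\<lambda>l. \<Sum>j=1..?\<eta>. b j * v j l) (v i) = (\<Sum>j=1..?\<eta>. b j * ip ?C (v j) (v i))"
        using v i by (subst ip_sum_left) (auto intro: sqi_cmult simp: ip_cmult_left)
      also have "\<dots> = (\<Sum>j=1..?\<eta>. if j = i then b i else 0)" using vv i by (intro sum.cong) auto
      finally show ?thesis using i by (simp add: sum.delta)
    qed
    have "ip ?C y2 (v i) = ip ?C ?x (v i) - (if i \<le> ?\<eta> then ip ?C ?x (v i) else 0)"
    proof -
      have "(\<lambda>l. \<Sum>i=1..?\<eta>. ip ?C ?x (v i) * v i l) \<in> sqi ?C" using v by (intro sqi_sum sqi_cmult) auto
      from ip_diff_left[OF x this v[OF i]] show ?thesis unfolding y2_def s .
    qed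
    hence "ell2_inner y (v i) = (if i \<le> ?\<eta> then a i else - ip ?C ?x (v i))"
      unfolding eq using s[of a] by (simp add: y1_def)
    moreover have "cmod (of_real (\<sigma> i) * a i) = cmod (ip Lam g (u i))" using s0[OF i] by (simp add: a_def)
    moreover have "\<sigma> i * cmod (ip ?C ?x (v i)) \<le> \<epsilon> * cmod (ip ?C ?x (v i))" if "\<not> i \<le> ?\<eta>"
      using small[of i] that by (intro mult_right_mono) auto
    ultimately show ?thesis using s0[OF i] by (simp add: norm_mult)
  qed
  \<comment> \<open>A bound for the partial sums of the singular expansion, uniform in
    \<open>n\<close>; the expansion converges in norm to the extension of the error.\<close>
  have part: "nrm Lam (\<lambda>t. \<Sum>i=1..n. of_real (\<sigma> i) * ell2_inner y (v i) * u i t) \<le> A * \<epsilon>" for n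
  proof (rule power2_le_imp_le)
    have "(nrm Lam (\<lambda>t. \<Sum>i=1..n. of_real (\<sigma> i) * ell2_inner y (v i) * u i t))\<^sup>2
        = (\<Sum>i=1..n. (cmod (of_real (\<sigma> i) * ell2_inner y (v i)))\<^sup>2)"
      using u uu by (intro nrm_orthonormal_sum) auto
    also have "\<dots> \<le> (\<Sum>i=1..n. (cmod (ip Lam g (u i)))\<^sup>2 + \<epsilon>\<^sup>2 * (cmod (ip ?C ?x (v i)))\<^sup>2)"
    proof (rule sum_mono)
      fix i assume "i \<in> {1..n}"
      hence "(cmod (of_real (\<sigma> i) * ell2_inner y (v i)))\<^sup>2
          \<le> (if i \<le> ?\<eta> then cmod (ip Lam g (u i)) else \<epsilon> * cmod (ip ?C ?x (v i)))\<^sup>2"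
        by (intro power_mono yv) auto
      thus "(cmod (of_real (\<sigma> i) * ell2_inner y (v i)))\<^sup>2 \<le> (cmod (ip Lam g (u i)))\<^sup>2 + \<epsilon>\<^sup>2 * (cmod (ip ?C ?x (v i)))\<^sup>2"
        by (auto simp: power_mult_distrib split: if_splits intro: add_increasing add_increasing2)
    qed
    also have "\<dots> \<le> (sqrt 2 * \<epsilon>)\<^sup>2 + \<epsilon>\<^sup>2 * (C0 * E)\<^sup>2"
    proof -
      have "(\<Sum>i=1..n. (cmod (ip Lam g (u i)))\<^sup>2) \<le> (sqrt 2 * \<epsilon>)\<^sup>2"
        by (rule order_trans[OF bessu power_mono[OF gn nrm_nonneg]])
      moreover have "(nrm ?C ?x)\<^sup>2 \<le> (C0 * E)\<^sup>2" using xd by (intro power_mono) (auto simp: ell2_norm_nrm)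
      hence "\<epsilon>\<^sup>2 * (\<Sum>i=1..n. (cmod (ip ?C ?x (v i)))\<^sup>2) \<le> \<epsilon>\<^sup>2 * (C0 * E)\<^sup>2"
        using order_trans[OF bessv] by (intro mult_left_mono) auto
      ultimately show ?thesis by (simp only: sum.distrib sum_distrib_left[symmetric] add_mono)
    qed
    \<comment> \<open>The two sides differ by the nonnegative mixed term of the square.\<close>
    also have "\<dots> \<le> (A * \<epsilon>)\<^sup>2"
    proof -
      have "0 \<le> sqrt 2 * \<epsilon> * (\<epsilon> * (C0 * E))" using e C0p E by simp
      moreover have "(A * \<epsilon>)\<^sup>2 = (sqrt 2 * \<epsilon>)\<^sup>2 + \<epsilon>\<^sup>2 * (C0 * E)\<^sup>2 + 2 * (sqrt 2 * \<epsilon> * (\<epsilon> * (C0 * E)))"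
        unfolding A_def by (simp add: power2_eq_square algebra_simps)
      ultimately show ?thesis by linarith
    qed
    finally show "(nrm Lam (\<lambda>t. \<Sum>i=1..n. of_real (\<sigma> i) * ell2_inner y (v i) * u i t))\<^sup>2 \<le> (A * \<epsilon>)\<^sup>2" .
  qed (use A0 e in simp)
  have "(\<lambda>n. L2_norm (\<lambda>x. Gop T hr y x - (\<Sum>i=1..n. of_real (\<sigma> i) * ell2_inner y (v i) * u i x))) \<longlonglongrightarrow> 0"
    using sys y by (simp add: singular_system_def)
  hence "(\<lambda>n. nrm Lam (\<lambda>x. (\<Sum>i=1..n. of_real (\<sigma> i) * ell2_inner y (v i) * u i x) - fext T (c - cd) x)) \<longlonglongrightarrow> 0"
    unfolding Gy L2_norm_nrm by (subst nrm_minus_commute)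
  hence "(\<lambda>n. nrm Lam (\<lambda>x. \<Sum>i=1..n. of_real (\<sigma> i) * ell2_inner y (v i) * u i x)) \<longlonglongrightarrow> nrm Lam (fext T (c - cd))"
    using u by (intro nrm_tendsto fext_sqi T cdE sqi_sum sqi_cmult) auto
  thus "nrm Lam (fext T (c - cd)) \<le> A * \<epsilon>" by (rule LIMSEQ_le_const2) (use part in auto)
qed

section \<open>Growth of the algebraic and exponential weights\<close>

lemma weight_alg:
  assumes "0 < r" shows "weight (alg_weight r)"
proof
  fix H :: real
  define L where "L = \<lceil>max 1 H powr (1 / r)\<rceil>"
  have "H \<le> alg_weight r (of_int \<bar>l\<bar>)" if "L < \<bar>l\<bar>" for l
  proof -
    have "max 1 H powr (1 / r) \<le> \<bar>real_of_int l\<bar>" using that unfolding L_def by linarith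
    hence "(max 1 H powr (1 / r)) powr r \<le> \<bar>real_of_int l\<bar> powr r" using assms by (intro powr_mono2) auto
    also have "\<dots> \<le> alg_weight r (of_int \<bar>l\<bar>)" using assms by (intro weight_le) auto
    finally show ?thesis using assms by (simp add: powr_powr)
  qed
  thus "\<exists>L::int. \<forall>l. L < \<bar>l\<bar> \<longrightarrow> H \<le> alg_weight r (of_int \<bar>l\<bar>)" by blast
qed (rule weight_ge_1)

text \<open>From \<open>(z / k) ^ k \<le> (1 + z / k) ^ k \<le> exp z\<close> with
  \<open>z = a * \<bar>l\<bar> powr r\<close>: the exponential dominates the power
  \<open>r * k\<close> of the frequency, which is at least \<open>p\<close>. This holds for every
  \<open>p\<close>, which is why the second part allows arbitrary order.\<close>

lemma alg_weight_le_exp_weight: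
  assumes "0 < a" "0 < r" "0 \<le> p"
  shows "\<exists>C>0. \<forall>l::int. alg_weight p (of_int \<bar>l\<bar>) \<le> C * exp_weight a r (of_int \<bar>l\<bar>)"
proof -
  \<comment> \<open>The successor keeps \<open>k\<close> positive when \<open>p = 0\<close>, as
    \<open>k\<close> appears as a divisor.\<close>
  define k where "k = Suc (nat \<lceil>p / r\<rceil>)"
  have k: "p / r \<le> real k" "0 < k" unfolding k_def by (auto, linarith)
  have pk: "p \<le> r * real k" using k(1) assms by (simp add: field_simps)
  have "alg_weight p (of_int \<bar>l\<bar>) \<le> (1 + (real k / a) ^ k) * exp_weight a r (of_int \<bar>l\<bar>)" for l
  proof -
    let ?x = "\<bar>real_of_int l\<bar>" and ?z = "a * \<bar>real_of_int l\<bar> powr r"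
    have z0: "0 \<le> ?z" using assms by simp
    have e1: "1 \<le> exp ?z" using z0 by simp
    have "(1 + ?z / real k) ^ k \<le> exp ?z" using z0 k by (intro exp_ge_one_plus_x_over_n_power_n) auto
    moreover have "(?z / real k) ^ k \<le> (1 + ?z / real k) ^ k" using z0 by (intro power_mono) auto
    ultimately have "(real k / a) ^ k * (?z / real k) ^ k \<le> (real k / a) ^ k * exp ?z"
      using assms by (intro mult_left_mono) auto
    moreover have "(real k / a) ^ k * (?z / real k) ^ k = (?x powr r) ^ k"
      using assms k by (simp flip: power_mult_distrib)
    ultimately have zk: "(?x powr r) ^ k \<le> (real k / a) ^ k * exp ?z" by simp
    have "?x powr p \<le> (?x powr r) ^ k"
    proof (cases "l = 0")
      case False
      hence "1 \<le> ?x" by linarith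
      hence "?x powr p \<le> ?x powr (r * real k)" using pk by (intro powr_mono) auto
      also have "\<dots> = (?x powr r) ^ k" using False by (simp add: powr_powr[symmetric] powr_realpow)
      finally show ?thesis .
    qed simp
    moreover have "alg_weight p (of_int \<bar>l\<bar>) \<le> 1 + ?x powr p"
    proof -
      have "1 + ?x powr (2 * p) \<le> (1 + ?x powr p)\<^sup>2"
        by (simp add: power2_sum) (simp add: power2_eq_square flip: powr_add)
      thus ?thesis unfolding alg_weight_def by (intro real_le_lsqrt) auto
    qed
    ultimately have "alg_weight p (of_int \<bar>l\<bar>) \<le> 1 * exp ?z + (real k / a) ^ k * exp ?z" using zk e1 by linarith
    thus ?thesis by (simp add: exp_weight_def distrib_right)
  qed
  moreover have "0 < 1 + (real k / a) ^ k" using assms by (intro add_pos_nonneg) auto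
  ultimately show ?thesis by blast
qed

lemma weight_exp:
  assumes "0 < a" "0 < r" shows "weight (exp_weight a r)"
proof
  show "1 \<le> exp_weight a r (of_int \<bar>l\<bar>)" for l using assms by (simp add: exp_weight_def)
  fix H :: real
  obtain C where C: "0 < C" "\<And>l::int. alg_weight 1 (of_int \<bar>l\<bar>) \<le> C * exp_weight a r (of_int \<bar>l\<bar>)"
    using alg_weight_le_exp_weight[OF assms, of 1] by auto
  interpret weight "alg_weight 1" by (rule weight_alg) simp
  obtain L :: int where L: "\<And>l. L < \<bar>l\<bar> \<Longrightarrow> C * H \<le> alg_weight 1 (of_int \<bar>l\<bar>)" using weight_tendsto by blast
  have "H \<le> exp_weight a r (of_int \<bar>l\<bar>)" if "L < \<bar>l\<bar>" for l
    using order_trans[OF L[OF that] C(2)] C(1) by simp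
  thus "\<exists>L::int. \<forall>l. L < \<bar>l\<bar> \<longrightarrow> H \<le> exp_weight a r (of_int \<bar>l\<bar>)" by blast
qed

section \<open>Assembling the rates\<close>

lemma unif_bigoI:
  assumes "0 < \<delta>" "\<And>\<epsilon> y. 0 < \<epsilon> \<Longrightarrow> \<epsilon> < \<delta> \<Longrightarrow> y \<in> A \<epsilon> \<Longrightarrow> \<bar>g \<epsilon> y\<bar> \<le> C * b \<epsilon>"
  shows "unif_bigo A g b"
  unfolding unif_bigo_def
  by (intro exI[of _ C] eventually_at_rightI[of 0 \<delta>]) (use assms in auto)

text \<open>The weights \<open>hr\<close> of both parts dominate the algebraic weight of order \<open>p\<close>, which is all
  that the Sobolev bounds of the error need.\<close>

lemma tsvd_sobolev_error:
  assumes T: "1 < T" and hr: "weight hr" and hs: "\<And>l. 0 < hs (of_int \<bar>l::int\<bar>)"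
    and adm: "admissible T hr hs f E C0 cd \<sigma> v u"
    and dom: "0 < D" "\<And>l::int. alg_weight p (of_int \<bar>l\<bar>) \<le> D * hr (of_int \<bar>l\<bar>)" and p: "0 \<le> p"
  defines "c \<equiv> reg_sol hr \<sigma> v u" and "g \<equiv> \<lambda>\<epsilon> fe x. fext T (reg_sol hr \<sigma> v u \<epsilon> fe) x - f x"
  shows "\<And>\<epsilon> fe. \<epsilon> \<in> {0<..<\<sigma> 1} \<Longrightarrow> fe \<in> noisy f \<epsilon> \<Longrightarrow> g \<epsilon> fe \<in> sobolev p"
    and "\<And>\<epsilon> fe C. \<epsilon> \<in> {0<..<\<sigma> 1} \<Longrightarrow> fe \<in> noisy f \<epsilon> \<Longrightarrow>
      (\<And>d. d \<in> diag_dom (alg_weight p) \<Longrightarrow> sob_of p (\<lambda>j. fext T (dcoef T j d)) \<le> C * ell2_norm (diag_op (alg_weight p) d)) \<Longrightarrow>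
      0 < C \<Longrightarrow> sobolev_norm p (g \<epsilon> fe) \<le> C * D * ell2_norm (diag_op hr (c \<epsilon> fe - cd))"
    and "\<And>q. 0 < p \<Longrightarrow> 0 \<le> q \<Longrightarrow> q \<le> p \<Longrightarrow>
      unif_bigo (noisy f) (\<lambda>\<epsilon> fe. sobolev_norm q (g \<epsilon> fe)) (\<lambda>\<epsilon>. \<epsilon> powr ((p - q) / p))"
proof -
  let ?A = "sqrt 2 + C0 * E"
  have err: "c \<epsilon> fe - cd \<in> diag_dom hr" "ell2_norm (diag_op hr (c \<epsilon> fe - cd)) \<le> ?A"
    "AE x in Lam. fext T (c \<epsilon> fe - cd) x = g \<epsilon> fe x" "nrm Lam (fext T (c \<epsilon> fe - cd)) \<le> ?A * \<epsilon>" "g \<epsilon> fe \<in> L2" "0 \<le> ?A"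
    if "\<epsilon> \<in> {0<..<\<sigma> 1}" "fe \<in> noisy f \<epsilon>" for \<epsilon> fe
    using tsvd_error[OF T hr hs adm _ _ that(2)] that(1) by (auto simp: c_def g_def)
  have alg: "d \<in> diag_dom (alg_weight p)" "ell2_norm (diag_op (alg_weight p) d) \<le> D * ell2_norm (diag_op hr d)"
    if d: "d \<in> diag_dom hr" for d
  proof -
    have "cmod (diag_op (alg_weight p) d l) \<le> D * cmod (diag_op hr d l)" for l
      using mult_right_mono[OF dom(2)[of l], of "cmod (d l)"] weight.weight_ge[OF hr, of l] weight_ge_1[of p "of_int \<bar>l\<bar>"]
      by (simp add: diag_op_def norm_mult mult.assoc)
    from ell2_comparison[OF _ this] d dom(1)
    show "d \<in> diag_dom (alg_weight p)" "ell2_norm (diag_op (alg_weight p) d) \<le> D * ell2_norm (diag_op hr d)"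
      by (auto simp: diag_dom_def)
  qed
  have rep: "sob_rep p (g \<epsilon> fe) (\<lambda>j. fext T (dcoef T j (c \<epsilon> fe - cd)))"
    if "\<epsilon> \<in> {0<..<\<sigma> 1}" "fe \<in> noisy f \<epsilon>" for \<epsilon> fe
    by (rule sob_rep_AE_cong[OF fext_sob_rep[OF T p alg(1)[OF err(1)[OF that]]] err(3,5)[OF that]])
  show "g \<epsilon> fe \<in> sobolev p" if "\<epsilon> \<in> {0<..<\<sigma> 1}" "fe \<in> noisy f \<epsilon>" for \<epsilon> fe
    by (rule sob_rep_sobolev(1)[OF rep[OF that]])
  show "sobolev_norm p (g \<epsilon> fe) \<le> C * D * ell2_norm (diag_op hr (c \<epsilon> fe - cd))"
    if e: "\<epsilon> \<in> {0<..<\<sigma> 1}" "fe \<in> noisy f \<epsilon>" and "0 < C"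
      and bd: "\<And>d. d \<in> diag_dom (alg_weight p) \<Longrightarrow> sob_of p (\<lambda>j. fext T (dcoef T j d)) \<le> C * ell2_norm (diag_op (alg_weight p) d)"
    for \<epsilon> fe C
  proof -
    note a = alg[OF err(1)[OF e]]
    have "sobolev_norm p (g \<epsilon> fe) \<le> C * ell2_norm (diag_op (alg_weight p) (c \<epsilon> fe - cd))"
      unfolding sob_rep_sobolev(2)[OF rep[OF e]] by (rule bd[OF a(1)])
    also have "\<dots> \<le> C * (D * ell2_norm (diag_op hr (c \<epsilon> fe - cd)))"
      using \<open>0 < C\<close> by (intro mult_left_mono a) auto
    finally show ?thesis by simp
  qed
  fix q assume "0 < p" "0 \<le> q" "q \<le> p"
  from fext_interpolation[OF T this] obtain C where C: "0 < C"
    and ip: "\<And>d \<epsilon> A. d \<in> diag_dom (alg_weight p) \<Longrightarrow> 0 < \<epsilon> \<Longrightarrow> \<epsilon> \<le> 1 \<Longrightarrow> 0 \<le> A \<Longrightarrow>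
     ell2_norm (diag_op (alg_weight p) d) \<le> A \<Longrightarrow> nrm Lam (fext T d) \<le> A * \<epsilon> \<Longrightarrow>
     sobolev_norm q (fext T d) \<le> C * A * \<epsilon> powr ((p - q) / p)" by metis
  \<comment> \<open>Interpolation takes one constant for two bounds: \<open>?A\<close> serves for
    the L2 norm divided by \<epsilon>, and \<open>D * ?A\<close> for the algebraically weighted
    norm.\<close>
  let ?B = "(1 + D) * ?A"
  have s1: "0 < \<sigma> 1" using adm by (auto simp: admissible_def singular_system_def)
  show "unif_bigo (noisy f) (\<lambda>\<epsilon> fe. sobolev_norm q (g \<epsilon> fe)) (\<lambda>\<epsilon>. \<epsilon> powr ((p - q) / p))"
  \<comment> \<open>Interpolation requires \<open>\<epsilon> \<le> 1\<close>, the error bounds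
    require \<open>\<epsilon> < \<sigma> 1\<close>.\<close>
  proof (rule unif_bigoI[of "min 1 (\<sigma> 1)"])
    fix \<epsilon> fe assume e: "0 < \<epsilon>" "\<epsilon> < min 1 (\<sigma> 1)" "fe \<in> noisy f \<epsilon>"
    hence e': "\<epsilon> \<in> {0<..<\<sigma> 1}" "fe \<in> noisy f \<epsilon>" by auto
    let ?d = "c \<epsilon> fe - cd"
    note er = err[OF e'] and a = alg[OF err(1)[OF e']]
    have "ell2_norm (diag_op (alg_weight p) ?d) \<le> D * ?A"
      using a(2) mult_left_mono[OF er(2), of D] dom(1) by linarith
    also have "\<dots> \<le> ?B" using er(6) by (simp add: distrib_right)
    finally have b1: "ell2_norm (diag_op (alg_weight p) ?d) \<le> ?B" .
    have "?A * \<epsilon> \<le> ?B * \<epsilon>" using er(6) e dom(1) by (intro mult_right_mono) (auto simp: distrib_right)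
    hence b2: "nrm Lam (fext T ?d) \<le> ?B * \<epsilon>" using er(4) by linarith
    have dq: "?d \<in> diag_dom (alg_weight q)"
    proof -
      have "cmod (diag_op (alg_weight q) ?d l) \<le> 1 * cmod (diag_op (alg_weight p) ?d l)" for l
        using mult_right_mono[OF weight_mono[OF \<open>0 \<le> q\<close> \<open>q \<le> p\<close>, of l], of "cmod (?d l)"]
          weight_ge_1[of p "of_int \<bar>l\<bar>"] weight_ge_1[of q "of_int \<bar>l\<bar>"]
        by (simp add: diag_op_def norm_mult)
      from ell2_comparison(1)[OF _ this] a(1) show ?thesis by (auto simp: diag_dom_def)
    qed
    note rq = fext_sob_rep[OF T \<open>0 \<le> q\<close> dq]
    have "sobolev_norm q (g \<epsilon> fe) = sobolev_norm q (fext T ?d)"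
      using sob_rep_sobolev(2)[OF rq] sob_rep_sobolev(2)[OF sob_rep_AE_cong[OF rq er(3,5)]] by simp
    also have "\<dots> \<le> C * ?B * \<epsilon> powr ((p - q) / p)"
      using er(6) dom(1) e by (intro ip[OF a(1) _ _ _ b1 b2]) auto
    finally show "\<bar>sobolev_norm q (g \<epsilon> fe)\<bar> \<le> C * ?B * \<epsilon> powr ((p - q) / p)"
      using sobolev_norm_nonneg[of q "g \<epsilon> fe"] by simp
  qed (use s1 in simp)
qed

lemma tsvd_basic_rates:
  assumes T: "1 < T" and hr: "weight hr" and hs: "\<And>l. 0 < hs (of_int \<bar>l::int\<bar>)"
    and adm: "admissible T hr hs f E C0 cd \<sigma> v u"
  shows "unif_bigo (noisy f) (\<lambda>\<epsilon> fe. L2_norm (\<lambda>x. fext T (reg_sol hr \<sigma> v u \<epsilon> fe) x - f x)) (\<lambda>\<epsilon>. \<epsilon>)"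
    and "unif_bigo (noisy f) (\<lambda>\<epsilon> fe. ell2_norm (diag_op hr (reg_sol hr \<sigma> v u \<epsilon> fe - cd))) (\<lambda>\<epsilon>. 1)"
proof -
  have s1: "0 < \<sigma> 1" using adm by (auto simp: admissible_def singular_system_def)
  have nr: "L2_norm (\<lambda>x. fext T (reg_sol hr \<sigma> v u \<epsilon> fe) x - f x) \<le> (sqrt 2 + C0 * E) * \<epsilon>"
    if "0 < \<epsilon>" "\<epsilon> < \<sigma> 1" "fe \<in> noisy f \<epsilon>" for \<epsilon> fe
  proof -
    note er = tsvd_error[OF T hr hs adm that]
    have "reg_sol hr \<sigma> v u \<epsilon> fe - cd \<in> ell2" using er(1) by (simp add: diag_dom_def)
    hence "nrm Lam (\<lambda>x. fext T (reg_sol hr \<sigma> v u \<epsilon> fe) x - f x) = nrm Lam (fext T (reg_sol hr \<sigma> v u \<epsilon> fe - cd))"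
      using er(5) by (intro nrm_AE_cong er(3) sqi_measurable fext_sqi T) (auto simp: L2_sqi)
    thus ?thesis using er(4) by (simp add: L2_norm_nrm)
  qed
  show "unif_bigo (noisy f) (\<lambda>\<epsilon> fe. L2_norm (\<lambda>x. fext T (reg_sol hr \<sigma> v u \<epsilon> fe) x - f x)) (\<lambda>\<epsilon>. \<epsilon>)"
    by (rule unif_bigoI[OF s1]) (use nr in \<open>auto simp: L2_norm_nrm\<close>)
  show "unif_bigo (noisy f) (\<lambda>\<epsilon> fe. ell2_norm (diag_op hr (reg_sol hr \<sigma> v u \<epsilon> fe - cd))) (\<lambda>\<epsilon>. 1)"
    by (rule unif_bigoI[OF s1, where C = "sqrt 2 + C0 * E"]) (use tsvd_error(2)[OF T hr hs adm] in auto)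
qed

text \<open>The constant \<open>C\<close> is a parameter because the norm
  \<open>1 / C * sobolev_norm r\<close> has to be fixed before \<open>s\<close>, the data and the
  singular system are given.\<close>

lemma alg_weight_case:
  assumes T: "1 < T" and r: "0 < r" and s: "r \<le> s" and C: "0 < C"
    and bd: "\<And>d. d \<in> diag_dom (alg_weight r) \<Longrightarrow>
      sob_of r (\<lambda>j. fext T (dcoef T j d)) \<le> C * ell2_norm (diag_op (alg_weight r) d)"
    and adm: "admissible T (alg_weight r) (alg_weight s) f E C0 cd \<sigma> v u"
  defines "c \<equiv> reg_sol (alg_weight r) \<sigma> v u"
  shows "unif_bigo (noisy f) (\<lambda>\<epsilon> fe. L2_norm (\<lambda>x. fext T (c \<epsilon> fe) x - f x)) (\<lambda>\<epsilon>. \<epsilon>) \<and>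
    (\<forall>\<epsilon>\<in>{0<..<\<sigma> 1}. \<forall>fe\<in>noisy f \<epsilon>.
      (\<lambda>x. fext T (c \<epsilon> fe) x - f x) \<in> sobolev r \<and> c \<epsilon> fe - cd \<in> diag_dom (alg_weight r) \<and>
      1 / C * sobolev_norm r (\<lambda>x. fext T (c \<epsilon> fe) x - f x) \<le> ell2_norm (diag_op (alg_weight r) (c \<epsilon> fe - cd))) \<and>
    unif_bigo (noisy f) (\<lambda>\<epsilon> fe. ell2_norm (diag_op (alg_weight r) (c \<epsilon> fe - cd))) (\<lambda>\<epsilon>. 1) \<and>
    (\<forall>q. 0 \<le> q \<and> q \<le> r \<longrightarrow>
      (\<forall>\<epsilon>\<in>{0<..<\<sigma> 1}. \<forall>fe\<in>noisy f \<epsilon>. (\<lambda>x. fext T (c \<epsilon> fe) x - f x) \<in> sobolev q) \<and>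
      unif_bigo (noisy f) (\<lambda>\<epsilon> fe. sobolev_norm q (\<lambda>x. fext T (c \<epsilon> fe) x - f x)) (\<lambda>\<epsilon>. \<epsilon> powr ((r - q) / r)))"
proof -
  note hr = weight_alg[OF r]
  have hs: "0 < alg_weight s (of_int \<bar>l::int\<bar>)" for l using weight_ge_1[of s "of_int \<bar>l\<bar>"] by linarith
  have dom: "alg_weight q (of_int \<bar>l\<bar>) \<le> 1 * alg_weight r (of_int \<bar>l\<bar>)" if "0 \<le> q" "q \<le> r" for q and l :: int
    using weight_mono[OF that, of l] by simp
  note rates = tsvd_basic_rates[OF T hr hs adm]
  note sob = tsvd_sobolev_error[OF T hr hs adm zero_less_one dom]
  have bound: "1 / C * sobolev_norm r (\<lambda>x. fext T (c \<epsilon> fe) x - f x) \<le> ell2_norm (diag_op (alg_weight r) (c \<epsilon> fe - cd))"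
    if "\<epsilon> \<in> {0<..<\<sigma> 1}" "fe \<in> noisy f \<epsilon>" for \<epsilon> fe
    using sob(2)[OF _ order_refl _ that bd C] r C unfolding c_def by (simp add: field_simps)
  have dd: "c \<epsilon> fe - cd \<in> diag_dom (alg_weight r)" if "\<epsilon> \<in> {0<..<\<sigma> 1}" "fe \<in> noisy f \<epsilon>" for \<epsilon> fe
    using tsvd_error(1)[OF T hr hs adm _ _ that(2)] that(1) unfolding c_def by auto
  have mem: "(\<lambda>x. fext T (c \<epsilon> fe) x - f x) \<in> sobolev q"
    if "0 \<le> q" "q \<le> r" "\<epsilon> \<in> {0<..<\<sigma> 1}" "fe \<in> noisy f \<epsilon>" for \<epsilon> fe q
    using sob(1)[OF that(1,2,1,3,4)] unfolding c_def .
  have rate: "unif_bigo (noisy f) (\<lambda>\<epsilon> fe. sobolev_norm q (\<lambda>x. fext T (c \<epsilon> fe) x - f x)) (\<lambda>\<epsilon>. \<epsilon> powr ((r - q) / r))"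
    if "0 \<le> q" "q \<le> r" for q
    using sob(3)[OF _ order_refl _ r that] r unfolding c_def by simp
  show ?thesis
    by (intro conjI ballI allI impI; (elim conjE)?; rule rates[folded c_def] bound dd mem rate;
      (assumption | use r in simp))
qed

text \<open>For each order \<open>p\<close> the constant is \<open>C * D\<close>: the Sobolev bound
  for the algebraic weight of that order times its domination by the exponential weight.\<close>

lemma exp_weight_case:
  assumes T: "1 < T" and a: "0 < a" and r: "0 < r"
    and adm: "admissible T (exp_weight a r) (exp_weight a s) f E C0 cd \<sigma> v u"
  defines "c \<equiv> reg_sol (exp_weight a r) \<sigma> v u"
  shows "unif_bigo (noisy f) (\<lambda>\<epsilon> fe. L2_norm (\<lambda>x. fext T (c \<epsilon> fe) x - f x)) (\<lambda>\<epsilon>. \<epsilon>) \<and>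
    (\<forall>p\<ge>0. \<exists>Cp. \<forall>\<epsilon>\<in>{0<..<\<sigma> 1}. \<forall>fe\<in>noisy f \<epsilon>.
      (\<lambda>x. fext T (c \<epsilon> fe) x - f x) \<in> sobolev p \<and> c \<epsilon> fe - cd \<in> diag_dom (exp_weight a r) \<and>
      sobolev_norm p (\<lambda>x. fext T (c \<epsilon> fe) x - f x) \<le> Cp * ell2_norm (diag_op (exp_weight a r) (c \<epsilon> fe - cd))) \<and>
    unif_bigo (noisy f) (\<lambda>\<epsilon> fe. ell2_norm (diag_op (exp_weight a r) (c \<epsilon> fe - cd))) (\<lambda>\<epsilon>. 1) \<and>
    (\<forall>p q. 0 < p \<and> 0 \<le> q \<and> q \<le> p \<longrightarrow>
      unif_bigo (noisy f) (\<lambda>\<epsilon> fe. sobolev_norm q (\<lambda>x. fext T (c \<epsilon> fe) x - f x)) (\<lambda>\<epsilon>. \<epsilon> powr ((p - q) / p)))"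
proof -
  note hr = weight_exp[OF a r]
  have hs: "0 < exp_weight a s (of_int \<bar>l::int\<bar>)" for l by (simp add: exp_weight_def)
  note rates = tsvd_basic_rates[OF T hr hs adm]
  have ex: "\<exists>Cp. \<forall>\<epsilon>\<in>{0<..<\<sigma> 1}. \<forall>fe\<in>noisy f \<epsilon>.
      (\<lambda>x. fext T (c \<epsilon> fe) x - f x) \<in> sobolev p \<and> c \<epsilon> fe - cd \<in> diag_dom (exp_weight a r) \<and>
      sobolev_norm p (\<lambda>x. fext T (c \<epsilon> fe) x - f x) \<le> Cp * ell2_norm (diag_op (exp_weight a r) (c \<epsilon> fe - cd))"
    if p: "0 \<le> p" for p
  proof -
    obtain D where D: "0 < D" "\<And>l::int. alg_weight p (of_int \<bar>l\<bar>) \<le> D * exp_weight a r (of_int \<bar>l\<bar>)"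
      using alg_weight_le_exp_weight[OF a r p] by blast
    obtain C where C: "0 < C" "\<And>d. d \<in> diag_dom (alg_weight p) \<Longrightarrow>
        sob_of p (\<lambda>j. fext T (dcoef T j d)) \<le> C * ell2_norm (diag_op (alg_weight p) d)"
      using fext_sobolev_bound[OF T p] by blast
    note sob = tsvd_sobolev_error[OF T hr hs adm D p]
    show ?thesis unfolding c_def
      using sob(1) sob(2)[OF _ _ C(2,1)] tsvd_error(1)[OF T hr hs adm]
      by (intro exI[of _ "C * D"] ballI conjI) auto
  qed
  have rate: "unif_bigo (noisy f) (\<lambda>\<epsilon> fe. sobolev_norm q (\<lambda>x. fext T (c \<epsilon> fe) x - f x)) (\<lambda>\<epsilon>. \<epsilon> powr ((p - q) / p))"
    if pq: "0 < p" "0 \<le> q" "q \<le> p" for p q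
  proof -
    obtain D where D: "0 < D" "\<And>l::int. alg_weight p (of_int \<bar>l\<bar>) \<le> D * exp_weight a r (of_int \<bar>l\<bar>)"
      using alg_weight_le_exp_weight[OF a r, of p] pq by auto
    show ?thesis unfolding c_def
      by (rule tsvd_sobolev_error(3)[OF T hr hs adm D _ pq]) (use pq in simp)
  qed
  show ?thesis
    by (intro conjI allI impI; (elim conjE)?; rule rates[folded c_def] ex rate; assumption)
qed

theorem corollary1:
  fixes T :: real
  assumes "1 < T"
  shows
    "(\<forall>r>0. \<exists>N. equivalent_sobolev_norm r N \<and>
       (\<forall>s\<ge>r. \<forall>hr hs f E C0 cd \<sigma> v u c g.
          hr = alg_weight r \<and> hs = alg_weight s \<and> f \<in> sobolev s \<and>
          admissible T hr hs f E C0 cd \<sigma> v u \<and>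
          c = reg_sol hr \<sigma> v u \<and>
          g = (\<lambda>\<epsilon> fe x. fext T (c \<epsilon> fe) x - f x) \<longrightarrow>
          unif_bigo (noisy f) (\<lambda>\<epsilon> fe. L2_norm (g \<epsilon> fe)) (\<lambda>\<epsilon>. \<epsilon>) \<and>
          (\<forall>\<epsilon>\<in>{0<..<\<sigma> 1}. \<forall>fe\<in>noisy f \<epsilon>.
             g \<epsilon> fe \<in> sobolev r \<and> c \<epsilon> fe - cd \<in> diag_dom hr \<and>
             N (g \<epsilon> fe) \<le> ell2_norm (diag_op hr (c \<epsilon> fe - cd))) \<and>
          unif_bigo (noisy f) (\<lambda>\<epsilon> fe. ell2_norm (diag_op hr (c \<epsilon> fe - cd))) (\<lambda>\<epsilon>. 1) \<and>
          (\<forall>q. 0 \<le> q \<and> q \<le> r \<longrightarrow>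
             (\<forall>\<epsilon>\<in>{0<..<\<sigma> 1}. \<forall>fe\<in>noisy f \<epsilon>. g \<epsilon> fe \<in> sobolev q) \<and>
             unif_bigo (noisy f) (\<lambda>\<epsilon> fe. sobolev_norm q (g \<epsilon> fe))
               (\<lambda>\<epsilon>. \<epsilon> powr ((r - q) / r)))))
     \<and>
     (\<forall>a r s. 0 < a \<and> 0 < r \<and> r \<le> s \<and> s \<le> 1 \<longrightarrow>
       (\<forall>hr hs f E C0 cd \<sigma> v u c g.
          hr = exp_weight a r \<and> hs = exp_weight a s \<and>
          admissible T hr hs f E C0 cd \<sigma> v u \<and>
          c = reg_sol hr \<sigma> v u \<and>
          g = (\<lambda>\<epsilon> fe x. fext T (c \<epsilon> fe) x - f x) \<longrightarrow>
          unif_bigo (noisy f) (\<lambda>\<epsilon> fe. L2_norm (g \<epsilon> fe)) (\<lambda>\<epsilon>. \<epsilon>) \<and>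
          (\<forall>p\<ge>0. \<exists>Cp. \<forall>\<epsilon>\<in>{0<..<\<sigma> 1}. \<forall>fe\<in>noisy f \<epsilon>.
             g \<epsilon> fe \<in> sobolev p \<and> c \<epsilon> fe - cd \<in> diag_dom hr \<and>
             sobolev_norm p (g \<epsilon> fe) \<le> Cp * ell2_norm (diag_op hr (c \<epsilon> fe - cd))) \<and>
          unif_bigo (noisy f) (\<lambda>\<epsilon> fe. ell2_norm (diag_op hr (c \<epsilon> fe - cd))) (\<lambda>\<epsilon>. 1) \<and>
          (\<forall>p q. 0 < p \<and> 0 \<le> q \<and> q \<le> p \<longrightarrow>
             unif_bigo (noisy f) (\<lambda>\<epsilon> fe. sobolev_norm q (g \<epsilon> fe))
               (\<lambda>\<epsilon>. \<epsilon> powr ((p - q) / p)))))"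
proof (rule conjI, intro allI impI, goal_cases)
  case (1 r)
  then obtain C where C: "0 < C" "\<And>d. d \<in> diag_dom (alg_weight r) \<Longrightarrow>
      sob_of r (\<lambda>j. fext T (dcoef T j d)) \<le> C * ell2_norm (diag_op (alg_weight r) d)"
    using fext_sobolev_bound[OF assms, of r] by auto
  show ?case
  \<comment> \<open>Dividing by the embedding constant, which depends on \<open>T\<close> and
    \<open>r\<close> only, turns the Sobolev bound into one with constant 1.\<close>
  proof (rule exI[of _ "\<lambda>g. 1 / C * sobolev_norm r g"], rule conjI)
    show "equivalent_sobolev_norm r (\<lambda>g. 1 / C * sobolev_norm r g)"
      using C(1) by (intro equivalent_sobolev_norm_scaled) simp
  qed (intro allI impI, elim conjE, hypsubst, rule alg_weight_case[OF assms 1 _ C], assumption+)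
next
  case 2
  show ?case
    by (intro allI impI, elim conjE, hypsubst, rule exp_weight_case[OF assms], assumption+)
qed

end
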